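(* Let $k\ge 1$ be an integer and let $C$ be a reduced curve with $r>1$ branches $C_1,\ldots,C_r$. Then $$d_k(C)=\inf\Bigl\{\inf_i\{d_k(C_i)\},\ \inf_{i,j}\{d(C_i,C_j)\}\Bigr\}.$$
   Context: $K$ is an algebraically closed field of arbitrary characteristic. An algebroid curve $C:\{f=0\}$ is the ideal of $K[[x,y]]$ generated by a nonzero power series $f$ without constant term; its multiplicity is $m(C)=\mathrm{ord}\, f$. $C$ is reduced if $f$ has no multiple factors; $C$ is a branch if $f$ is irreducible. The branches of a reduced curve $C:\{f=0\}$ are the curves defined by the irreducible factors of $f$. For $C:\{f=0\}$, $D:\{g=0\}$ put $(C,D)_0=\dim_K K[[x,y]]/(f,g)$ (possibly $+\infty$). For branches $C,D$ put $d(C,D)=\frac{(C,D)_0}{m(C)m(D)}$ (so $d(C,C)=+\infty$); for reduced curves $C,D$ with branches $C_i,D_j$ put $d(C,D)=\inf_{i,j}\{d(C_i,D_j)\}$. The semigroup of a branch $C:\{f=0\}$ is $\Gamma(C)=\{\dim_K K[[x,y]]/(f,g): g\in K[[x,y]],\ g\not\equiv 0\pmod f\}$. Its minimal system of generators $v_0,\dots,v_g$ is defined by $v_0=\min(\Gamma(C)\setminus\{0\})=m(C)$, $v_k=\min(\Gamma(C)\setminus(\mathbb{N}v_0+\cdots+\mathbb{N}v_{k-1}))$ for $1\le k\le g$, and $\Gamma(C)=\mathbb{N}v_0+\cdots+\mathbb{N}v_g$. With $e_k=\gcd(v_0,\dots,v_k)$, the Zariski pairs of $C$ are $(v_k/e_k,\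 e_{k-1}/e_k)$, $1\le k\le g$; thus $C$ has exactly $g$ Zariski pairs (none if $m(C)=1$). For a positive integer $k$, $\mathcal{B}_k$ is the family of branches having at most $k-1$ Zariski pairs, and for a reduced curve $C$, $d_k(C):=\sup\{d(C,W): W\in\mathcal{B}_k\}$ (possibly $+\infty$). *)

theory Defs
  imports
    "HOL-Library.Extended_Real"
    "HOL-Library.Set_Algebras"
    "HOL-Computational_Algebra.Computational_Algebra"
begin

text \<open>
  The ring \<open>K[[x,y]]\<close> is represented as \<open>K[[x]][[y]]\<close>: the coefficient of \<open>x\<^sup>i y\<^sup>j\<close> in \<open>f\<close> is
  \<open>f $ j $ i\<close>.  A curve is an ideal of this ring, hence a set of power series, and not a
  power series up to a unit.
\<close>

type_synonym 'k ps2 = "'k fps fps"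

definition ps2_const :: "'k::zero \<Rightarrow> 'k ps2" where
  "ps2_const c = fps_const (fps_const c)"

definition ps2_ord :: "'k::zero ps2 \<Rightarrow> nat" where
  "ps2_ord f = (LEAST n. \<exists>i j. i + j = n \<and> f $ j $ i \<noteq> 0)"

definition principal :: "'k::comm_ring_1 ps2 \<Rightarrow> 'k ps2 set" where
  "principal f = {f * h | h. True}"

text \<open>\<open>is_curve f C\<close> is the relation written \<open>C : {f = 0}\<close>.\<close>

definition is_curve :: "'k::comm_ring_1 ps2 \<Rightarrow> 'k ps2 set \<Rightarrow> bool" where
  "is_curve f C \<longleftrightarrow> f \<noteq> 0 \<and> f $ 0 $ 0 = 0 \<and> C = principal f"

definition reduced_curve :: "'k::comm_ring_1 ps2 set \<Rightarrow> bool" where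
  "reduced_curve C \<longleftrightarrow> (\<exists>f. is_curve f C \<and> squarefree f)"

definition branch :: "'k::comm_ring_1 ps2 set \<Rightarrow> bool" where
  "branch C \<longleftrightarrow> (\<exists>f. is_curve f C \<and> irreducible f)"

definition branches :: "'k::comm_ring_1 ps2 set \<Rightarrow> 'k ps2 set set" where
  "branches C = {D. \<exists>f p. is_curve f C \<and> irreducible p \<and> p dvd f \<and> is_curve p D}"

text \<open>The order does not depend on the chosen equation; see \<open>curve_mult_eq\<close> below.\<close>

definition curve_mult :: "'k::comm_ring_1 ps2 set \<Rightarrow> nat" where
  "curve_mult C = ps2_ord (SOME f. is_curve f C)"

text \<open>
  \<open>quotient_basis I B\<close>: the residue classes of the elements of the finite set \<open>B\<close> are pairwise
  distinct and form a \<open>K\<close>-basis of \<open>K[[x,y]]/I\<close>.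
\<close>

definition quotient_basis :: "'k::comm_ring_1 ps2 set \<Rightarrow> 'k ps2 set \<Rightarrow> bool" where
  "quotient_basis I B \<longleftrightarrow> finite B \<and>
     (\<forall>c. (\<Sum>b\<in>B. ps2_const (c b) * b) \<in> I \<longrightarrow> (\<forall>b\<in>B. c b = 0)) \<and>
     (\<forall>f. \<exists>c. f - (\<Sum>b\<in>B. ps2_const (c b) * b) \<in> I)"

text \<open>
  \<open>dim\<^sub>K K[[x,y]]/I\<close>.  All finite bases have the same cardinality; if there is none, the infimum
  is the infimum of the empty set, which is \<open>\<infinity>\<close>.
\<close>

definition quotient_dim :: "'k::comm_ring_1 ps2 set \<Rightarrow> enat" where
  "quotient_dim I = (INF B\<in>{B. quotient_basis I B}. enat (card B))"

text \<open>For \<open>C : {f = 0}\<close> and \<open>D : {g = 0}\<close> the elementwise sum \<open>C + D\<close> is the ideal \<open>(f, g)\<close>.\<close>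

definition intersection_mult :: "'k::comm_ring_1 ps2 set \<Rightarrow> 'k ps2 set \<Rightarrow> enat" where
  "intersection_mult C D = quotient_dim (C + D)"

definition branch_contact :: "'k::comm_ring_1 ps2 set \<Rightarrow> 'k ps2 set \<Rightarrow> ereal" where
  "branch_contact C D =
     ereal_of_enat (intersection_mult C D) / ereal (real (curve_mult C) * real (curve_mult D))"

text \<open>On branches this coincides with \<open>branch_contact\<close>; see \<open>contact_eq_branch_contact\<close> below.\<close>

definition contact :: "'k::comm_ring_1 ps2 set \<Rightarrow> 'k ps2 set \<Rightarrow> ereal" where
  "contact C D = (INF A\<in>branches C. INF B\<in>branches D. branch_contact A B)"

definition branch_semigroup :: "'k::comm_ring_1 ps2 set \<Rightarrow> nat set" where
  "branch_semigroup C = {n. \<exists>g. g \<notin> C \<and> quotient_dim (C + principal g) = enat n}"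

definition nat_span :: "nat set \<Rightarrow> nat set" where
  "nat_span S = {n. \<exists>c. n = (\<Sum>s\<in>S. c s * s)}"

text \<open>
  \<open>first_gens \<Gamma> n\<close> is \<open>[v\<^sub>0, \<dots>, v\<^bsub>n-1\<^esub>]\<close>.  As \<open>nat_span {} = {0}\<close>, the first entry is
  \<open>min (\<Gamma> - {0})\<close>.  The entries after the span has reached \<open>\<Gamma>\<close> are meaningless; they are cut off
  in \<open>min_gens\<close>.
\<close>

primrec first_gens :: "nat set \<Rightarrow> nat \<Rightarrow> nat list" where
  "first_gens \<Gamma> 0 = []"
| "first_gens \<Gamma> (Suc n) =
     first_gens \<Gamma> n @ [LEAST v. v \<in> \<Gamma> - nat_span (set (first_gens \<Gamma> n))]"

definition min_gens :: "nat set \<Rightarrow> nat list" where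
  "min_gens \<Gamma> = first_gens \<Gamma> (LEAST n. nat_span (set (first_gens \<Gamma> n)) = \<Gamma>)"

definition zariski_pairs :: "'k::comm_ring_1 ps2 set \<Rightarrow> (nat \<times> nat) list" where
  "zariski_pairs C =
     (let v = min_gens (branch_semigroup C);
          e = (\<lambda>k. Gcd (set (take (Suc k) v)))
      in map (\<lambda>k. (v ! k div e k, e (k - 1) div e k)) [1..<length v])"

definition branch_family :: "nat \<Rightarrow> 'k::comm_ring_1 ps2 set set" where
  "branch_family k = {W. branch W \<and> length (zariski_pairs W) \<le> k - 1}"

definition contact_k :: "nat \<Rightarrow> 'k::comm_ring_1 ps2 set \<Rightarrow> ereal" where
  "contact_k k C = (SUP W\<in>branch_family k. contact C W)"


lemma principal_eq_iff:
  fixes f g :: "'k::comm_ring_1 ps2"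
  shows "principal f = principal g \<longleftrightarrow> f dvd g \<and> g dvd f"
proof -
  have "principal f = {h. f dvd h}" for f :: "'k ps2"
    unfolding principal_def dvd_def by auto
  then show ?thesis
    by (auto intro: dvd_trans)
qed

lemma ps2_ord_mult_le:
  fixes f g :: "'k::comm_ring_1 ps2"
  assumes "f dvd g" "g \<noteq> 0"
  shows "ps2_ord f \<le> ps2_ord g"
proof -
  from assms obtain h where h: "g = f * h" by (auto simp: dvd_def)
  obtain j0 i0 where "g $ j0 $ i0 \<noteq> 0"
    using assms(2) by (metis fps_ext fps_zero_nth)
  then have "\<exists>n i j. i + j = n \<and> g $ j $ i \<noteq> 0" by auto
  from LeastI_ex[OF this] obtain i j where ij: "i + j = ps2_ord g" "g $ j $ i \<noteq> 0"
    unfolding ps2_ord_def by auto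
  have "\<exists>a b. a \<le> j \<and> b \<le> i \<and> f $ a $ b \<noteq> 0"
  proof (rule ccontr)
    assume "\<not> ?thesis"
    then have "g $ j $ i = 0"
      unfolding h fps_mult_nth fps_sum_nth by (intro sum.neutral ballI) auto
    with ij show False by simp
  qed
  then obtain a b where ab: "a \<le> j" "b \<le> i" "f $ a $ b \<noteq> 0" by auto
  then have "ps2_ord f \<le> b + a"
    unfolding ps2_ord_def by (intro Least_le) auto
  with ab ij show ?thesis by linarith
qed

lemma curve_mult_eq:
  fixes f :: "'k::comm_ring_1 ps2"
  assumes "is_curve f C"
  shows "curve_mult C = ps2_ord f"
proof -
  have "is_curve (SOME f. is_curve f C) C" using assms by (rule someI)
  with assms show ?thesis
    unfolding curve_mult_def
    by (intro antisym ps2_ord_mult_le) (auto simp: is_curve_def principal_eq_iff)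
qed

lemma branches_branch:
  fixes C :: "'k::field ps2 set"
  assumes "branch C"
  shows "branches C = {C}"
proof -
  from assms obtain f where f: "is_curve f C" "irreducible f"
    by (auto simp: branch_def)
  have "D = C" if *: "is_curve g C" "irreducible p" "p dvd g" "is_curve p D" for g p D
  proof -
    have "f dvd g" "g dvd f"
      using f *(1) by (auto simp: is_curve_def principal_eq_iff)
    then obtain q where q: "f = p * q"
      using *(3) by (metis dvd_trans dvdE)
    then have "q dvd 1"
      using f(2) *(2) by (auto simp: irreducible_def)
    then obtain u where "1 = q * u" by (auto simp: dvd_def)
    then have "p = f * u" using q by (simp add: mult.assoc)
    then have "f dvd p" by simp
    with q have "principal p = principal f" by (simp add: principal_eq_iff)
    with f * show ?thesis by (simp add: is_curve_def)
  qed
  moreover have "C \<in> branches C"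
    using f dvd_refl[of f] unfolding branches_def by blast
  ultimately show ?thesis unfolding branches_def by blast
qed

lemma contact_eq_branch_contact:
  fixes C D :: "'k::field ps2 set"
  assumes "branch C" "branch D"
  shows "contact C D = branch_contact C D"
  using assms by (simp add: contact_def branches_branch)

end

theory Submission
  imports "HOL-Algebra.Algebraic_Closure_Type" Defs
begin

text \<open>
  The heart of the matter is the strong triangle inequality
  \<open>d(C,E) \<ge> min (d(C,D)) (d(D,E))\<close> for branches (\<open>branch_contact_strong_triangle\<close>).  Given it, the
  theorem is formal.  If \<open>W\<close> is a branch, then \<open>d(C,W)\<close> is the least of the numbers \<open>d(C_i,W)\<close>.  So it
  is at most \<open>d_k(C_i)\<close> for all \<open>i\<close> if \<open>W\<close> belongs to the family that defines \<open>d_k\<close>, and it is at most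
  \<open>d(C_i,C_j)\<close> for all \<open>i\<close> and \<open>j\<close>, being a lower bound for both \<open>d(C_i,W)\<close> and \<open>d(W,C_j)\<close>.
  Conversely, a branch \<open>W\<close> that is close to \<open>C_1\<close> is close to every \<open>C_i\<close>, because \<open>C_i\<close> is
  close to \<open>C_1\<close>.

  For the inequality, a substitution \<open>x \<mapsto> x + c y\<close> with general \<open>c\<close> makes each of the three
  branches transversal to the axis \<open>x = 0\<close>; by Weierstrass preparation each of them is then given by
  an irreducible polynomial in \<open>y\<close> over \<open>K[[x]]\<close> whose degree is its multiplicity.  The \<open>x\<close>-adic absolute
  value of \<open>K((x))\<close> extends to an absolute value on the algebraic closure that is the same for
  conjugate elements.  If \<open>f\<close> has degree \<open>n\<close> and the root \<open>\<alpha>\<close>, then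
  \<open>(f,g)_0 = - n log_2 \<bar>g(\<alpha>)\<bar>\<close>, where \<open>\<bar>x\<bar> = 1/2\<close> (\<open>codim_eq_nrm\<close>).  Hence \<open>2\<close> to the power
  \<open>-d(f,g)\<close> is the geometric mean of the distances from \<open>\<alpha>\<close> to the roots of \<open>g\<close>
  (\<open>quotient_dim_eq_contact_of_sep\<close>).

  This mean is controlled by an ultrametric.  Replace every distance \<open>\<bar>\<alpha> - \<beta>\<bar>\<close> by
  \<open>max r \<bar>\<alpha> - \<beta>\<bar>\<close>.  The resulting mean still does not depend on the choice of the root
  \<open>\<alpha>\<close> of \<open>f\<close>: it is the Gauss norm, for the radius \<open>r\<close>, of the Taylor polynomial
  of \<open>g\<close> at \<open>\<alpha>\<close> (\<open>prox_conjugate\<close>).  If some root of \<open>f\<close> has distance at most \<open>r\<close> from some root of \<open>g\<close>,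
  then \<open>f\<close> and \<open>g\<close> have the same mean of radius \<open>r\<close> to every third polynomial, as points at
  distance at most \<open>r\<close> cannot be told apart.  Taking for \<open>r\<close> the larger one of the distances
  between the root sets of \<open>f\<close> and \<open>g\<close> and of \<open>g\<close> and \<open>h\<close>, one obtains the mean of \<open>g\<close> to itself on the
  way from \<open>f\<close> to \<open>h\<close>; this mean equals the one of \<open>f\<close> to \<open>g\<close> or the one of \<open>g\<close> to \<open>h\<close>
  (\<open>prox_strong_triangle\<close>).
\<close>

hide_const (open) Divisibility.irreducible

section \<open>Finite codimension in \<open>K[[x,y]]\<close>\<close>

lemma ps2_const_simps [simp]:
  "ps2_const 0 = 0" "ps2_const 1 = 1"
  by (simp_all add: ps2_const_def fps_const_0_eq_0 fps_const_1_eq_1)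

lemma ps2_const_add: "ps2_const (a + b) = ps2_const a + ps2_const (b :: 'k :: comm_ring_1)"
  and ps2_const_mult: "ps2_const (a * b) = ps2_const a * ps2_const (b :: 'k :: comm_ring_1)"
  by (simp_all add: ps2_const_def)

interpretation ps2: vector_space "\<lambda>(c :: 'k :: field) (v :: 'k ps2). ps2_const c * v"
  by unfold_locales (simp_all add: ps2_const_add ps2_const_mult algebra_simps)

definition independent_mod :: "'k::field ps2 set \<Rightarrow> 'k ps2 set \<Rightarrow> bool" where
  "independent_mod I S \<longleftrightarrow> (\<forall>c. (\<Sum>b\<in>S. ps2_const (c b) * b) \<in> I \<longrightarrow> (\<forall>b\<in>S. c b = 0))"

lemma quotient_basis_altdef:
  "quotient_basis I B \<longleftrightarrow> finite B \<and> independent_mod I B \<and> (\<forall>h. \<exists>t\<in>ps2.span B. h - t \<in> I)"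
  unfolding quotient_basis_def independent_mod_def
  by (cases "finite B") (auto simp: ps2.span_finite image_iff)

text \<open>
  Every element of \<open>S\<close> can be moved modulo \<open>I\<close> into the span of \<open>B\<close>.  The moved elements stay
  independent, so the exchange lemma in \<open>K[[x,y]]\<close> itself bounds their number, and the quotient
  space is never formed.
\<close>

lemma independent_mod_card_le:
  assumes I: "ps2.subspace I" and B: "quotient_basis I B" and S: "finite S" "independent_mod I S"
  shows "card S \<le> card B"
proof -
  from B have finB: "finite B" and "\<forall>h. \<exists>t\<in>ps2.span B. h - t \<in> I"
    unfolding quotient_basis_altdef by auto
  then obtain t where t: "\<And>h. t h \<in> ps2.span B" "\<And>h. h - t h \<in> I" by metis
  have key: "(\<Sum>s\<in>S. ps2_const (c s) * s) \<in> I" if "(\<Sum>s\<in>S. ps2_const (c s) * t s) = 0" for c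
  proof -
    have "(\<Sum>s\<in>S. ps2_const (c s) * (s - t s)) \<in> I"
      by (intro ps2.subspace_sum I ps2.subspace_scale t)
    with that show ?thesis by (simp add: right_diff_distrib sum_subtractf)
  qed
  have inj: "inj_on t S"
  proof (rule inj_onI, rule ccontr)
    fix s s' assume s: "s \<in> S" "s' \<in> S" "t s = t s'" "s \<noteq> s'"
    define c :: "'a ps2 \<Rightarrow> 'a" where "c = (\<lambda>x. if x = s then 1 else if x = s' then -1 else 0)"
    have "(\<Sum>x\<in>S. ps2_const (c x) * t x) = (\<Sum>x\<in>{s, s'}. ps2_const (c x) * t x)"
      by (intro sum.mono_neutral_right) (use S(1) s in \<open>auto simp: c_def\<close>)
    also have "\<dots> = (ps2_const 1 + ps2_const (-1)) * t s"
      using s(3,4) by (simp add: c_def distrib_right)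
    also have "\<dots> = 0"
      by (simp del: ps2_const_simps add: ps2_const_add [symmetric])
    finally have "c s = 0" using key S(2) s(1) unfolding independent_mod_def by blast
    then show False by (simp add: c_def)
  qed
  have "ps2.independent (t ` S)"
  proof (rule ps2.independent_if_scalars_zero)
    fix g x assume g: "(\<Sum>x\<in>t ` S. ps2_const (g x) * x) = 0" and "x \<in> t ` S"
    then obtain s where "s \<in> S" "x = t s" by auto
    moreover have "(\<Sum>s\<in>S. ps2_const (g (t s)) * t s) = 0"
      using g by (simp add: sum.reindex[OF inj])
    ultimately show "g x = 0"
      using key[of "\<lambda>s. g (t s)"] S(2)[unfolded independent_mod_def, rule_format, of "\<lambda>s. g (t s)" s]
      by simp
  qed (use S in auto)
  from ps2.independent_span_bound[OF finB this] t
  have "card (t ` S) \<le> card B" by auto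
  then show ?thesis by (simp add: card_image[OF inj])
qed

definition has_codim :: "'k::field ps2 set \<Rightarrow> nat \<Rightarrow> bool" where
  "has_codim I n \<longleftrightarrow> (\<exists>B. quotient_basis I B \<and> card B = n)"

lemma quotient_basis_card_unique:
  assumes "ps2.subspace I" "quotient_basis I B" "quotient_basis I B'"
  shows "card B = card B'"
proof (rule antisym)
  have fin: "finite B" "independent_mod I B" "finite B'" "independent_mod I B'"
    using assms(2,3) by (simp_all add: quotient_basis_altdef)
  show "card B \<le> card B'"
    by (rule independent_mod_card_le[OF assms(1,3) fin(1,2)])
  show "card B' \<le> card B"
    by (rule independent_mod_card_le[OF assms(1,2) fin(3,4)])
qed

lemma has_codim_unique: "ps2.subspace I \<Longrightarrow> has_codim I m \<Longrightarrow> has_codim I n \<Longrightarrow> m = n"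
  unfolding has_codim_def using quotient_basis_card_unique by blast

lemma quotient_dim_eq:
  assumes "ps2.subspace I" "has_codim I n"
  shows "quotient_dim I = enat n"
proof -
  from assms obtain B where B: "quotient_basis I B" "card B = n" by (auto simp: has_codim_def)
  have "(\<lambda>B. enat (card B)) ` {B. quotient_basis I B} = {enat n}"
  proof (intro equalityI subsetI)
    fix x assume "x \<in> (\<lambda>B. enat (card B)) ` {B. quotient_basis I B}"
    then obtain B' where "quotient_basis I B'" "x = enat (card B')" by blast
    then show "x \<in> {enat n}"
      using quotient_basis_card_unique[OF assms(1) B(1), of B'] B(2) by simp
  qed (use B in blast)
  then show ?thesis by (simp add: quotient_dim_def)
qed

lemma quotient_dim_infinite: "(\<nexists>n. has_codim I n) \<Longrightarrow> quotient_dim I = \<infinity>"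
  unfolding has_codim_def quotient_dim_def by (simp add: Inf_enat_def)

text \<open>
  A subset of \<open>B\<close> that is maximal among those independent modulo \<open>J\<close> also spans modulo \<open>J\<close>.
\<close>

lemma quotient_basis_superspace:
  assumes I: "ps2.subspace J" "I \<subseteq> J" and B: "quotient_basis I B"
  obtains B' where "B' \<subseteq> B" "quotient_basis J B'"
proof -
  let ?P = "\<lambda>S. S \<subseteq> B \<and> independent_mod J S"
  have finB: "finite B" and spB: "\<forall>h. \<exists>t\<in>ps2.span B. h - t \<in> I"
    using B unfolding quotient_basis_altdef by auto
  have "?P {}" by (simp add: independent_mod_def)
  moreover have "\<forall>S. ?P S \<longrightarrow> card S < Suc (card B)"
    using finB by (auto simp: less_Suc_eq_le card_mono)
  ultimately obtain S where S: "?P S" and max: "\<And>S'. ?P S' \<Longrightarrow> card S' \<le> card S"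
    using ex_has_greatest_nat[of ?P "{}" card "Suc (card B)"] by blast
  have finS: "finite S" using S finB finite_subset by blast
  define T where "T = {h. \<exists>t\<in>ps2.span S. h - t \<in> J}"
  have T: "ps2.subspace T"
  proof (rule ps2.subspaceI, unfold T_def mem_Collect_eq)
    show "\<exists>t\<in>ps2.span S. 0 - t \<in> J"
      by (rule bexI[of _ 0]) (use I in \<open>auto simp: ps2.span_zero ps2.subspace_0\<close>)
  next
    fix x y assume "\<exists>t\<in>ps2.span S. x - t \<in> J" "\<exists>t\<in>ps2.span S. y - t \<in> J"
    then obtain t u where tu: "t \<in> ps2.span S" "x - t \<in> J" "u \<in> ps2.span S" "y - u \<in> J" by auto
    have "(x + y) - (t + u) \<in> J"
      using ps2.subspace_add[OF I(1) tu(2,4)] by (simp add: add_diff_add)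
    then show "\<exists>t\<in>ps2.span S. x + y - t \<in> J"
      using ps2.span_add[OF tu(1,3)] by blast
  next
    fix c x assume "\<exists>t\<in>ps2.span S. x - t \<in> J"
    then obtain t where "t \<in> ps2.span S" "x - t \<in> J" by auto
    then show "\<exists>t\<in>ps2.span S. ps2_const c * x - t \<in> J"
      using ps2.subspace_scale[OF I(1), of "x - t" c]
      by (intro bexI[of _ "ps2_const c * t"]) (auto simp: right_diff_distrib ps2.span_scale)
  qed
  have "b \<in> T" if "b \<in> B" for b
  proof (cases "b \<in> S")
    case True
    then show ?thesis unfolding T_def
      by (auto intro!: bexI[of _ b] ps2.span_base simp: ps2.subspace_0[OF I(1)])
  next
    case False
    then have "\<not> ?P (insert b S)" using max[of "insert b S"] finS by auto
    then have "\<not> independent_mod J (insert b S)" using S \<open>b \<in> B\<close> by auto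
    then obtain c where c: "(\<Sum>x\<in>insert b S. ps2_const (c x) * x) \<in> J" "\<exists>x\<in>insert b S. c x \<noteq> 0"
      unfolding independent_mod_def by blast
    have c': "ps2_const (c b) * b + (\<Sum>x\<in>S. ps2_const (c x) * x) \<in> J"
      using c(1) False finS by simp
    have "c b \<noteq> 0"
    proof
      assume "c b = 0"
      then have "\<forall>x\<in>S. c x = 0" using c' S by (simp add: independent_mod_def)
      with \<open>c b = 0\<close> c(2) show False by auto
    qed
    define t where "t = ps2_const (- inverse (c b)) * (\<Sum>x\<in>S. ps2_const (c x) * x)"
    have "t \<in> ps2.span S"
      unfolding t_def by (intro ps2.span_scale ps2.span_sum ps2.span_base)
    moreover have "b - t = ps2_const (inverse (c b)) * (ps2_const (c b) * b + (\<Sum>x\<in>S. ps2_const (c x) * x))"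
    proof -
      have "ps2_const (- inverse (c b)) = - ps2_const (inverse (c b))"
        by (simp add: ps2_const_def)
      moreover have "ps2_const (inverse (c b)) * ps2_const (c b) = 1"
        using \<open>c b \<noteq> 0\<close> by (simp add: ps2_const_mult [symmetric])
      ultimately show ?thesis
        unfolding t_def distrib_left by (simp add: mult.assoc[symmetric])
    qed
    ultimately show ?thesis
      unfolding T_def using ps2.subspace_scale[OF I(1) c', of "inverse (c b)"]
      by (auto intro!: bexI[of _ t])
  qed
  then have "ps2.span B \<subseteq> T" using T by (intro ps2.span_minimal) auto
  have "h \<in> T" for h
  proof -
    obtain t where t: "t \<in> ps2.span B" "h - t \<in> J" using spB I(2) by blast
    have "h - t \<in> T" unfolding T_def using t by (auto intro!: bexI[of _ 0] ps2.span_zero)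
    with t \<open>ps2.span B \<subseteq> T\<close> have "(h - t) + t \<in> T" by (intro ps2.subspace_add[OF T]) auto
    then show ?thesis by simp
  qed
  then have "quotient_basis J S"
    unfolding quotient_basis_altdef using S finS unfolding T_def by auto
  with S that show ?thesis by blast
qed

lemma has_codim_superspace:
  assumes "ps2.subspace J" "I \<subseteq> J" "has_codim I n"
  obtains m where "m \<le> n" "has_codim J m"
proof -
  from assms(3) obtain B where B: "quotient_basis I B" "card B = n" by (auto simp: has_codim_def)
  from quotient_basis_superspace[OF assms(1,2) B(1)] obtain B' where "B' \<subseteq> B" "quotient_basis J B'"
    by blast
  moreover have "card B' \<le> n"
    using B \<open>B' \<subseteq> B\<close> by (auto simp: quotient_basis_def intro: card_mono)
  ultimately show ?thesis using that unfolding has_codim_def by blast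
qed

lemma mem_principal_plus:
  "h \<in> principal f + principal g \<longleftrightarrow> (\<exists>p q. h = f * p + g * q)"
  by (auto simp: principal_def set_plus_def)

lemma subspace_principal_plus [simp]: "ps2.subspace (principal f + principal g)"
  unfolding ps2.subspace_def
proof (intro conjI ballI allI)
  show "0 \<in> principal f + principal g"
    unfolding mem_principal_plus by (metis add_0 mult_zero_right)
next
  fix x y assume "x \<in> principal f + principal g" "y \<in> principal f + principal g"
  then obtain p q p' q' where "x = f * p + g * q" "y = f * p' + g * q'"
    unfolding mem_principal_plus by blast
  then have "x + y = f * (p + p') + g * (q + q')" by (simp add: algebra_simps)
  then show "x + y \<in> principal f + principal g" unfolding mem_principal_plus by blast
next
  fix c x assume "x \<in> principal f + principal g"
  then obtain p q where "x = f * p + g * q" unfolding mem_principal_plus by blast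
  then have "ps2_const c * x = f * (ps2_const c * p) + g * (ps2_const c * q)"
    by (simp add: algebra_simps)
  then show "ps2_const c * x \<in> principal f + principal g" unfolding mem_principal_plus by blast
qed

text \<open>
  Additivity of the intersection number.  Multiplication by \<open>a\<close> embeds
  \<open>K[[x,y]]/(f,b)\<close> into \<open>K[[x,y]]/(f,ab)\<close> with cokernel \<open>K[[x,y]]/(f,a)\<close>, since \<open>a\<close> is not a zero
  divisor modulo \<open>f\<close>.
\<close>

lemma has_codim_mult:
  assumes reg: "\<And>h. f dvd a * h \<Longrightarrow> f dvd h" and a: "a \<noteq> 0"
    and m: "has_codim (principal f + principal a) m" and n: "has_codim (principal f + principal b) n"
  shows "has_codim (principal f + principal (a * b)) (m + n)"
proof -
  from m obtain A where A: "quotient_basis (principal f + principal a) A" "card A = m"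
    by (auto simp: has_codim_def)
  from n obtain B where B: "quotient_basis (principal f + principal b) B" "card B = n"
    by (auto simp: has_codim_def)
  have finA: "finite A" "finite B" using A B by (auto simp: quotient_basis_def)
  have indA: "(\<Sum>x\<in>A. ps2_const (c x) * x) \<in> principal f + principal a \<Longrightarrow> x \<in> A \<Longrightarrow> c x = 0" for c x
    using A(1) unfolding quotient_basis_def by blast
  have indB: "(\<Sum>x\<in>B. ps2_const (c x) * x) \<in> principal f + principal b \<Longrightarrow> x \<in> B \<Longrightarrow> c x = 0" for c x
    using B(1) unfolding quotient_basis_def by blast
  have inj: "inj_on ((*) a) B" using a by (auto intro: inj_onI)
  have ma: "a * z \<in> principal f + principal a" for z
    unfolding mem_principal_plus by (rule exI[of _ 0], rule exI[of _ z]) simp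
  have disj: "A \<inter> (*) a ` B = {}"
  proof (rule ccontr)
    assume "A \<inter> (*) a ` B \<noteq> {}"
    then obtain z where z: "z \<in> A" "z \<in> (*) a ` B" by blast
    have "(\<Sum>x\<in>A. ps2_const (if x = z then 1 else 0) * x) = (\<Sum>x\<in>A. if x = z then z else 0)"
      by (intro sum.cong) auto
    also have "\<dots> = z"
      using z finA by simp
    finally have "(if z = z then 1 else 0) = (0::'a)"
      using z ma by (intro indA) auto
    then show False by simp
  qed
  have split: "(\<Sum>x\<in>A \<union> (*) a ` B. ps2_const (c x) * x) =
      (\<Sum>x\<in>A. ps2_const (c x) * x) + a * (\<Sum>x\<in>B. ps2_const (c (a * x)) * x)" for c
    using finA disj by (simp add: sum.union_disjoint sum.reindex[OF inj] sum_distrib_left mult.left_commute)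
  have "quotient_basis (principal f + principal (a * b)) (A \<union> (*) a ` B)"
    unfolding quotient_basis_def
  proof (intro conjI allI impI)
    show "finite (A \<union> (*) a ` B)" using finA by auto
  next
    fix c assume "(\<Sum>x\<in>A \<union> (*) a ` B. ps2_const (c x) * x) \<in> principal f + principal (a * b)"
    then obtain p q where pq: "(\<Sum>x\<in>A. ps2_const (c x) * x) +
        a * (\<Sum>x\<in>B. ps2_const (c (a * x)) * x) = f * p + (a * b) * q"
      unfolding split mem_principal_plus by blast
    then have "(\<Sum>x\<in>A. ps2_const (c x) * x) = f * p + a * (b * q - (\<Sum>x\<in>B. ps2_const (c (a * x)) * x))"
      by (simp add: algebra_simps)
    then have "(\<Sum>x\<in>A. ps2_const (c x) * x) \<in> principal f + principal a"
      unfolding mem_principal_plus by blast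
    then have cA: "\<forall>x\<in>A. c x = 0" using indA by blast
    then have "a * ((\<Sum>x\<in>B. ps2_const (c (a * x)) * x) - b * q) = f * p"
      using pq by (simp add: algebra_simps)
    then have "f dvd a * ((\<Sum>x\<in>B. ps2_const (c (a * x)) * x) - b * q)" by simp
    from reg[OF this] obtain r where "(\<Sum>x\<in>B. ps2_const (c (a * x)) * x) - b * q = f * r"
      by (auto simp: dvd_def)
    then have "(\<Sum>x\<in>B. ps2_const (c (a * x)) * x) = f * r + b * q"
      by (simp add: algebra_simps)
    then have "(\<Sum>x\<in>B. ps2_const (c (a * x)) * x) \<in> principal f + principal b"
      unfolding mem_principal_plus by blast
    then have "\<forall>x\<in>B. c (a * x) = 0" using indB[of "\<lambda>x. c (a * x)"] by blast
    with cA show "\<forall>x\<in>A \<union> (*) a ` B. c x = 0" by auto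
  next
    fix h
    obtain c where "h - (\<Sum>x\<in>A. ps2_const (c x) * x) \<in> principal f + principal a"
      using A(1) unfolding quotient_basis_def by blast
    then obtain p q where pq: "h - (\<Sum>x\<in>A. ps2_const (c x) * x) = f * p + a * q"
      unfolding mem_principal_plus by blast
    obtain d where "q - (\<Sum>x\<in>B. ps2_const (d x) * x) \<in> principal f + principal b"
      using B(1) unfolding quotient_basis_def by blast
    then obtain p' q' where pq': "q - (\<Sum>x\<in>B. ps2_const (d x) * x) = f * p' + b * q'"
      unfolding mem_principal_plus by blast
    define e where "e = (\<lambda>x. if x \<in> A then c x else d (inv_into B ((*) a) x))"
    have "(\<Sum>x\<in>A. ps2_const (e x) * x) = (\<Sum>x\<in>A. ps2_const (c x) * x)"
      by (intro sum.cong) (auto simp: e_def)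
    moreover have "(\<Sum>x\<in>B. ps2_const (e (a * x)) * x) = (\<Sum>x\<in>B. ps2_const (d x) * x)"
      using disj by (intro sum.cong) (auto simp: e_def inv_into_f_f[OF inj])
    moreover have "h - ((\<Sum>x\<in>A. ps2_const (c x) * x) + a * (\<Sum>x\<in>B. ps2_const (d x) * x)) =
        f * (p + a * p') + (a * b) * q'"
    proof -
      define s where "s = (\<Sum>x\<in>A. ps2_const (c x) * x)"
      define t where "t = (\<Sum>x\<in>B. ps2_const (d x) * x)"
      have "h = s + f * p + a * q" "q = t + f * p' + b * q'"
        using pq pq' unfolding s_def[symmetric] t_def[symmetric] by (simp_all add: diff_eq_eq add.commute add.assoc)
      then have "h - (s + a * t) = f * (p + a * p') + (a * b) * q'"
        by (simp only:) (simp add: algebra_simps)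
      then show ?thesis by (simp only: s_def t_def)
    qed
    ultimately have "h - (\<Sum>x\<in>A \<union> (*) a ` B. ps2_const (e x) * x) = f * (p + a * p') + (a * b) * q'"
      unfolding split by simp
    then show "\<exists>c. h - (\<Sum>x\<in>A \<union> (*) a ` B. ps2_const (c x) * x) \<in> principal f + principal (a * b)"
      unfolding mem_principal_plus by blast
  qed
  moreover have "card (A \<union> (*) a ` B) = m + n"
    using finA disj A B by (simp add: card_Un_disjoint card_image[OF inj])
  ultimately show ?thesis unfolding has_codim_def by blast
qed

section \<open>Weierstrass division and preparation\<close>

text \<open>
  The series \<open>f(0,y)\<close> has order \<open>n\<close>.
\<close>

definition ps2_regular :: "nat \<Rightarrow> 'k::comm_ring_1 ps2 \<Rightarrow> bool" where
  "ps2_regular n f \<longleftrightarrow> (\<forall>j<n. f $ j $ 0 = 0) \<and> f $ n $ 0 \<noteq> 0"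

text \<open>
  The coefficient of \<open>x^i\<close> as a power series in \<open>y\<close>.  Weierstrass division proceeds by
  powers of \<open>x\<close>, which is the inner variable of \<open>ps2\<close>.
\<close>

definition xslice :: "nat \<Rightarrow> 'k::comm_ring_1 ps2 \<Rightarrow> 'k fps" where
  "xslice i f = Abs_fps (\<lambda>j. f $ j $ i)"

lemma xslice_nth [simp]: "xslice i f $ j = f $ j $ i"
  by (simp add: xslice_def)

lemma ps2_eqI: "(\<And>i. xslice i f = xslice i g) \<Longrightarrow> f = g"
  by (metis fps_ext xslice_nth)

lemma xslice_add [simp]: "xslice i (f + g) = xslice i f + xslice i g"
  and xslice_diff [simp]: "xslice i (f - g) = xslice i f - xslice i g"
  and xslice_0 [simp]: "xslice i 0 = 0"
  by (rule fps_ext, simp)+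

lemma xslice_mult: "xslice i (f * g) = (\<Sum>a\<le>i. xslice a f * xslice (i - a) g)"
proof (rule fps_ext)
  fix j
  have "xslice i (f * g) $ j = (\<Sum>b\<le>j. \<Sum>a\<le>i. f $ b $ a * g $ (j - b) $ (i - a))"
    by (simp add: fps_mult_nth fps_sum_nth atLeast0AtMost)
  also have "\<dots> = (\<Sum>a\<le>i. \<Sum>b\<le>j. f $ b $ a * g $ (j - b) $ (i - a))"
    by (rule sum.swap)
  also have "\<dots> = (\<Sum>a\<le>i. xslice a f * xslice (i - a) g) $ j"
    by (simp add: fps_mult_nth fps_sum_nth atLeast0AtMost)
  finally show "xslice i (f * g) $ j = (\<Sum>a\<le>i. xslice a f * xslice (i - a) g) $ j" .
qed

text \<open>
  In the lowest power of \<open>x\<close> that occurs in \<open>q\<close>, the product \<open>f * q\<close> has \<open>y\<close>-order at least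
  \<open>n\<close>, and the \<open>y\<close>-degree of \<open>r\<close> is smaller than that.
\<close>

lemma weierstrass_division_unique:
  fixes f :: "'k::field ps2"
  assumes f: "ps2_regular n f" and eq: "f * q + fps_of_poly r = 0" and r: "\<forall>j\<ge>n. coeff r j = 0"
  shows "q = 0" "r = 0"
proof -
  have "xslice i q = 0" for i
  proof (induction i rule: less_induct)
    case (less i)
    have "xslice i (f * q) = (\<Sum>a\<le>i. xslice a f * xslice (i - a) q)" by (rule xslice_mult)
    also have "\<dots> = (\<Sum>a\<in>{0}. xslice a f * xslice (i - a) q)"
      by (rule sum.mono_neutral_right) (auto simp: less)
    finally have "xslice i (f * q) = xslice 0 f * xslice i q" by simp
    moreover have "xslice i (f * q + fps_of_poly r) = 0" by (simp add: eq)
    ultimately have *: "xslice 0 f * xslice i q = - xslice i (fps_of_poly r)"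
      by (simp add: add_eq_0_iff2)
    show ?case
    proof (rule ccontr)
      assume nz: "xslice i q \<noteq> 0"
      have nz': "xslice 0 f \<noteq> 0" and "subdegree (xslice 0 f) = n"
        using f by (auto simp: ps2_regular_def fps_eq_iff intro!: subdegreeI)
      then have "subdegree (xslice 0 f * xslice i q) = n + subdegree (xslice i q)"
        using nz by simp
      moreover have "(xslice 0 f * xslice i q) $ subdegree (xslice 0 f * xslice i q) \<noteq> 0"
        using nz nz' by (intro nth_subdegree_nonzero) simp
      ultimately have "(- xslice i (fps_of_poly r)) $ (n + subdegree (xslice i q)) \<noteq> 0"
        unfolding * by metis
      then show False using r by simp
    qed
  qed
  then show "q = 0" by (intro ps2_eqI) simp
  then have "fps_of_poly r = 0" using eq by simp
  then show "r = 0" by (metis fps_of_poly_0 fps_of_poly_eq_iff)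
qed

text \<open>
  The coefficients of the quotient of \<open>h\<close> by a series \<open>w\<close> with \<open>w(0,y) = y^n\<close>.  Both are given by
  their coefficients of the powers of \<open>x\<close>.  What is left of the coefficient of \<open>x^i\<close> in \<open>h\<close> after
  subtracting the contributions of the earlier quotient coefficients is divided by \<open>y^n\<close>.
\<close>

fun weierstrass_quot :: "nat \<Rightarrow> (nat \<Rightarrow> 'k::comm_ring_1 fps) \<Rightarrow> (nat \<Rightarrow> 'k fps) \<Rightarrow> nat \<Rightarrow> 'k fps" where
  "weierstrass_quot n w h i =
     fps_shift n (h i - (\<Sum>a\<in>{1..i}. w a * weierstrass_quot n w h (i - a)))"

declare weierstrass_quot.simps [simp del]

lemma ps2_is_unit_iff: "(f :: 'k::field ps2) dvd 1 \<longleftrightarrow> f $ 0 $ 0 \<noteq> 0"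
proof
  assume "f dvd 1"
  then obtain g where "1 = f * g" by (auto simp: dvd_def)
  then have "(f * g) $ 0 $ 0 = 1" by (metis fps_one_nth)
  then show "f $ 0 $ 0 \<noteq> 0" by auto
next
  assume "f $ 0 $ 0 \<noteq> 0"
  then have "f $ 0 * inverse (f $ 0) = 1"
    by (intro inverse_mult_eq_1')
  from fps_right_inverse[OF this] show "f dvd 1" by (metis dvdI)
qed

lemma weierstrass_division_monic:
  fixes f :: "'k::field ps2"
  assumes f: "xslice 0 f = fps_X ^ n"
  shows "\<exists>q r. h = f * q + fps_of_poly r \<and> (\<forall>j\<ge>n. coeff r j = 0)"
proof -
  define Q where "Q = weierstrass_quot n (\<lambda>i. xslice i f) (\<lambda>i. xslice i h)"
  define q where "q = Abs_fps (\<lambda>j. Abs_fps (\<lambda>i. Q i $ j))"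
  have xq: "xslice i q = Q i" for i by (rule fps_ext) (simp add: q_def)
  have "(h - f * q) $ j $ i = 0" if "j \<ge> n" for j i
  proof -
    define e where "e = xslice i h - (\<Sum>a\<in>{1..i}. xslice a f * Q (i - a))"
    have Qi: "Q i = fps_shift n e"
      unfolding Q_def e_def by (subst weierstrass_quot.simps) simp
    have "{..i} = insert 0 {1..i}" by auto
    then have "xslice i (f * q) = fps_X ^ n * Q i + (\<Sum>a\<in>{1..i}. xslice a f * Q (i - a))"
      unfolding xslice_mult by (simp add: xq f)
    then have "xslice i (h - f * q) = e - fps_X ^ n * fps_shift n e"
      by (simp add: e_def Qi)
    then have "xslice i (h - f * q) $ j = 0" using that by (simp add: fps_X_power_mult_nth)
    then show ?thesis by simp
  qed
  then have z: "(h - f * q) $ j = 0" if "j \<ge> n" for j using that by (intro fps_ext) simp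
  define r where "r = Abs_poly (\<lambda>j. (h - f * q) $ j)"
  have "coeff r j = (h - f * q) $ j" for j
    unfolding r_def
  proof (subst coeff_Abs_poly)
    show "(h - f * q) $ i = 0" if "i > n" for i using that z by simp
  qed simp
  then have "fps_of_poly r = h - f * q" "\<forall>j\<ge>n. coeff r j = 0"
    using z by (auto intro: fps_ext)
  then show ?thesis by (intro exI[of _ q] exI[of _ r]) simp
qed

lemma ps2_unit_cancel:
  assumes "(u :: 'k::field ps2) $ 0 $ 0 \<noteq> 0"
  obtains v where "u * v = 1" "v $ 0 $ 0 \<noteq> 0"
proof -
  from assms have "u dvd 1" by (simp add: ps2_is_unit_iff)
  then obtain v where v: "u * v = 1" by (metis dvdE)
  then have "v dvd 1" by (metis dvdI mult.commute)
  with v that show ?thesis by (simp add: ps2_is_unit_iff)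
qed

text \<open>
  The unit \<open>f(0,y) / y^n\<close> of \<open>K[[y]]\<close>, inverted and regarded as a series in both variables,
  reduces the claim to the case \<open>f(0,y) = y^n\<close>.
\<close>

theorem weierstrass_division:
  fixes f :: "'k::field ps2"
  assumes f: "ps2_regular n f"
  shows "\<exists>q r. h = f * q + fps_of_poly r \<and> (\<forall>j\<ge>n. coeff r j = 0)"
proof -
  define s where "s = fps_shift n (xslice 0 f)"
  have s0: "s $ 0 \<noteq> 0" using f by (simp add: s_def ps2_regular_def)
  have fs: "xslice 0 f = fps_X ^ n * s"
    using f by (intro fps_ext) (auto simp: s_def fps_X_power_mult_nth ps2_regular_def)
  define t :: "'k ps2" where "t = Abs_fps (\<lambda>j. fps_const (inverse s $ j))"
  have xt: "xslice 0 t = inverse s" by (rule fps_ext) (simp add: t_def)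
  have "xslice 0 (f * t) = fps_X ^ n"
    using s0 by (simp add: xslice_mult fs xt mult.assoc inverse_mult_eq_1')
  from weierstrass_division_monic[OF this, of h] obtain q r
    where "h = f * t * q + fps_of_poly r" "\<forall>j\<ge>n. coeff r j = 0" by blast
  then show ?thesis by (intro exI[of _ "t * q"] exI[of _ r]) (simp add: mult.assoc)
qed

definition weierstrass_poly :: "'k::comm_ring_1 fps poly \<Rightarrow> bool" where
  "weierstrass_poly w \<longleftrightarrow> lead_coeff w = 1 \<and> (\<forall>j<degree w. coeff w j $ 0 = 0)"

lemma weierstrass_poly_regular: "weierstrass_poly w \<Longrightarrow> ps2_regular (degree w) (fps_of_poly w)"
  by (simp add: weierstrass_poly_def ps2_regular_def)

text \<open>
  The quotient of \<open>y^n\<close> by \<open>f\<close> is a unit, as can be seen from the coefficient of \<open>y^n\<close> modulo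
  \<open>x\<close>, and the remainder is divisible by \<open>x\<close>.
\<close>

theorem weierstrass_preparation:
  fixes f :: "'k::field ps2"
  assumes f: "ps2_regular n f"
  obtains u w where "u $ 0 $ 0 \<noteq> 0" "f * u = fps_of_poly w" "weierstrass_poly w" "degree w = n"
proof -
  from weierstrass_division[OF f, of "fps_X ^ n"] obtain q r
    where qr: "fps_X ^ n = f * q + fps_of_poly r" and r: "\<forall>j\<ge>n. coeff r j = 0" by blast
  have "xslice 0 (fps_X ^ n :: 'k ps2) = fps_X ^ n"
    by (rule fps_ext) (simp add: fps_X_power_nth)
  then have x: "fps_X ^ n = xslice 0 f * xslice 0 q + xslice 0 (fps_of_poly r)"
    unfolding qr by (simp add: xslice_mult)
  have low: "(xslice 0 f * xslice 0 q) $ j = 0" if "j < n" for j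
    using f that by (auto simp: fps_mult_nth ps2_regular_def intro!: sum.neutral)
  have rlow: "coeff r j $ 0 = 0" for j
  proof (cases "j < n")
    case True
    with low[OF True] arg_cong[OF x, of "\<lambda>z. z $ j"] show ?thesis
      by (simp add: fps_X_power_nth)
  qed (use r in simp)
  have "(xslice 0 f * xslice 0 q) $ n = f $ n $ 0 * q $ 0 $ 0"
  proof -
    have "(xslice 0 f * xslice 0 q) $ n = (\<Sum>i\<in>{n}. f $ i $ 0 * q $ (n - i) $ 0)"
      unfolding fps_mult_nth xslice_nth
      by (rule sum.mono_neutral_right) (use f in \<open>auto simp: ps2_regular_def\<close>)
    then show ?thesis by simp
  qed
  with arg_cong[OF x, of "\<lambda>z. z $ n"] r have q0: "q $ 0 $ 0 \<noteq> 0"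
    by (auto simp: fps_X_power_nth)
  define w where "w = monom 1 n - r"
  have cw: "coeff w j = (if j = n then 1 else 0) - coeff r j" for j by (simp add: w_def)
  have deg: "degree w = n"
  proof (rule antisym)
    show "degree w \<le> n" using r by (intro degree_le) (auto simp: cw)
    show "n \<le> degree w" using r by (intro le_degree) (auto simp: cw)
  qed
  show ?thesis
  proof
    show "q $ 0 $ 0 \<noteq> 0" by fact
    have "fps_of_poly w = fps_X ^ n - fps_of_poly r"
      by (simp add: w_def fps_of_poly_diff fps_of_poly_monom')
    with qr show "f * q = fps_of_poly w" by simp
    show "weierstrass_poly w"
      using r rlow by (simp add: weierstrass_poly_def deg cw)
    show "degree w = n" by fact
  qed
qed

lemma monic_division:
  fixes w :: "'a::idom poly"
  assumes "lead_coeff w = 1"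
  obtains q r where "p = w * q + r" "r = 0 \<or> degree r < degree w"
proof -
  have "w \<noteq> 0" using assms by auto
  from pseudo_divmod[OF this, of p "fst (pseudo_divmod p w)" "snd (pseudo_divmod p w)"] assms that
  show ?thesis by auto
qed

text \<open>
  The remainder of polynomial division by \<open>w\<close> is also the remainder of Weierstrass division, so it
  vanishes by uniqueness.
\<close>

lemma fps_of_poly_multiple_imp_dvd:
  fixes w :: "'k::field fps poly"
  assumes w: "weierstrass_poly w" and dvd: "fps_of_poly w dvd fps_of_poly p"
  shows "w dvd p"
proof -
  from w have "lead_coeff w = 1" by (simp add: weierstrass_poly_def)
  from monic_division[OF this, of p] obtain q r where qr: "p = w * q + r" "r = 0 \<or> degree r < degree w"
    by metis
  from dvd obtain v where "fps_of_poly p = fps_of_poly w * v" by (auto simp: dvd_def)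
  then have "fps_of_poly w * (fps_of_poly q - v) + fps_of_poly r = 0"
    unfolding qr by (simp add: fps_of_poly_add fps_of_poly_mult algebra_simps)
  from weierstrass_division_unique(2)[OF weierstrass_poly_regular[OF w] this] qr(2)
  have "r = 0" by (metis coeff_eq_0 order.strict_trans2)
  with qr show ?thesis by simp
qed

text \<open>
  The case of Hensel's lemma on which the extension of the absolute value rests: the roots
  of \<open>p\<close> of absolute value less than 1 are split off from the others.
\<close>

theorem poly_weierstrass_factor:
  fixes p :: "'k::field fps poly"
  assumes "ps2_regular n (fps_of_poly p)"
  obtains w q where "weierstrass_poly w" "degree w = n" "p = w * q"
proof -
  from weierstrass_preparation[OF assms] obtain u w where
    u: "u $ 0 $ 0 \<noteq> 0" "fps_of_poly p * u = fps_of_poly w" and w: "weierstrass_poly w" "degree w = n"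
    by blast
  from ps2_unit_cancel[OF u(1)] obtain v where "u * v = 1" by blast
  then have "fps_of_poly p = fps_of_poly w * v"
    by (metis u(2) mult.assoc mult.right_neutral)
  then have "w dvd p" by (intro fps_of_poly_multiple_imp_dvd w) simp
  then show ?thesis using w that by (auto simp: dvd_def)
qed

section \<open>Integral elements of the algebraic closure of \<open>K((x))\<close>\<close>

text \<open>
  The ring \<open>K[[x]]\<close> inside the algebraic closure of \<open>K((x))\<close>.
\<close>

definition emb :: "'k::field fps \<Rightarrow> 'k fls alg_closure" where
  "emb a = to_ac (fps_to_fls a)"

lemma emb_simps [simp]:
  "emb 0 = 0" "emb 1 = 1" "emb (a + b) = emb a + emb b" "emb (a - b) = emb a - emb b"
  "emb (- a) = - emb a" "emb (a * b) = emb a * emb b" "emb (a ^ n) = emb a ^ n"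
  by (simp_all add: emb_def fls_times_fps_to_fls fps_to_fls_power)

lemma emb_eq_0_iff [simp]: "emb a = 0 \<longleftrightarrow> a = 0"
  by (simp add: emb_def)

lemma emb_sum: "emb (sum f A) = (\<Sum>x\<in>A. emb (f x))"
  by (induction A rule: infinite_finite_induct) simp_all

definition pev :: "'k::field fps poly \<Rightarrow> 'k fls alg_closure \<Rightarrow> 'k fls alg_closure" where
  "pev p z = poly (map_poly emb p) z"

lemma map_poly_emb_add: "map_poly emb (p + q) = map_poly emb p + map_poly emb q"
  by (rule poly_eqI) (simp add: coeff_map_poly)

lemma map_poly_emb_mult: "map_poly emb (p * q) = map_poly emb p * map_poly emb q"
  by (rule poly_eqI) (simp add: coeff_map_poly coeff_mult emb_sum)

lemma degree_map_poly_emb [simp]: "degree (map_poly emb p) = degree p"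
  by (rule degree_map_poly) simp

lemma pev_0 [simp]: "pev 0 z = 0"
  and pev_1 [simp]: "pev 1 z = 1"
  and pev_pCons [simp]: "pev (pCons a p) z = emb a + z * pev p z"
  by (simp_all add: pev_def map_poly_pCons)

lemma pev_add [simp]: "pev (p + q) z = pev p z + pev q z"
  and pev_mult [simp]: "pev (p * q) z = pev p z * pev q z"
  by (simp_all add: pev_def map_poly_emb_add map_poly_emb_mult)

lemma pev_minus [simp]: "pev (- p) z = - pev p z"
  using pev_add[of p "- p" z] by (simp add: add_eq_0_iff2 del: pev_add)

lemma pev_diff [simp]: "pev (p - q) z = pev p z - pev q z"
  using pev_add[of p "- q" z] by simp

lemma pev_power [simp]: "pev (p ^ n) z = pev p z ^ n"
  by (induction n) simp_all

lemma pev_smult [simp]: "pev (smult c p) z = emb c * pev p z"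
  using pev_mult[of "[:c:]" p z] by simp

lemma pev_sum: "pev (sum f A) z = (\<Sum>x\<in>A. pev (f x) z)"
  by (induction A rule: infinite_finite_induct) simp_all

lemma pev_altdef: "pev p z = (\<Sum>i\<le>degree p. emb (coeff p i) * z ^ i)"
  by (simp add: pev_def poly_altdef coeff_map_poly)

lemma pev_monom [simp]: "pev (monom c n) z = emb c * z ^ n"
  by (simp add: pev_def map_poly_monom poly_monom)


definition integral :: "'k::field fls alg_closure \<Rightarrow> bool" where
  "integral z \<longleftrightarrow> (\<exists>p. lead_coeff p = 1 \<and> pev p z = 0)"

interpretation O_span: Modules.module "\<lambda>(c :: 'k :: field fps) (v :: 'k fls alg_closure). emb c * v"
  by unfold_locales (simp_all add: algebra_simps)

interpretation F_lin: vector_space_pair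
    "\<lambda>(c :: 'k :: field fls) (v :: 'k fls alg_closure). to_ac c * v"
    "(*) :: 'k fls \<Rightarrow> 'k fls \<Rightarrow> 'k fls"
  by unfold_locales (simp_all add: algebra_simps)

lemma fls_nonneg_subdegree_in_range:
  assumes "fls_subdegree z \<ge> 0"
  shows "z \<in> range fps_to_fls"
  using fls_regpart_to_fls_trivial[OF assms] by (metis rangeI)

lemma fls_clear_denominator:
  "\<exists>N. \<forall>M\<ge>N. fls_X ^ M * (z :: 'k :: field fls) \<in> range fps_to_fls"
proof (cases "z = 0")
  case True
  then show ?thesis by (auto intro!: rangeI[of fps_to_fls 0, simplified])
next
  case False
  show ?thesis
  proof (intro exI[of _ "nat (- fls_subdegree z)"] allI impI fls_nonneg_subdegree_in_range)
    fix M assume "M \<ge> nat (- fls_subdegree z)"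
    then show "fls_subdegree (fls_X ^ M * z) \<ge> 0"
      using False by (simp add: fls_subdegree_mult fls_subdegree_pow)
  qed
qed

lemma fls_clear_denominators:
  assumes "finite A"
  shows "\<exists>N. \<forall>z\<in>A. fls_X ^ N * (f z :: 'k :: field fls) \<in> range fps_to_fls"
proof -
  have "\<forall>z. \<exists>N. \<forall>M\<ge>N. fls_X ^ M * f z \<in> range fps_to_fls"
    using fls_clear_denominator by blast
  then obtain N where N: "\<And>z M. M \<ge> N z \<Longrightarrow> fls_X ^ M * f z \<in> range fps_to_fls" by metis
  have "N z \<le> sum N A" if "z \<in> A" for z using assms that by (intro member_le_sum) auto
  with N show ?thesis by blast
qed

lemma annihilating_poly_exists:
  fixes z :: "'k::field fls alg_closure"
  obtains p where "p \<noteq> 0" "pev p z = 0"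
proof -
  obtain p :: "'k fls poly" where p: "p \<noteq> 0" "poly (map_poly to_ac p) z = 0"
    by (rule alg_closure_algebraic)
  obtain N where N: "\<forall>i\<in>{..degree p}. fls_X ^ N * coeff p i \<in> range fps_to_fls"
    using fls_clear_denominators[of "{..degree p}" "coeff p"] by auto
  then have "\<forall>i. \<exists>a. fls_X ^ N * coeff p i = fps_to_fls a"
  proof (intro allI)
    fix i show "\<exists>a. fls_X ^ N * coeff p i = fps_to_fls a"
    proof (cases "i \<le> degree p")
      case True
      with N show ?thesis by blast
    qed (auto simp: coeff_eq_0 intro!: exI[of _ 0])
  qed
  then obtain a where a: "\<And>i. fls_X ^ N * coeff p i = fps_to_fls (a i)" by metis
  define q where "q = (\<Sum>i\<le>degree p. monom (a i) i)"
  have cq: "coeff q i = (if i \<le> degree p then a i else 0)" for i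
    by (simp add: q_def coeff_sum)
  have "a (degree p) \<noteq> 0" using a[of "degree p"] p(1) by auto
  then have "q \<noteq> 0" using cq[of "degree p"] by auto
  moreover have "pev q z = (\<Sum>i\<le>degree p. emb (a i) * z ^ i)"
    by (simp add: q_def pev_sum)
  moreover have "\<dots> = to_ac (fls_X ^ N) * (\<Sum>i\<le>degree p. to_ac (coeff p i) * z ^ i)"
    by (simp add: emb_def a[symmetric] sum_distrib_left mult.assoc)
  moreover have "(\<Sum>i\<le>degree p. to_ac (coeff p i) * z ^ i) = 0"
    using p(2) by (simp add: poly_altdef coeff_map_poly degree_map_poly)
  ultimately show ?thesis using that by simp
qed

text \<open>
  Among the annihilating polynomials of least degree, one whose leading coefficient has least
  order is not divisible by \<open>x\<close>.
\<close>

lemma min_primitive_annihilator: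
  fixes z :: "'k::field fls alg_closure"
  obtains p j where "p \<noteq> 0" "pev p z = 0" "\<And>q. q \<noteq> 0 \<Longrightarrow> pev q z = 0 \<Longrightarrow> degree p \<le> degree q"
    "coeff p j $ 0 \<noteq> 0"
proof -
  let ?P = "\<lambda>p. p \<noteq> 0 \<and> pev p z = 0"
  obtain p0 where "?P p0" using annihilating_poly_exists by blast
  from ex_has_least_nat[of ?P, OF this, of degree] obtain p1
    where p1: "?P p1" "\<And>q. ?P q \<Longrightarrow> degree p1 \<le> degree q" by auto
  let ?Q = "\<lambda>p. ?P p \<and> degree p = degree p1"
  have "?Q p1" using p1 by simp
  from ex_has_least_nat[of ?Q, OF this, of "\<lambda>p. subdegree (lead_coeff p)"] obtain p
    where p: "?Q p" "\<And>q. ?Q q \<Longrightarrow> subdegree (lead_coeff p) \<le> subdegree (lead_coeff q)" by auto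
  have "\<exists>j. coeff p j $ 0 \<noteq> 0"
  proof (rule ccontr)
    assume "\<nexists>j. coeff p j $ 0 \<noteq> 0"
    then have cj: "coeff p j = fps_X * fps_shift 1 (coeff p j)" for j
      by (intro fps_ext) (auto simp: fps_X_mult_nth)
    define q where "q = map_poly (fps_shift 1) p"
    have pq: "p = smult fps_X q"
      by (rule poly_eqI) (subst cj, simp add: q_def coeff_map_poly)
    with p(1) have "q \<noteq> 0" "pev q z = 0" by (auto simp: emb_eq_0_iff)
    moreover have "degree q = degree p" unfolding pq by simp
    ultimately have "subdegree (lead_coeff p) \<le> subdegree (lead_coeff q)"
      using p(1) by (intro p(2)) simp
    moreover have "lead_coeff p = fps_X * lead_coeff q"
      using \<open>degree q = degree p\<close> arg_cong[OF pq, of "\<lambda>p. coeff p (degree q)"] by simp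
    ultimately show False using \<open>q \<noteq> 0\<close> by simp
  qed
  then obtain j where "coeff p j $ 0 \<noteq> 0" by blast
  moreover have "degree p \<le> degree q" if "q \<noteq> 0" "pev q z = 0" for q
    using p1(2)[of q] p(1) that by simp
  ultimately show ?thesis using p(1) by (intro that[of p j]) auto
qed

lemma map_poly_reflect_emb: "map_poly emb (reflect_poly p) = reflect_poly (map_poly emb p)"
  by (rule poly_eqI) (simp add: coeff_map_poly coeff_reflect_poly)

text \<open>
  A minimal primitive annihilator is factored by \<open>poly_weierstrass_factor\<close>, and one of the
  two factors annihilates \<open>z\<close>.  If it is the Weierstrass polynomial, then \<open>z\<close> has absolute value less
  than 1; otherwise the constant term of the annihilator is a unit, and \<open>1/z\<close> is integral.
\<close>

lemma minimal_annihilator_cases: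
  fixes z :: "'k::field fls alg_closure"
  obtains
    (unit) p where "pev p z = 0" "coeff p 0 $ 0 \<noteq> 0"
  | (weierstrass) v where "weierstrass_poly v" "pev v z = 0"
      "\<And>q. q \<noteq> 0 \<Longrightarrow> pev q z = 0 \<Longrightarrow> degree v \<le> degree q"
proof -
  obtain p j where p: "p \<noteq> 0" "pev p z = 0" and
    min: "\<And>q. q \<noteq> 0 \<Longrightarrow> pev q z = 0 \<Longrightarrow> degree p \<le> degree q" and j: "coeff p j $ 0 \<noteq> 0"
    using min_primitive_annihilator by blast
  define r where "r = (LEAST j. coeff p j $ 0 \<noteq> 0)"
  have r: "ps2_regular r (fps_of_poly p)"
    unfolding ps2_regular_def
  proof (intro conjI allI impI)
    show "fps_of_poly p $ r $ 0 \<noteq> 0"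
      unfolding r_def fps_of_poly_nth by (rule LeastI[of "\<lambda>j. coeff p j $ 0 \<noteq> 0", OF j])
    fix i assume "i < r"
    from not_less_Least[OF this[unfolded r_def]] show "fps_of_poly p $ i $ 0 = 0" by simp
  qed
  from poly_weierstrass_factor[OF r] obtain v s where
    v: "weierstrass_poly v" "degree v = r" "p = v * s" by blast
  from p v have nz: "v \<noteq> 0" "s \<noteq> 0" by auto
  have deg: "degree p = r + degree s" using v nz by (simp add: degree_mult_eq)
  have "pev v z = 0 \<or> pev s z = 0" using p v by simp
  then show ?thesis
  proof
    assume "pev v z = 0"
    moreover have "degree v \<le> degree q" if "q \<noteq> 0" "pev q z = 0" for q
      using min[OF that] deg v(2) by simp
    ultimately show ?thesis using v(1) weierstrass by blast
  next
    assume "pev s z = 0"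
    \<comment> \<open>minimality of \<open>p\<close> forces \<open>v\<close> to be constant\<close>
    then have "r = 0" using min[OF nz(2)] deg by simp
    with r p(2) unit show ?thesis by (auto simp: ps2_regular_def)
  qed
qed

lemma integral_dichotomy:
  fixes z :: "'k::field fls alg_closure"
  assumes "z \<noteq> 0"
  shows "(\<exists>w. weierstrass_poly w \<and> pev w z = 0) \<or> integral (inverse z)"
proof (rule minimal_annihilator_cases[of z])
  fix p assume p: "pev p z = 0" "coeff p 0 $ 0 \<noteq> 0"
  define s where "s = smult (inverse (coeff p 0)) p"
  have s0: "coeff s 0 = 1" using p by (simp add: s_def inverse_mult_eq_1)
  have "pev s z = 0" by (simp add: s_def p)
  have "pev (reflect_poly s) (inverse z) = inverse z ^ degree s * pev s z"
    unfolding pev_def map_poly_reflect_emb using assms by (subst poly_reflect_poly_nz) simp_all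
  moreover have "lead_coeff (reflect_poly s) = 1"
    using s0 by (simp add: coeff_reflect_poly)
  ultimately show ?thesis using \<open>pev s z = 0\<close> unfolding integral_def by auto
qed blast

text \<open>
  The values of a \<open>K((x))\<close>-linear functional on a finitely generated \<open>K[[x]]\<close>-module have a
  common denominator.
\<close>

lemma F_functional_bounded:
  fixes \<phi> :: "'k::field fls alg_closure \<Rightarrow> 'k fls"
  assumes lin: "\<And>u v. \<phi> (u + v) = \<phi> u + \<phi> v" "\<And>c v. \<phi> (to_ac c * v) = c * \<phi> v"
    and S: "finite S"
  shows "\<exists>N. \<forall>v\<in>O_span.span S. fls_X ^ N * \<phi> v \<in> range fps_to_fls"
proof -
  obtain N where N: "\<forall>s\<in>S. fls_X ^ N * \<phi> s \<in> range fps_to_fls"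
    using fls_clear_denominators[OF S, of \<phi>] by blast
  have "O_span.span S \<subseteq> {v. fls_X ^ N * \<phi> v \<in> range fps_to_fls}"
  proof (rule O_span.span_minimal)
    show "S \<subseteq> {v. fls_X ^ N * \<phi> v \<in> range fps_to_fls}" using N by auto
    show "O_span.subspace {v. fls_X ^ N * \<phi> v \<in> range fps_to_fls}"
    proof (rule O_span.subspaceI, unfold mem_Collect_eq)
      have "\<phi> 0 = 0" using lin(2)[of 0 0] by simp
      then show "fls_X ^ N * \<phi> 0 \<in> range fps_to_fls"
        using rangeI[of fps_to_fls 0] by simp
    next
      fix x y assume "fls_X ^ N * \<phi> x \<in> range fps_to_fls" "fls_X ^ N * \<phi> y \<in> range fps_to_fls"
      then obtain a b where "fls_X ^ N * \<phi> x = fps_to_fls a" "fls_X ^ N * \<phi> y = fps_to_fls b" by auto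
      then have "fls_X ^ N * \<phi> (x + y) = fps_to_fls (a + b)" by (simp add: lin distrib_left)
      then show "fls_X ^ N * \<phi> (x + y) \<in> range fps_to_fls" by blast
    next
      fix c x assume "fls_X ^ N * \<phi> x \<in> range fps_to_fls"
      then obtain a where a: "fls_X ^ N * \<phi> x = fps_to_fls a" by auto
      have "fls_X ^ N * \<phi> (emb c * x) = fps_to_fls c * (fls_X ^ N * \<phi> x)"
        by (simp add: emb_def lin mult.left_commute)
      also have "\<dots> = fps_to_fls (c * a)" by (simp add: a fls_times_fps_to_fls)
      finally show "fls_X ^ N * \<phi> (emb c * x) \<in> range fps_to_fls" by blast
    qed
  qed
  then show ?thesis by blast
qed

text \<open>
  This is what makes the integral elements a ring.  If \<open>z\<close> is not integral, then \<open>1/z\<close>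
  is the root of a Weierstrass polynomial, which amounts to a relation
  \<open>1 = x (b_1 z + \<dots> + b_d z^d)\<close> with \<open>b_i\<close> in \<open>K[[x]]\<close>.  Iterating it puts 1 into \<open>x^k M\<close> for
  all \<open>k\<close>, where \<open>M\<close> is the module spanned by \<open>S\<close>.  But a \<open>K((x))\<close>-linear functional that maps 1 to 1
  has bounded denominators on \<open>M\<close>.
\<close>

lemma power_bounded_imp_integral:
  fixes z :: "'k::field fls alg_closure"
  assumes S: "finite S" and pow: "\<And>k. z ^ k \<in> O_span.span S"
  shows "integral z"
proof (rule ccontr)
  assume nint: "\<not> integral z"
  have "integral 0"
    unfolding integral_def by (rule exI[of _ "[:0, 1:]"]) simp
  with nint have "z \<noteq> 0" by auto
  with nint integral_dichotomy[of "inverse z"] obtain w where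
    w: "weierstrass_poly w" "pev w (inverse z) = 0" by auto
  define d where "d = degree w"
  define a where "a = (\<lambda>i. fps_shift 1 (coeff w i))"
  have a: "coeff w i = fps_X * a i" if "i < d" for i
    using w(1) that by (intro fps_ext) (auto simp: weierstrass_poly_def fps_X_mult_nth a_def d_def)
  have "0 = (\<Sum>i\<le>d. emb (coeff w i) * inverse z ^ i)"
    using w(2) by (simp add: pev_altdef d_def)
  also have "{..d} = insert d {..<d}" by auto
  also have "(\<Sum>i\<in>insert d {..<d}. emb (coeff w i) * inverse z ^ i) =
      inverse z ^ d + (\<Sum>i<d. emb (fps_X * a i) * inverse z ^ i)"
    using w(1) a by (simp add: weierstrass_poly_def d_def)
  finally have rel: "inverse z ^ d = - (\<Sum>i<d. emb (fps_X * a i) * inverse z ^ i)"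
    by (simp add: eq_neg_iff_add_eq_0)
  \<comment> \<open>the relation for 1 mentioned above, multiplied by \<open>z^j\<close>\<close>
  have step: "z ^ j = emb fps_X * (\<Sum>i<d. emb (- a i) * z ^ (j + (d - i)))" for j
  proof -
    have shuffle: "- (u * (x * y * v)) = x * (- y * (u * v))" for x y u v :: "'k fls alg_closure"
      by (simp only: mult_minus_left mult_minus_right mult_ac)
    have "z ^ j = z ^ (j + d) * inverse z ^ d"
      using \<open>z \<noteq> 0\<close> by (simp add: power_add field_simps)
    also have "\<dots> = (\<Sum>i<d. emb fps_X * (emb (- a i) * (z ^ (j + d) * inverse z ^ i)))"
      unfolding rel mult_minus_right sum_distrib_left sum_negf[symmetric]
      unfolding emb_simps by (rule sum.cong[OF refl]) (rule shuffle)
    also have "\<dots> = (\<Sum>i<d. emb fps_X * (emb (- a i) * z ^ (j + (d - i))))"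
    proof (rule sum.cong, simp)
      fix i assume "i \<in> {..<d}"
      then have "z ^ (j + d) = z ^ (j + (d - i)) * z ^ i"
        by (simp flip: power_add)
      then have "z ^ (j + d) * inverse z ^ i = z ^ (j + (d - i)) * (z ^ i * inverse z ^ i)"
        by (simp only: mult.assoc)
      also have "z ^ i * inverse z ^ i = 1"
        using \<open>z \<noteq> 0\<close> by (simp flip: power_mult_distrib)
      finally have "z ^ (j + d) * inverse z ^ i = z ^ (j + (d - i))" by simp
      then show "emb fps_X * (emb (- a i) * (z ^ (j + d) * inverse z ^ i)) =
          emb fps_X * (emb (- a i) * z ^ (j + (d - i)))" by simp
    qed
    finally show ?thesis by (simp add: sum_distrib_left)
  qed
  have "\<exists>v\<in>O_span.span S. z ^ j = emb fps_X ^ k * v" for k j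
  proof (induction k arbitrary: j)
    case 0
    show ?case using pow by auto
  next
    case (Suc k)
    then obtain v where v: "\<And>j. v j \<in> O_span.span S" "\<And>j. z ^ j = emb fps_X ^ k * v j" by metis
    have "z ^ j = emb fps_X * (\<Sum>i<d. emb (- a i) * (emb fps_X ^ k * v (j + (d - i))))"
      by (subst step) (simp only: v(2)[symmetric])
    then have "z ^ j = emb fps_X ^ Suc k * (\<Sum>i<d. emb (- a i) * v (j + (d - i)))"
      unfolding sum_distrib_left by (simp only: power_Suc mult_ac)
    moreover have "(\<Sum>i<d. emb (- a i) * v (j + (d - i))) \<in> O_span.span S"
      by (intro O_span.span_sum O_span.span_scale v)
    ultimately show ?case by blast
  qed
  from this[of 0] have one: "\<exists>v\<in>O_span.span S. 1 = emb fps_X ^ k * v" for k by simp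
  have "F_lin.vs1.independent {1 :: 'k fls alg_closure}"
    by (rule F_lin.vs1.independent_if_scalars_zero) auto
  from F_lin.linear_independent_extend[OF this, of "\<lambda>_. 1"]
  obtain \<phi> :: "'k fls alg_closure \<Rightarrow> 'k fls" where \<phi>: "Vector_Spaces.linear (\<lambda>c v. to_ac c * v) (*) \<phi>" "\<phi> 1 = 1" by auto
  from \<phi>(1) interpret \<phi>: Vector_Spaces.linear "\<lambda>c v. to_ac c * v" "(*)" \<phi> .
  have lin: "\<phi> (u + v) = \<phi> u + \<phi> v" "\<phi> (to_ac c * v) = c * \<phi> v" for u v c
    by (rule \<phi>.add \<phi>.scale)+
  from F_functional_bounded[of \<phi>, OF lin S] obtain N
    where N: "\<And>v. v \<in> O_span.span S \<Longrightarrow> fls_X ^ N * \<phi> v \<in> range fps_to_fls" by blast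
  from one[of "Suc N"] obtain v where v: "v \<in> O_span.span S" "1 = emb fps_X ^ Suc N * v" by blast
  from N[OF v(1)] obtain b where b: "fls_X ^ N * \<phi> v = fps_to_fls b" by auto
  have "emb fps_X ^ Suc N * v = to_ac (fls_X ^ Suc N) * v" by (simp add: emb_def)
  with v(2) have "(1 :: 'k fls alg_closure) = to_ac (fls_X ^ Suc N) * v" by (simp only:)
  then have "\<phi> 1 = \<phi> (to_ac (fls_X ^ Suc N) * v)" by (rule arg_cong)
  then have "\<phi> 1 = fls_X ^ Suc N * \<phi> v" unfolding lin(2) .
  then have "1 = fls_X ^ Suc N * \<phi> v" unfolding \<phi>(2) .
  also have "\<dots> = fls_X * fps_to_fls b" unfolding b[symmetric] power_Suc by (rule mult.assoc)
  also have "\<dots> = fps_to_fls (fps_X * b)" by (simp add: fls_times_fps_to_fls)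
  finally have "fps_to_fls 1 = fps_to_fls (fps_X * b)" unfolding fps_one_to_fls .
  then have "1 = fps_X * b" unfolding fps_to_fls_eq_iff .
  from arg_cong[OF this, of "\<lambda>f. f $ 0"] have "(1 :: 'k) = 0" by simp
  then show False by simp
qed

lemma integral_if_stable:
  fixes z :: "'k::field fls alg_closure"
  assumes S: "finite S" "1 \<in> O_span.span S" and st: "\<And>v. v \<in> O_span.span S \<Longrightarrow> z * v \<in> O_span.span S"
  shows "integral z"
proof (rule power_bounded_imp_integral[OF S(1)])
  fix k show "z ^ k \<in> O_span.span S"
    by (induction k) (use S(2) st in auto)
qed

text \<open>
  The module is spanned by the monomials \<open>a^i b^j\<close> whose exponents are smaller than the degrees of
  monic equations for \<open>a\<close> and \<open>b\<close>.
\<close>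

lemma integral_stable_pair:
  fixes a b :: "'k::field fls alg_closure"
  assumes "integral a" "integral b"
  obtains S where "finite S" "1 \<in> O_span.span S"
    "\<And>v. v \<in> O_span.span S \<Longrightarrow> a * v \<in> O_span.span S"
    "\<And>v. v \<in> O_span.span S \<Longrightarrow> b * v \<in> O_span.span S"
proof -
  from assms obtain p q where p: "lead_coeff p = 1" "pev p a = 0" and q: "lead_coeff q = 1" "pev q b = 0"
    by (auto simp: integral_def)
  have d0: "degree p > 0" "degree q > 0"
    using p q by (auto intro!: Nat.gr0I elim!: degree_eq_zeroE)
  define S where "S = (\<lambda>(i, j). a ^ i * b ^ j) ` ({..<degree p} \<times> {..<degree q})"
  have inS: "a ^ i * b ^ j \<in> O_span.span S" if "i < degree p" "j < degree q" for i j
    using that by (intro O_span.span_base) (auto simp: S_def)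
  have red: "z ^ degree r = - (\<Sum>i<degree r. emb (coeff r i) * z ^ i)"
    if "lead_coeff r = 1" "pev r z = 0" for r and z :: "'k fls alg_closure"
  proof -
    have "{..degree r} = insert (degree r) {..<degree r}" by auto
    then show ?thesis using that by (simp add: pev_altdef eq_neg_iff_add_eq_0)
  qed
  have stable: "c * v \<in> O_span.span S"
    if "v \<in> O_span.span S" and base: "\<And>s. s \<in> S \<Longrightarrow> c * s \<in> O_span.span S" for c v
  proof -
    have "O_span.span S \<subseteq> {v. c * v \<in> O_span.span S}"
    proof (rule O_span.span_minimal)
      show "O_span.subspace {v. c * v \<in> O_span.span S}"
        by (rule O_span.subspaceI)
          (auto simp: distrib_left mult.left_commute[of c] O_span.span_zero
             intro: O_span.span_add O_span.span_scale)
    qed (use base in auto)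
    with that show ?thesis by blast
  qed
  show ?thesis
  proof
    show "finite S" by (simp add: S_def)
    show "1 \<in> O_span.span S" using inS[of 0 0] d0 by simp
    show "a * v \<in> O_span.span S" if "v \<in> O_span.span S" for v
    proof (rule stable[OF that])
      fix s assume "s \<in> S"
      then obtain i j where ij: "s = a ^ i * b ^ j" "i < degree p" "j < degree q"
        by (auto simp: S_def)
      show "a * s \<in> O_span.span S"
      proof (cases "Suc i < degree p")
        case True
        with inS[of "Suc i" j] ij show ?thesis by (simp add: mult.assoc)
      next
        case False
        with ij have "Suc i = degree p" by simp
        then have "a * s = a ^ degree p * b ^ j" using ij by (metis mult.assoc power_Suc)
        also have "\<dots> = - (\<Sum>i<degree p. emb (coeff p i) * (a ^ i * b ^ j))"
          by (simp add: red[OF p] sum_distrib_right mult.assoc)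
        also have "\<dots> \<in> O_span.span S"
          using ij by (intro O_span.span_neg O_span.span_sum O_span.span_scale inS) auto
        finally show ?thesis .
      qed
    qed
    show "b * v \<in> O_span.span S" if "v \<in> O_span.span S" for v
    proof (rule stable[OF that])
      fix s assume "s \<in> S"
      then obtain i j where ij: "s = a ^ i * b ^ j" "i < degree p" "j < degree q"
        by (auto simp: S_def)
      show "b * s \<in> O_span.span S"
      proof (cases "Suc j < degree q")
        case True
        with inS[of i "Suc j"] ij show ?thesis by (simp add: mult.left_commute)
      next
        case False
        with ij have "Suc j = degree q" by simp
        then have "b * s = a ^ i * b ^ degree q" using ij by (metis mult.left_commute power_Suc)
        also have "\<dots> = - (\<Sum>j<degree q. emb (coeff q j) * (a ^ i * b ^ j))"
          by (simp add: red[OF q] sum_distrib_left mult.left_commute)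
        also have "\<dots> \<in> O_span.span S"
          using ij by (intro O_span.span_neg O_span.span_sum O_span.span_scale inS) auto
        finally show ?thesis .
      qed
    qed
  qed
qed

lemma integral_add: "integral a \<Longrightarrow> integral b \<Longrightarrow> integral (a + b)"
  and integral_mult: "integral a \<Longrightarrow> integral b \<Longrightarrow> integral (a * b)"
proof -
  assume "integral a" "integral b"
  then obtain S where S: "finite S" "1 \<in> O_span.span S"
    "\<And>v. v \<in> O_span.span S \<Longrightarrow> a * v \<in> O_span.span S"
    "\<And>v. v \<in> O_span.span S \<Longrightarrow> b * v \<in> O_span.span S"
    using integral_stable_pair by blast
  show "integral (a + b)"
    by (rule integral_if_stable[OF S(1,2)]) (auto simp: distrib_right intro!: O_span.span_add S)
  show "integral (a * b)"
    by (rule integral_if_stable[OF S(1,2)]) (auto simp: mult.assoc intro!: S)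
qed

lemma integral_emb [simp, intro]: "integral (emb a)"
  unfolding integral_def by (rule exI[of _ "[:- a, 1:]"]) simp

lemma integral_0 [simp]: "integral 0" and integral_1 [simp]: "integral 1"
  using integral_emb[of 0] integral_emb[of 1] by simp_all

lemma integral_uminus: "integral a \<Longrightarrow> integral (- a)"
  using integral_mult[of "emb (-1)" a] integral_emb[of "-1"] by (simp del: integral_emb)

lemma integral_power: "integral a \<Longrightarrow> integral (a ^ n)"
  by (induction n) (auto intro: integral_mult)

lemma integral_sum: "(\<And>x. x \<in> A \<Longrightarrow> integral (f x)) \<Longrightarrow> integral (sum f A)"
  by (induction A rule: infinite_finite_induct) (auto intro: integral_add)

lemma integral_pev: "integral a \<Longrightarrow> integral (pev p a)"
  unfolding pev_altdef by (intro integral_sum integral_mult integral_power) auto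

lemma weierstrass_poly_imp_integral: "weierstrass_poly w \<Longrightarrow> pev w a = 0 \<Longrightarrow> integral a"
  unfolding weierstrass_poly_def integral_def by blast

lemma integral_or_inverse: "integral a \<or> integral (inverse a)"
  using integral_dichotomy[of a] weierstrass_poly_imp_integral by (cases "a = 0") auto

lemma integral_root:
  assumes "integral (a ^ n)" "n > 0"
  shows "integral a"
proof -
  from assms(1) obtain p where p: "lead_coeff p = 1" "pev p (a ^ n) = 0" by (auto simp: integral_def)
  define q where "q = (\<Sum>i\<le>degree p. monom (coeff p i) (n * i))"
  have "pev q a = 0" using p(2) by (simp add: q_def pev_sum pev_altdef[of p] power_mult)
  moreover have c: "coeff q k = (\<Sum>i\<le>degree p. if k = n * i then coeff p i else 0)" for k
    by (auto simp: q_def coeff_sum intro!: sum.cong)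
  have "coeff q (n * degree p) = 1" using assms(2) p by (simp add: c)
  moreover have "degree q = n * degree p"
  proof (rule antisym)
    show "degree q \<le> n * degree p"
      by (rule degree_le) (auto simp: c intro!: sum.neutral)
    show "n * degree p \<le> degree q"
      using \<open>coeff q (n * degree p) = 1\<close> by (intro le_degree) simp
  qed
  ultimately have "lead_coeff q = 1 \<and> pev q a = 0" by simp
  then show ?thesis unfolding integral_def by blast
qed

lemma not_integral_inverse_X: "\<not> integral (inverse (emb fps_X) :: 'k::field fls alg_closure)"
proof
  assume "integral (inverse (emb fps_X) :: 'k fls alg_closure)"
  then obtain p :: "'k fps poly" where p: "lead_coeff p = 1" "pev p (inverse (emb fps_X)) = 0"
    by (auto simp: integral_def)
  have d0: "degree p > 0"
    using p by (auto intro!: Nat.gr0I elim!: degree_eq_zeroE)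
  define x where "x = (emb fps_X :: 'k fls alg_closure)"
  have x: "x \<noteq> 0" by (simp add: x_def)
  have "emb (\<Sum>i\<le>degree p. coeff p i * fps_X ^ (degree p - i)) = x ^ degree p * pev p (inverse x)"
    unfolding pev_altdef emb_sum sum_distrib_left
  proof (rule sum.cong, simp)
    fix i assume "i \<in> {..degree p}"
    then have "x ^ degree p = x ^ (degree p - i) * x ^ i" by (simp flip: power_add)
    then show "emb (coeff p i * fps_X ^ (degree p - i)) = x ^ degree p * (emb (coeff p i) * inverse x ^ i)"
      using x by (simp add: x_def field_simps)
  qed
  then have "(\<Sum>i\<le>degree p. coeff p i * fps_X ^ (degree p - i)) = 0"
    using p(2) by (simp add: x_def)
  moreover have "(\<Sum>i\<le>degree p. coeff p i * fps_X ^ (degree p - i)) $ 0 =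
      (\<Sum>i\<in>{degree p}. (coeff p i * fps_X ^ (degree p - i)) $ 0)"
    unfolding fps_sum_nth by (rule sum.mono_neutral_right) auto
  ultimately show False using p(1) by simp
qed

section \<open>The absolute value on the algebraic closure\<close>

definition vunit :: "'k::field fls alg_closure \<Rightarrow> bool" where
  "vunit u \<longleftrightarrow> u \<noteq> 0 \<and> integral u \<and> integral (inverse u)"

lemma vunit_1 [simp]: "vunit 1"
  by (simp add: vunit_def)

lemma vunit_mult: "vunit a \<Longrightarrow> vunit b \<Longrightarrow> vunit (a * b)"
  by (simp add: vunit_def integral_mult)

lemma vunit_inverse: "vunit a \<Longrightarrow> vunit (inverse a)"
  by (simp add: vunit_def)

lemma vunit_power: "vunit a \<Longrightarrow> vunit (a ^ n)"
  by (induction n) (auto intro: vunit_mult)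

lemma vunit_X_powi:
  assumes "vunit (emb fps_X powi p :: 'k::field fls alg_closure)"
  shows "p = 0"
proof -
  have neg: "p \<ge> 0" if "integral (emb fps_X powi p :: 'k fls alg_closure)" for p
  proof (rule ccontr)
    assume p: "\<not> p \<ge> 0"
    have "(emb fps_X powi p) * (emb fps_X ^ nat (- p - 1)) = (inverse (emb fps_X) :: 'k fls alg_closure)"
      using p by (simp flip: power_int_of_nat power_int_add add: power_int_minus)
    with integral_mult[OF that integral_power[OF integral_emb, of fps_X "nat (- p - 1)"]]
      not_integral_inverse_X show False by metis
  qed
  have "integral (emb fps_X powi (- p) :: 'k fls alg_closure)" "integral (emb fps_X powi p :: 'k fls alg_closure)"
    using assms by (simp_all add: vunit_def power_int_minus)
  from neg[OF this(1)] neg[OF this(2)] show ?thesis by simp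
qed

text \<open>
  The exponential valuation of \<open>z\<close> is \<open>t = p/q\<close> if \<open>z^q\<close> is \<open>x^p\<close> up to a unit.
\<close>

definition val_rel :: "'k::field fls alg_closure \<Rightarrow> real \<Rightarrow> bool" where
  "val_rel z t \<longleftrightarrow> (\<exists>(p::int) (q::nat). q > 0 \<and> t = real_of_int p / real q \<and> vunit (z ^ q * emb fps_X powi (- p)))"

lemma val_rel_unique:
  assumes "val_rel z s" "val_rel z t"
  shows "s = t"
proof -
  from assms obtain p p' and q q' :: nat where q: "q > 0" "q' > 0"
    and st: "s = real_of_int p / real q" "t = real_of_int p' / real q'"
    and u: "vunit (z ^ q * emb fps_X powi (- p))" "vunit (z ^ q' * emb fps_X powi (- p'))"
    unfolding val_rel_def by blast
  from u(1) q have "z \<noteq> 0" by (auto simp: vunit_def)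
  have "(z ^ q * emb fps_X powi (- p)) ^ q' * inverse ((z ^ q' * emb fps_X powi (- p')) ^ q) =
      emb fps_X powi (p' * int q - p * int q')"
    using \<open>z \<noteq> 0\<close>
    by (simp add: power_mult_distrib power_int_diff power_int_mult power_int_minus field_simps
        flip: power_mult)
  then have "vunit (emb fps_X powi (p' * int q - p * int q') :: 'a fls alg_closure)"
    by (metis u vunit_mult vunit_inverse vunit_power)
  from vunit_X_powi[OF this] have "real_of_int (p' * int q) = real_of_int (p * int q')" by simp
  then show ?thesis using q unfolding st by (simp add: field_simps)
qed

lemma val_rel_mult:
  assumes "val_rel z s" "val_rel y t"
  shows "val_rel (z * y) (s + t)"
proof -
  from assms obtain p p' and q q' :: nat where q: "q > 0" "q' > 0"
    and st: "s = real_of_int p / real q" "t = real_of_int p' / real q'"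
    and u: "vunit (z ^ q * emb fps_X powi (- p))" "vunit (y ^ q' * emb fps_X powi (- p'))"
    unfolding val_rel_def by blast
  have X: "(emb fps_X powi a :: 'a fls alg_closure) ^ n = emb fps_X powi (a * int n)" for a n
    by (simp add: power_int_mult)
  have "(z ^ q * emb fps_X powi (- p)) ^ q' * (y ^ q' * emb fps_X powi (- p')) ^ q =
      ((z * y) ^ (q * q')) * (emb fps_X powi (- p * int q') * emb fps_X powi (- p' * int q))"
    by (simp add: power_mult_distrib X mult_ac flip: power_mult)
  also have "emb fps_X powi (- p * int q') * emb fps_X powi (- p' * int q) =
      (emb fps_X powi (- (p * int q' + p' * int q)) :: 'a fls alg_closure)"
    by (subst power_int_add [symmetric]) simp_all
  finally have "vunit ((z * y) ^ (q * q') * emb fps_X powi (- (p * int q' + p' * int q)))"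
    using u by (metis vunit_mult vunit_power)
  moreover have "s + t = real_of_int (p * int q' + p' * int q) / real (q * q')"
    using q unfolding st by (simp add: add_frac_eq)
  ultimately show ?thesis
    unfolding val_rel_def using q
    by (intro exI[of _ "p * int q' + p' * int q"] exI[of _ "q * q'"] conjI) simp_all
qed

lemma val_rel_X: "val_rel (emb fps_X) 1"
  unfolding val_rel_def by (rule exI[of _ 1], rule exI[of _ 1]) (simp add: power_int_minus)

lemma val_rel_vunit: "vunit u \<Longrightarrow> val_rel u 0"
  unfolding val_rel_def by (rule exI[of _ 0], rule exI[of _ 1]) simp

lemma integral_iff_val_rel:
  assumes "val_rel z t"
  shows "integral z \<longleftrightarrow> t \<ge> 0"
proof -
  from assms obtain p and q :: nat where q: "q > 0" and t: "t = real_of_int p / real q"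
    and u: "vunit (z ^ q * emb fps_X powi (- p))" unfolding val_rel_def by blast
  define u where "u = z ^ q * emb fps_X powi (- p)"
  have zu: "z ^ q = u * emb fps_X powi p" by (simp add: u_def power_int_minus)
  show ?thesis
  proof
    assume "integral z"
    have "u \<noteq> 0" using u by (simp add: u_def vunit_def)
    then have "emb fps_X powi p = inverse u * z ^ q" by (simp add: zu)
    then have int: "integral (emb fps_X powi p :: 'a fls alg_closure)"
      using u \<open>integral z\<close> by (simp add: integral_mult integral_power vunit_def u_def)
    have "p \<ge> 0"
    proof (rule ccontr)
      assume p: "\<not> p \<ge> 0"
      then have "inverse (emb fps_X powi p) = (emb fps_X ^ nat (- p) :: 'a fls alg_closure)"
        by (simp add: power_int_minus[symmetric] flip: power_int_of_nat)
      then have "vunit (emb fps_X powi p :: 'a fls alg_closure)"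
        using int by (simp add: vunit_def integral_power)
      from vunit_X_powi[OF this] p show False by simp
    qed
    then show "t \<ge> 0" by (simp add: t)
  next
    assume "t \<ge> 0"
    then have "p \<ge> 0" using q by (simp add: t zero_le_divide_iff)
    then have "emb fps_X powi p = (emb fps_X ^ nat p :: 'a fls alg_closure)"
      by (simp flip: power_int_of_nat)
    then have "integral (z ^ q)"
      unfolding zu using u by (simp add: integral_mult integral_power vunit_def u_def)
    then show "integral z" using q by (rule integral_root)
  qed
qed

text \<open>
  For any two nonzero elements, one of their two quotients is integral.
\<close>

lemma dominant_term_exists:
  fixes f :: "'i \<Rightarrow> 'k::field fls alg_closure"
  assumes "finite I" "I \<noteq> {}" "\<And>i. i \<in> I \<Longrightarrow> f i \<noteq> 0"
  shows "\<exists>i\<in>I. \<forall>j\<in>I. integral (f j / f i)"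
  using assms
proof (induction I rule: finite_ne_induct)
  case (singleton i)
  then show ?case by simp
next
  case (insert a I)
  then obtain i where i: "i \<in> I" "\<And>j. j \<in> I \<Longrightarrow> integral (f j / f i)" by auto
  have nz: "f i \<noteq> 0" "f a \<noteq> 0" using insert i by auto
  show ?case
  proof (cases "integral (f a / f i)")
    case True
    with i show ?thesis by auto
  next
    case False
    then have ia: "integral (f i / f a)" using integral_or_inverse[of "f a / f i"] by simp
    have "integral (f j / f a)" if "j \<in> I" for j
    proof -
      have "f j / f a = (f j / f i) * (f i / f a)" using nz by simp
      then show ?thesis using i(2)[OF that] ia by (simp only: integral_mult)
    qed
    moreover have "integral (f a / f a)" using nz by simp
    ultimately show ?thesis by auto
  qed
qed

lemma nonunit_add:
  assumes "integral a" "integral b" "\<not> vunit a" "\<not> vunit b"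
  shows "\<not> vunit (a + b)"
proof -
  \<comment> \<open>if \<open>a + b\<close> is a unit, then so is \<open>b\<close>, as it divides \<open>a + b\<close>\<close>
  have *: "\<not> vunit (a + b)" if ab: "integral a" "integral b" "\<not> vunit b" "b \<noteq> 0" "integral (a / b)" for a b
  proof
    assume "vunit (a + b)"
    then have "integral ((1 + a / b) * inverse (a + b))" "a + b \<noteq> 0"
      using ab by (auto simp: vunit_def intro!: integral_mult integral_add)
    moreover have "(1 + a / b) * inverse (a + b) = inverse b"
      using ab \<open>a + b \<noteq> 0\<close> by (simp add: field_simps)
    ultimately show False using ab by (simp add: vunit_def)
  qed
  show ?thesis
  proof (cases "a = 0 \<or> b = 0")
    case False
    then show ?thesis
      using *[of a b] *[of b a] assms integral_or_inverse[of "a / b"] by (auto simp: add.commute)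
  qed (use assms in auto)
qed

lemma nonunit_sum:
  assumes "\<And>i. i \<in> I \<Longrightarrow> integral (f i) \<and> \<not> vunit (f i)"
  shows "integral (sum f I) \<and> \<not> vunit (sum f I)"
  using assms
  by (induction I rule: infinite_finite_induct)
    (auto simp: vunit_def[of 0] intro: integral_add dest: nonunit_add[rotated 2])

lemma vunit_emb: "a $ 0 \<noteq> 0 \<Longrightarrow> vunit (emb a)"
proof -
  assume a: "a $ 0 \<noteq> 0"
  then have "emb a * emb (inverse a) = 1"
    by (simp flip: emb_simps(6) add: inverse_mult_eq_1')
  then have "inverse (emb a) = emb (inverse a)" by (rule inverse_unique)
  with a show ?thesis by (auto simp: vunit_def)
qed

lemma val_rel_power: "val_rel z t \<Longrightarrow> val_rel (z ^ n) (real n * t)"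
proof (induction n)
  case 0
  then show ?case by (simp add: val_rel_vunit)
next
  case (Suc n)
  from val_rel_mult[OF Suc.prems Suc.IH[OF Suc.prems]] show ?case by (simp add: algebra_simps)
qed

lemma val_rel_emb:
  assumes "a \<noteq> 0"
  shows "val_rel (emb a) (real (subdegree a))"
proof -
  have "a = unit_factor a * fps_X ^ subdegree a"
    by (rule fps_unit_factor_decompose)
  then have "emb a = emb (unit_factor a) * emb fps_X ^ subdegree a"
    by (metis emb_simps(6,7))
  moreover have "val_rel (emb (unit_factor a) * emb fps_X ^ subdegree a) (0 + real (subdegree a) * 1)"
    using assms by (intro val_rel_mult val_rel_power val_rel_X val_rel_vunit vunit_emb) simp
  ultimately show ?thesis by simp
qed

lemma val_rel_inverse:
  assumes "val_rel z t"
  shows "val_rel (inverse z) (- t)"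
proof -
  from assms obtain p and q :: nat where q: "q > 0" and t: "t = real_of_int p / real q"
    and u: "vunit (z ^ q * emb fps_X powi (- p))" unfolding val_rel_def by blast
  from vunit_inverse[OF u] have "vunit (inverse z ^ q * emb fps_X powi (- (- p)))"
    by (simp add: power_int_minus power_inverse)
  with q show ?thesis unfolding val_rel_def t
    by (intro exI[of _ "- p"] exI[of _ q]) simp
qed

text \<open>
  In a vanishing sum the dominant term is not alone, because the elements that are integral but
  not units are closed under addition.  Applied to the terms of a polynomial that annihilates \<open>z\<close>,
  this gives two of them whose quotient is a unit, and this quotient is a power of \<open>z\<close> times an
  element of \<open>K((x))\<close>.
\<close>

lemma val_rel_exists:
  fixes z :: "'k::field fls alg_closure"
  assumes "z \<noteq> 0"
  shows "\<exists>t. val_rel z t"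
proof -
  obtain p where p: "p \<noteq> 0" "pev p z = 0" by (rule annihilating_poly_exists)
  define I where "I = {i. i \<le> degree p \<and> coeff p i \<noteq> 0}"
  define f where "f = (\<lambda>i. emb (coeff p i) * z ^ i)"
  have I: "finite I" "I \<noteq> {}" using p by (auto simp: I_def)
  have f: "f i \<noteq> 0" if "i \<in> I" for i using that assms by (simp add: f_def I_def)
  have "\<exists>i\<in>I. \<forall>j\<in>I. integral (f j / f i)"
    using I f by (rule dominant_term_exists)
  then obtain i where i: "i \<in> I" "\<forall>j\<in>I. integral (f j / f i)"
    by (elim bexE)
  have "sum f I = 0"
  proof -
    have "sum f I = (\<Sum>i\<le>degree p. f i)"
      by (rule sum.mono_neutral_left) (auto simp: I_def f_def)
    then show ?thesis using p by (simp add: f_def pev_altdef)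
  qed
  then have "f i + sum f (I - {i}) = 0" using i I by (simp add: sum.remove)
  then have "sum f (I - {i}) = - f i" by (simp add: eq_neg_iff_add_eq_0 add.commute)
  then have sum_neg1: "(\<Sum>j\<in>I - {i}. f j / f i) = - 1"
    using f[OF i(1)] by (simp add: sum_divide_distrib[symmetric])
  have "vunit (- 1 :: 'k fls alg_closure)" by (simp add: vunit_def integral_uminus)
  then have "vunit (\<Sum>j\<in>I - {i}. f j / f i)" by (simp only: sum_neg1)
  then obtain j where j: "j \<in> I" "j \<noteq> i" "vunit (f j / f i)"
    using nonunit_sum[of "I - {i}" "\<lambda>j. f j / f i"] i by blast
  have ex: "\<exists>t. val_rel z t" if ij: "i \<in> I" "j \<in> I" "i < j" "vunit (f j / f i)" for i j
  proof -
    define d where "d = real (subdegree (coeff p i)) - real (subdegree (coeff p j))"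
    have nz: "coeff p i \<noteq> 0" "coeff p j \<noteq> 0" using ij by (auto simp: I_def)
    have "z ^ j = z ^ (j - i) * z ^ i" using ij by (simp flip: power_add)
    then have "f j / f i = emb (coeff p j) * z ^ (j - i) / emb (coeff p i)"
      using assms by (simp add: f_def)
    then have "z ^ (j - i) = (f j / f i) * (emb (coeff p i) * inverse (emb (coeff p j)))"
      using nz by simp
    moreover have "val_rel \<dots> (0 + (real (subdegree (coeff p i)) + - real (subdegree (coeff p j))))"
      by (intro val_rel_mult val_rel_vunit val_rel_inverse val_rel_emb ij nz)
    ultimately have v: "val_rel (z ^ (j - i)) d" by (simp add: d_def)
    then obtain p' and q' :: nat where q: "q' > 0"
      and u: "vunit ((z ^ (j - i)) ^ q' * emb fps_X powi (- p'))" unfolding val_rel_def by blast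
    then have "val_rel z (real_of_int p' / real ((j - i) * q'))"
      unfolding val_rel_def using ij
      by (intro exI[of _ p'] exI[of _ "(j - i) * q'"]) (simp add: power_mult)
    then show ?thesis by blast
  qed
  show ?thesis
  proof (cases "i < j")
    case True
    with ex[of i j] i j show ?thesis by blast
  next
    case False
    with j have "j < i" by simp
    moreover have "vunit (f i / f j)" using vunit_inverse[OF j(3)] by simp
    ultimately show ?thesis using ex[of j i] i j by blast
  qed
qed

text \<open>
  The extended absolute value, normalised by \<open>\<bar>x\<bar> = 1/2\<close>.
\<close>

definition nrm :: "'k::field fls alg_closure \<Rightarrow> real" where
  "nrm z = (if z = 0 then 0 else 2 powr (- (THE t. val_rel z t)))"

lemma nrm_eq: "val_rel z t \<Longrightarrow> nrm z = 2 powr (- t)"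
proof -
  assume *: "val_rel z t"
  then have "z \<noteq> 0" by (auto simp: val_rel_def vunit_def)
  moreover have "(THE t. val_rel z t) = t"
    using * val_rel_unique by (intro the_equality) blast+
  ultimately show ?thesis by (simp add: nrm_def)
qed

lemma nrm_0 [simp]: "nrm 0 = 0" by (simp add: nrm_def)

lemma nrm_eq_0_iff [simp]: "nrm z = 0 \<longleftrightarrow> z = 0" by (simp add: nrm_def)

lemma nrm_nonneg [simp]: "nrm z \<ge> 0" by (simp add: nrm_def)

lemma nrm_pos_iff [simp]: "nrm z > 0 \<longleftrightarrow> z \<noteq> 0"
  using nrm_nonneg[of z] nrm_eq_0_iff[of z] by linarith

lemma nrm_mult: "nrm (a * b) = nrm a * nrm b"
proof (cases "a = 0 \<or> b = 0")
  case False
  then obtain s t where "val_rel a s" "val_rel b t" using val_rel_exists by blast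
  then show ?thesis using val_rel_mult[of a s b t] by (simp add: nrm_eq powr_add[symmetric])
qed auto

lemma nrm_1 [simp]: "nrm 1 = 1"
  using nrm_eq[OF val_rel_vunit[OF vunit_1]] by simp

lemma nrm_power: "nrm (a ^ n) = nrm a ^ n"
  by (induction n) (simp_all add: nrm_mult)

lemma nrm_inverse: "nrm (inverse a) = inverse (nrm a)"
proof (cases "a = 0")
  case False
  then have "nrm a * nrm (inverse a) = 1" by (simp flip: nrm_mult)
  then show ?thesis by (metis inverse_unique)
qed auto

lemma nrm_divide: "nrm (a / b) = nrm a / nrm b"
  by (simp add: divide_inverse nrm_mult nrm_inverse)

lemma nrm_X [simp]: "nrm (emb fps_X) = 1 / 2"
  using nrm_eq[OF val_rel_X] by (simp add: powr_minus)

lemma nrm_le_1_iff: "nrm z \<le> 1 \<longleftrightarrow> integral z"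
proof (cases "z = 0")
  case False
  then obtain t where t: "val_rel z t" using val_rel_exists by blast
  have "2 powr (- t) \<le> 2 powr 0 \<longleftrightarrow> - t \<le> 0" by (rule powr_le_cancel_iff) simp
  then show ?thesis using integral_iff_val_rel[OF t] by (simp add: nrm_eq[OF t])
qed simp

lemma nrm_vunit: "vunit u \<Longrightarrow> nrm u = 1"
  using nrm_eq[OF val_rel_vunit, of u] by simp

lemma nrm_uminus [simp]: "nrm (- a) = nrm a"
proof -
  have "nrm (- 1 :: 'a fls alg_closure) = 1"
    by (rule nrm_vunit) (simp add: vunit_def integral_uminus)
  then show ?thesis using nrm_mult[of "-1" a] by simp
qed

lemma nrm_add: "nrm (a + b) \<le> max (nrm a) (nrm b)"
proof -
  have *: "nrm (a + b) \<le> nrm b" if "nrm a \<le> nrm b" "b \<noteq> 0" for a b :: "'a fls alg_closure"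
  proof -
    have "nrm (a / b) \<le> 1" using that by (simp add: nrm_divide divide_le_eq)
    then have "nrm (a / b + 1) \<le> 1" unfolding nrm_le_1_iff by (intro integral_add) auto
    moreover have "a / b + 1 = (a + b) / b" using that by (simp add: field_simps)
    ultimately show ?thesis using that by (simp add: nrm_divide divide_le_eq)
  qed
  show ?thesis
  proof (cases "nrm a \<le> nrm b")
    case True
    then show ?thesis using *[of a b] by (cases "b = 0") auto
  next
    case False
    then have "a \<noteq> 0" by auto
    with False show ?thesis using *[of b a] by (simp add: add.commute)
  qed
qed

lemma nrm_diff: "nrm (a - b) \<le> max (nrm a) (nrm b)"
  using nrm_add[of a "- b"] by simp

lemma nrm_minus_commute: "nrm (a - b) = nrm (b - a)"
  using nrm_uminus[of "a - b"] by simp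

lemma nrm_add_eq:
  assumes "nrm a < nrm b"
  shows "nrm (a + b) = nrm b"
proof (rule antisym)
  show "nrm (a + b) \<le> nrm b" using nrm_add[of a b] assms by simp
  show "nrm b \<le> nrm (a + b)" using nrm_diff[of "a + b" a] assms by simp
qed

lemma nrm_emb_le_1: "nrm (emb a) \<le> 1"
  by (simp add: nrm_le_1_iff)

text \<open>
  A monic equation for the quotient at \<open>a\<close> becomes, when denominators are cleared, a polynomial
  \<open>T\<close> over \<open>K[[x]]\<close> that annihilates \<open>a\<close>.  Then \<open>T\<close> annihilates \<open>b\<close> as well, and this is the same
  equation for the quotient at \<open>b\<close>.
\<close>

lemma conjugate_integral_quotient:
  assumes conj: "\<And>p. pev p a = 0 \<Longrightarrow> pev p b = 0"
    and nz: "pev Q2 b \<noteq> 0" and int: "integral (pev Q1 a / pev Q2 a)"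
  shows "integral (pev Q1 b / pev Q2 b)"
proof -
  have nz': "pev Q2 a \<noteq> 0" using conj nz by blast
  from int obtain r where r: "lead_coeff r = 1" "pev r (pev Q1 a / pev Q2 a) = 0"
    by (auto simp: integral_def)
  define T where "T = (\<Sum>i\<le>degree r. smult (coeff r i) (Q1 ^ i * Q2 ^ (degree r - i)))"
  have T: "pev T c = pev Q2 c ^ degree r * pev r (pev Q1 c / pev Q2 c)" if "pev Q2 c \<noteq> 0" for c
    unfolding T_def pev_sum pev_altdef[of r] sum_distrib_left
  proof (rule sum.cong, simp)
    fix i assume "i \<in> {..degree r}"
    then have "pev Q2 c ^ degree r = pev Q2 c ^ (degree r - i) * pev Q2 c ^ i"
      by (simp flip: power_add)
    then show "pev (smult (coeff r i) (Q1 ^ i * Q2 ^ (degree r - i))) c =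
        pev Q2 c ^ degree r * (emb (coeff r i) * (pev Q1 c / pev Q2 c) ^ i)"
      using that by (simp add: power_divide)
  qed
  have "pev T b = 0" by (rule conj) (simp add: T[OF nz'] r)
  then have "pev r (pev Q1 b / pev Q2 b) = 0" using T[OF nz] nz by simp
  with r show ?thesis unfolding integral_def by blast
qed

text \<open>
  An identity \<open>Q(a)^q = x^p u\<close> with a unit \<open>u\<close> says that a quotient of two polynomials in \<open>a\<close> and its
  inverse are integral, so it passes to conjugates.
\<close>

lemma conjugate_nrm:
  fixes a b :: "'k::field fls alg_closure"
  assumes conj: "\<And>p. pev p a = 0 \<longleftrightarrow> pev p b = 0"
  shows "nrm (pev Q a) = nrm (pev Q b)"
proof (cases "pev Q a = 0")
  case True
  with conj show ?thesis by simp
next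
  case False
  with conj have nz: "pev Q b \<noteq> 0" by blast
  from False val_rel_exists obtain t where "val_rel (pev Q a) t" by blast
  then obtain p and q :: nat where q: "q > 0"
    and u: "vunit (pev Q a ^ q * emb fps_X powi (- p))" unfolding val_rel_def by blast
  obtain m n where p: "p = int m - int n" by (metis int_diff_cases)
  define P where "P = Q ^ q * [:fps_X ^ n:]"
  define R where "R = [:fps_X ^ m :: 'k fps:]"
  have eq: "pev Q c ^ q * emb fps_X powi (- p) = pev P c / pev R c" for c
    by (simp add: P_def R_def p power_int_diff)
  have nzP: "pev P c \<noteq> 0" if "c = a \<or> c = b" for c
    using that nz False by (auto simp: P_def)
  have nzR: "pev R c \<noteq> 0" for c by (simp add: R_def)
  have "integral (pev P a / pev R a)" "integral (pev R a / pev P a)"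
    using u by (simp_all add: eq vunit_def)
  note int = this
  have conj': "pev p b = 0" if "pev p a = 0" for p using that conj by simp
  have "pev P b \<noteq> 0" "pev R b \<noteq> 0" using nzP nzR by simp_all
  from conjugate_integral_quotient[OF conj' this(2) int(1)]
    conjugate_integral_quotient[OF conj' this(1) int(2)]
  have "vunit (pev P b / pev R b)" using nzP[of b] nzR[of b] by (simp add: vunit_def)
  then have u': "vunit (pev Q b ^ q * emb fps_X powi (- p))" by (simp add: eq)
  have "val_rel (pev Q a) (real_of_int p / real q)" "val_rel (pev Q b) (real_of_int p / real q)"
    unfolding val_rel_def using q u u' by blast+
  then show ?thesis by (simp add: nrm_eq)
qed

section \<open>Intersection numbers as absolute values\<close>

lemma nrm_sum_le:
  assumes "\<And>i. i \<in> I \<Longrightarrow> nrm (f i) \<le> B" "B \<ge> 0"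
  shows "nrm (sum f I) \<le> B"
  using assms(1)
proof (induction I rule: infinite_finite_induct)
  case (insert i I)
  then have "nrm (f i) \<le> B" "nrm (sum f I) \<le> B" by auto
  then show ?case using nrm_add[of "f i" "sum f I"] insert.hyps by simp
qed (use assms(2) in auto)

lemma nrm_emb_unit: "a $ 0 \<noteq> 0 \<Longrightarrow> nrm (emb a) = 1"
  by (rule nrm_vunit[OF vunit_emb])

lemma nrm_emb_nonunit:
  fixes a :: "'k::field fps"
  assumes "a $ 0 = 0"
  shows "nrm (emb a) \<le> 1 / 2"
proof -
  have "fps_X * fps_shift 1 a = a"
    using assms by (intro fps_ext) (auto simp: fps_X_mult_nth)
  from arg_cong[OF this, of "\<lambda>a. nrm (emb a)"]
  have "nrm (emb a) = nrm (emb (fps_X :: 'k fps)) * nrm (emb (fps_shift 1 a))"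
    unfolding emb_simps(6) nrm_mult by (rule sym)
  then show ?thesis using nrm_emb_le_1[of "fps_shift 1 a"] by simp
qed

lemma weierstrass_root_nrm_less_1:
  assumes w: "weierstrass_poly w" and a: "pev w a = 0"
  shows "nrm a < 1"
proof (rule ccontr)
  assume "\<not> nrm a < 1"
  moreover have "nrm a \<le> 1"
    unfolding nrm_le_1_iff using weierstrass_poly_imp_integral[OF w a] .
  ultimately have a1: "nrm a = 1" by simp
  have "{..degree w} = insert (degree w) {..<degree w}" by auto
  then have "a ^ degree w + (\<Sum>i<degree w. emb (coeff w i) * a ^ i) = 0"
    using a w by (simp add: pev_altdef weierstrass_poly_def)
  then have "a ^ degree w = - (\<Sum>i<degree w. emb (coeff w i) * a ^ i)"
    by (simp add: eq_neg_iff_add_eq_0)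
  then have "nrm (a ^ degree w) = nrm (\<Sum>i<degree w. emb (coeff w i) * a ^ i)"
    by simp
  also have "\<dots> \<le> 1 / 2"
  proof (rule nrm_sum_le)
    fix i assume "i \<in> {..<degree w}"
    then have "coeff w i $ 0 = 0" using w by (simp add: weierstrass_poly_def)
    from nrm_emb_nonunit[OF this] show "nrm (emb (coeff w i) * a ^ i) \<le> 1 / 2"
      by (simp add: nrm_mult nrm_power a1)
  qed simp
  finally show False by (simp add: nrm_power a1)
qed

text \<open>
  A branch other than the axis \<open>x = 0\<close>, given by a Weierstrass polynomial and one of its roots.
  Substituting \<open>a\<close> for \<open>y\<close> identifies \<open>K[[x,y]]/(w)\<close> with \<open>K[[x]][a]\<close>.
\<close>

locale branch_root =
  fixes w :: "'k::field fps poly" and a :: "'k fls alg_closure"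
  assumes weierstrass: "weierstrass_poly w"
    and irreducible_w: "irreducible (fps_of_poly w)"
    and root: "pev w a = 0"
begin

abbreviation W :: "'k ps2" where "W \<equiv> fps_of_poly w"

lemma monic: "lead_coeff w = 1"
  using weierstrass by (simp add: weierstrass_poly_def)

lemma degree_pos: "degree w > 0"
proof (rule Nat.gr0I)
  assume "degree w = 0"
  then obtain c where "w = [:c:]" by (rule degree_eq_zeroE)
  with monic root show False by simp
qed

lemma nrm_root: "nrm a < 1"
  using weierstrass_root_nrm_less_1[OF weierstrass root] .

lemma integral_root_a: "integral a"
  using weierstrass_poly_imp_integral[OF weierstrass root] .

text \<open>
  Irreducibility of \<open>w\<close> as a power series entails irreducibility over \<open>K((x))\<close>: a minimal
  annihilator of \<open>a\<close> is again a Weierstrass polynomial, it divides \<open>w\<close>, and the cofactor must be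
  a unit of \<open>K[[x,y]]\<close>, hence of order 0 modulo \<open>x\<close>.
\<close>

lemma degree_minimal:
  assumes "q \<noteq> 0" "pev q a = 0"
  shows "degree w \<le> degree q"
proof (rule minimal_annihilator_cases[of a])
  fix p assume p: "pev p a = 0" "coeff p 0 $ 0 \<noteq> 0"
  \<comment> \<open>impossible: the constant term of \<open>p\<close> has norm 1, all other terms are smaller\<close>
  obtain p' where p': "p = pCons (coeff p 0) p'" by (metis coeff_pCons_0 pCons_cases)
  have "emb (coeff p 0) + a * pev p' a = 0"
    using p(1) by (subst (asm) p') simp
  then have "emb (coeff p 0) = - (a * pev p' a)" by (simp add: eq_neg_iff_add_eq_0)
  then have "nrm a * nrm (pev p' a) = 1"
    using nrm_emb_unit[OF p(2)] by (simp add: nrm_mult)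
  moreover have "nrm (pev p' a) \<le> 1"
    unfolding nrm_le_1_iff by (intro integral_pev integral_root_a)
  then have "nrm a * nrm (pev p' a) \<le> nrm a * 1"
    by (intro mult_left_mono) auto
  ultimately show ?thesis using nrm_root by simp
next
  fix v assume v: "weierstrass_poly v" "pev v a = 0"
    and min: "\<And>q. q \<noteq> 0 \<Longrightarrow> pev q a = 0 \<Longrightarrow> degree v \<le> degree q"
  have monv: "lead_coeff v = 1" using v by (simp add: weierstrass_poly_def)
  from monic_division[OF monv, of w] obtain t u where tu: "w = v * t + u" "u = 0 \<or> degree u < degree v"
    by metis
  have "pev u a = 0" using root v tu(1) by simp
  with min[of u] tu(2) have "u = 0" by force
  then have wvt: "W = fps_of_poly v * fps_of_poly t" using tu by (simp add: fps_of_poly_mult)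
  have "\<not> fps_of_poly v dvd 1"
  proof
    assume "fps_of_poly v dvd 1"
    then have "coeff v 0 $ 0 \<noteq> 0" by (simp add: ps2_is_unit_iff)
    then have "degree v = 0" using v(1) by (auto simp: weierstrass_poly_def)
    then obtain c where "v = [:c:]" by (rule degree_eq_zeroE)
    with monv v show False by simp
  qed
  with wvt irreducible_w have "fps_of_poly t dvd 1"
    unfolding Factorial_Ring.irreducible_def by blast
  then have t0: "coeff t 0 $ 0 \<noteq> 0" by (simp add: ps2_is_unit_iff)
  \<comment> \<open>modulo \<open>x\<close>, the series \<open>v\<close> has order \<open>degree v\<close> and \<open>t\<close> has order 0\<close>
  define r where "r = degree v"
  have "coeff w r $ 0 = (\<Sum>i\<le>r. coeff v i $ 0 * coeff t (r - i) $ 0)"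
    using tu \<open>u = 0\<close> by (simp add: coeff_mult fps_sum_nth)
  also have "\<dots> = (\<Sum>i\<in>{r}. coeff v i $ 0 * coeff t (r - i) $ 0)"
    by (rule sum.mono_neutral_right) (use v in \<open>auto simp: weierstrass_poly_def r_def\<close>)
  also have "\<dots> \<noteq> 0" using monv t0 by (simp add: r_def)
  finally have "degree w \<le> r" using weierstrass by (auto simp: weierstrass_poly_def not_less[symmetric])
  also have "r \<le> degree q" unfolding r_def by (rule min[OF assms])
  finally show ?thesis .
qed

lemma pev_eq_0_iff: "pev p a = 0 \<longleftrightarrow> w dvd p"
proof
  assume p: "pev p a = 0"
  from monic_division[OF monic, of p] obtain q r where qr: "p = w * q + r" "r = 0 \<or> degree r < degree w"
    by metis
  have "pev r a = 0" using p qr(1) root by simp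
  with degree_minimal[of r] qr(2) have "r = 0" by force
  with qr show "w dvd p" by simp
qed (auto simp: root elim: dvdE)

text \<open>
  The substitution of \<open>a\<close> for \<open>y\<close>.  By Weierstrass division, every series is congruent modulo
  \<open>w\<close> to a polynomial in \<open>y\<close>, so that no convergence is involved.
\<close>

definition ev :: "'k ps2 \<Rightarrow> 'k fls alg_closure" where
  "ev h = pev (SOME p. W dvd h - fps_of_poly p) a"

lemma representative_exists: "\<exists>p. W dvd h - fps_of_poly p"
proof -
  from weierstrass_division[OF weierstrass_poly_regular[OF weierstrass], of h]
  obtain q r where "h = W * q + fps_of_poly r" by blast
  then show ?thesis by (intro exI[of _ r]) simp
qed

lemma ev_eqI:
  assumes "W dvd h - fps_of_poly p"
  shows "ev h = pev p a"
proof -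
  define r where "r = (SOME p. W dvd h - fps_of_poly p)"
  have "W dvd h - fps_of_poly r"
    unfolding r_def by (rule someI_ex[OF representative_exists])
  from dvd_diff[OF this assms] have "W dvd fps_of_poly (p - r)"
    by (simp add: fps_of_poly_diff)
  then have "w dvd p - r" by (intro fps_of_poly_multiple_imp_dvd weierstrass)
  then have "pev (p - r) a = 0" by (simp only: pev_eq_0_iff)
  then show ?thesis by (simp add: ev_def r_def)
qed

lemma ev_rep: obtains p where "W dvd h - fps_of_poly p" "ev h = pev p a"
  using representative_exists ev_eqI by blast

lemma ev_fps_of_poly [simp]: "ev (fps_of_poly p) = pev p a"
  by (rule ev_eqI) simp

lemma ev_add [simp]: "ev (g + h) = ev g + ev h"
proof -
  obtain p where p: "W dvd g - fps_of_poly p" "ev g = pev p a" by (rule ev_rep)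
  obtain q where q: "W dvd h - fps_of_poly q" "ev h = pev q a" by (rule ev_rep)
  have "W dvd (g - fps_of_poly p) + (h - fps_of_poly q)" using p q by (intro dvd_add) auto
  then have "W dvd (g + h) - fps_of_poly (p + q)" by (simp add: fps_of_poly_add algebra_simps)
  from ev_eqI[OF this] p q show ?thesis by simp
qed

lemma ev_mult [simp]: "ev (g * h) = ev g * ev h"
proof -
  obtain p where p: "W dvd g - fps_of_poly p" "ev g = pev p a" by (rule ev_rep)
  obtain q where q: "W dvd h - fps_of_poly q" "ev h = pev q a" by (rule ev_rep)
  have "W dvd (g - fps_of_poly p) * h + fps_of_poly p * (h - fps_of_poly q)"
    using p q by (intro dvd_add dvd_mult dvd_mult2) auto
  then have "W dvd g * h - fps_of_poly (p * q)" by (simp add: fps_of_poly_mult algebra_simps)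
  from ev_eqI[OF this] p q show ?thesis by simp
qed

lemma ev_0 [simp]: "ev 0 = 0" and ev_1 [simp]: "ev 1 = 1"
  using ev_fps_of_poly[of 0] ev_fps_of_poly[of 1] by simp_all

lemma ev_const [simp]: "ev (fps_const c) = emb c"
  using ev_fps_of_poly[of "[:c:]"] by (simp add: fps_of_poly_const)

lemma ev_power [simp]: "ev (g ^ n) = ev g ^ n"
  by (induction n) simp_all

lemma ev_eq_0_iff: "ev h = 0 \<longleftrightarrow> W dvd h"
proof
  assume h: "ev h = 0"
  obtain p where p: "W dvd h - fps_of_poly p" "ev h = pev p a" by (rule ev_rep)
  with h have "w dvd p" by (simp add: pev_eq_0_iff)
  then have "W dvd fps_of_poly p" by (auto simp: fps_of_poly_mult elim!: dvdE)
  with p(1) have "W dvd (h - fps_of_poly p) + fps_of_poly p" by (rule dvd_add)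
  then show "W dvd h" by simp
next
  assume "W dvd h"
  then show "ev h = 0" using ev_eqI[of h 0] by simp
qed

lemma ev_diff [simp]: "ev (g - h) = ev g - ev h"
  using ev_add[of "g - h" h] by (simp add: algebra_simps del: ev_add)

lemma ev_uminus [simp]: "ev (- h) = - ev h"
  using ev_diff[of 0 h] by simp

lemma pev_ev_in_range: "\<exists>h. pev p (ev g) = ev h"
proof (induction p)
  case 0
  show ?case by (metis ev_0 pev_0)
next
  case (pCons c p)
  then obtain h where "pev p (ev g) = ev h" by blast
  then have "pev (pCons c p) (ev g) = ev (fps_const c + g * h)" by simp
  then show ?case by blast
qed

lemma integral_ev: "integral (ev h)"
  by (rule ev_rep[of h]) (simp add: integral_pev integral_root_a)

abbreviation codim :: "'k ps2 \<Rightarrow> nat \<Rightarrow> bool" where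
  "codim g m \<equiv> has_codim (principal W + principal g) m"

abbreviation x :: "'k ps2" where "x \<equiv> fps_const fps_X"

lemma ideal_subset:
  assumes "ev h = ev g * ev b"
  shows "principal W + principal h \<subseteq> principal W + principal g"
proof
  fix z assume "z \<in> principal W + principal h"
  then obtain p q where z: "z = W * p + h * q" by (auto simp: mem_principal_plus)
  have "ev (h - g * b) = 0" using assms by simp
  then have "W dvd h - g * b" by (simp only: ev_eq_0_iff)
  then obtain c where "h - g * b = W * c" by (rule dvdE)
  then have "h = W * c + g * b" by (simp add: diff_eq_eq add.commute)
  then have "z = W * (p + c * q) + g * (b * q)" unfolding z by (simp only:) (simp add: algebra_simps)
  then show "z \<in> principal W + principal g" by (auto simp: mem_principal_plus)
qed

lemma codim_cong: "ev g = ev h \<Longrightarrow> codim g m \<longleftrightarrow> codim h m"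
  using ideal_subset[of g h 1] ideal_subset[of h g 1] by simp

lemma codim_mult:
  assumes "ev g \<noteq> 0" "codim g m" "codim h n"
  shows "codim (g * h) (m + n)"
proof (rule has_codim_mult[OF _ _ assms(2,3)])
  show "g \<noteq> 0" using assms(1) by auto
  fix b assume "W dvd g * b"
  then have "ev (g * b) = 0" by (simp only: ev_eq_0_iff)
  with assms(1) have "ev b = 0" by simp
  then show "W dvd b" by (simp only: ev_eq_0_iff)
qed

lemma codim_1: "codim 1 0"
  unfolding has_codim_def
proof (intro exI[of _ "{}"] conjI)
  have "h \<in> principal W + principal 1" for h
    unfolding mem_principal_plus by (intro exI[of _ 0] exI[of _ h]) simp
  then show "quotient_basis (principal W + principal 1) {}"
    by (simp add: quotient_basis_def)
qed simp

lemma codim_power: "ev g \<noteq> 0 \<Longrightarrow> codim g m \<Longrightarrow> codim (g ^ k) (k * m)"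
proof (induction k)
  case 0
  then show ?case using codim_1 by simp
next
  case (Suc k)
  from codim_mult[OF Suc.prems Suc.IH[OF Suc.prems]] show ?case by simp
qed

text \<open>
  Modulo \<open>x\<close> the polynomial \<open>w\<close> is \<open>y^n\<close>, so the powers of \<open>y\<close> below \<open>n\<close> form a basis.
\<close>

lemma codim_x: "codim x (degree w)"
  unfolding has_codim_def
proof (intro exI[of _ "(^) fps_X ` {..<degree w}"] conjI)
  have inj: "inj_on ((^) (fps_X :: 'k ps2)) {..<degree w}"
    by (rule inj_onI) simp
  then show "card ((^) (fps_X :: 'k ps2) ` {..<degree w}) = degree w"
    by (simp add: card_image)
  have sum: "(\<Sum>b\<in>(^) fps_X ` {..<degree w}. ps2_const (c b) * b) =
      fps_of_poly (\<Sum>j<degree w. monom (fps_const (c (fps_X ^ j))) j)" for c :: "'k ps2 \<Rightarrow> 'k"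
    by (simp add: sum.reindex[OF inj] fps_of_poly_sum fps_of_poly_monom ps2_const_def)
  show "quotient_basis (principal W + principal x) ((^) fps_X ` {..<degree w})"
    unfolding quotient_basis_def sum
  proof (intro conjI allI impI)
    fix c :: "'k ps2 \<Rightarrow> 'k"
    let ?r = "\<Sum>j<degree w. monom (fps_const (c (fps_X ^ j))) j"
    have coef: "coeff ?r j $ 0 = (if j < degree w then c (fps_X ^ j) else 0)" for j
      by (simp add: coeff_sum)
    assume "fps_of_poly ?r \<in> principal W + principal x"
    then obtain p q where pq: "fps_of_poly ?r = W * p + x * q" by (auto simp: mem_principal_plus)
    have "coeff ?r j $ 0 = 0" if "j < degree w" for j
    proof -
      have "coeff ?r j $ 0 = (W * p + x * q) $ j $ 0"
        unfolding pq[symmetric] by simp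
      also have "\<dots> = (W * p) $ j $ 0" by simp
      also have "\<dots> = (\<Sum>i=0..j. coeff w i $ 0 * p $ (j - i) $ 0)"
        by (simp add: fps_mult_nth fps_sum_nth)
      also have "\<dots> = 0"
        using weierstrass that by (intro sum.neutral) (auto simp: weierstrass_poly_def)
      finally show ?thesis .
    qed
    then show "\<forall>b\<in>(^) fps_X ` {..<degree w}. c b = 0" by (auto simp: coef)
  next
    fix h :: "'k ps2"
    from weierstrass_division[OF weierstrass_poly_regular[OF weierstrass], of h]
    obtain q r where qr: "h = W * q + fps_of_poly r" "\<forall>j\<ge>degree w. coeff r j = 0" by blast
    define c :: "'k ps2 \<Rightarrow> 'k" where "c = (\<lambda>b. coeff r (subdegree b) $ 0)"
    let ?r = "\<Sum>j<degree w. monom (fps_const (c (fps_X ^ j))) j"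
    have cr: "coeff ?r j = fps_const (coeff r j $ 0)" for j
      using qr(2) by (auto simp: coeff_sum c_def not_less)
    define s where "s = map_poly (fps_shift 1) r"
    have "r - ?r = smult fps_X s"
    proof (rule poly_eqI)
      fix j
      have "coeff r j - fps_const (coeff r j $ 0) = fps_X * fps_shift 1 (coeff r j)"
        by (rule fps_ext) (simp add: fps_X_mult_nth)
      then show "coeff (r - ?r) j = coeff (smult fps_X s) j"
        by (simp only: coeff_diff cr coeff_smult) (simp add: s_def coeff_map_poly)
    qed
    then have "h - fps_of_poly ?r = W * q + x * fps_of_poly s"
      unfolding qr(1) by (simp add: algebra_simps flip: fps_of_poly_smult fps_of_poly_diff)
    then have "h - fps_of_poly ?r \<in> principal W + principal x"
      unfolding mem_principal_plus by blast
    then show "\<exists>c :: 'k ps2 \<Rightarrow> 'k. h - fps_of_poly (\<Sum>j<degree w. monom (fps_const (c (fps_X ^ j))) j) \<in>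
        principal W + principal x" by (rule exI[of _ c])
  qed simp
qed

lemma codim_x_power: "codim (x ^ N) (N * degree w)"
  by (rule codim_power[OF _ codim_x]) simp

text \<open>
  The constant term of a minimal polynomial of \<open>g(a)\<close> is a multiple of \<open>g(a)\<close> in
  \<open>K[[x]][a]\<close>, and it is a power of \<open>x\<close> up to a unit of \<open>K[[x]]\<close>.
\<close>

lemma ev_dvd_x_power:
  assumes "ev g \<noteq> 0"
  obtains N h where "ev g * ev h = emb fps_X ^ N"
proof -
  let ?P = "\<lambda>p. p \<noteq> 0 \<and> pev p (ev g) = 0"
  obtain p0 where "?P p0" using annihilating_poly_exists by blast
  from ex_has_least_nat[of ?P, OF this, of degree] obtain p
    where p: "?P p" "\<And>q. ?P q \<Longrightarrow> degree p \<le> degree q" by auto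
  obtain c q where cq: "p = pCons c q" by (metis pCons_cases)
  have "c \<noteq> 0"
  proof
    assume "c = 0"
    with p(1) cq assms have q: "?P q" by auto
    from p(2)[OF this] q show False unfolding cq by simp
  qed
  obtain h where h: "pev q (ev g) = ev h" using pev_ev_in_range by blast
  have "emb c + ev g * ev h = 0" using p(1) by (simp add: cq h)
  then have c: "emb c = - (ev g * ev h)" by (simp add: eq_neg_iff_add_eq_0)
  have u0: "unit_factor c $ 0 \<noteq> 0" using \<open>c \<noteq> 0\<close> by simp
  have "c = unit_factor c * fps_X ^ subdegree c" by (rule fps_unit_factor_decompose)
  then have "inverse (unit_factor c) * c = fps_X ^ subdegree c"
    using inverse_mult_eq_1[OF u0] by (metis mult.assoc mult_1)
  then have "emb fps_X ^ subdegree c = emb (inverse (unit_factor c)) * emb c"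
    by (metis emb_simps(6,7))
  also have "\<dots> = ev g * ev (- (fps_const (inverse (unit_factor c)) * h))"
    unfolding c ev_uminus ev_mult ev_const by (simp add: mult.left_commute)
  finally show ?thesis using that by metis
qed

lemma codim_exists:
  assumes "ev g \<noteq> 0"
  shows "\<exists>m. codim g m"
proof -
  obtain N h where "ev g * ev h = emb fps_X ^ N" by (rule ev_dvd_x_power[OF assms])
  then have "principal W + principal (x ^ N) \<subseteq> principal W + principal g"
    by (intro ideal_subset[of _ _ h]) simp
  from has_codim_superspace[OF subspace_principal_plus this codim_x_power] show ?thesis by blast
qed

text \<open>
  A monic equation of degree \<open>d\<close> reduces all powers of \<open>u\<close> to the first \<open>d\<close> of them, which have a
  common denominator.
\<close>

lemma bounded_powers:
  assumes u: "integral u" and c: "u * emb fps_X ^ c = ev h"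
  shows "\<exists>C. \<forall>k. \<exists>s. ev s = u ^ k * emb fps_X ^ C"
proof -
  from u obtain p where p: "lead_coeff p = 1" "pev p u = 0" by (auto simp: integral_def)
  define d where "d = degree p"
  have "{..d} = insert d {..<d}" by auto
  then have "u ^ d + (\<Sum>i<d. emb (coeff p i) * u ^ i) = 0"
    using p by (simp add: pev_altdef d_def)
  then have ud: "u ^ d = - (\<Sum>i<d. emb (coeff p i) * u ^ i)" by (simp add: eq_neg_iff_add_eq_0)
  have "\<exists>s. ev s = u ^ k * emb fps_X ^ (c * d)" for k
  proof (induction k rule: less_induct)
    case (less k)
    show ?case
    proof (cases "k < d")
      case True
      then have "c * d = c * k + c * (d - k)" by (simp flip: distrib_left)
      then have "u ^ k * emb fps_X ^ (c * d) = (u * emb fps_X ^ c) ^ k * emb fps_X ^ (c * (d - k))"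
        by (simp add: power_add power_mult power_mult_distrib)
      also have "\<dots> = ev (h ^ k * x ^ (c * (d - k)))" by (simp add: c)
      finally show ?thesis by metis
    next
      case False
      have "\<forall>i. \<exists>s. i < d \<longrightarrow> ev s = u ^ (k - d + i) * emb fps_X ^ (c * d)"
        using less.IH False by auto
      then obtain s where s: "\<And>i. i < d \<Longrightarrow> ev (s i) = u ^ (k - d + i) * emb fps_X ^ (c * d)" by metis
      have evsum: "ev (sum f A) = (\<Sum>i\<in>A. ev (f i))" for f :: "nat \<Rightarrow> 'k ps2" and A
        by (induction A rule: infinite_finite_induct) simp_all
      have "u ^ k = u ^ (k - d) * u ^ d" using False by (simp flip: power_add)
      then have "u ^ k * emb fps_X ^ (c * d) =
          - (\<Sum>i<d. emb (coeff p i) * (u ^ (k - d + i) * emb fps_X ^ (c * d)))"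
        by (simp add: ud sum_distrib_left sum_distrib_right power_add mult_ac)
      also have "\<dots> = ev (0 - (\<Sum>i<d. fps_const (coeff p i) * s i))"
        unfolding ev_diff evsum by (simp add: s)
      finally show ?thesis by metis
    qed
  qed
  then show ?thesis by blast
qed

text \<open>
  In other words, the intersection number \<open>L\<close> of \<open>w\<close> and \<open>g\<close> is \<open>-n log_2 \<bar>g(a)\<bar>\<close>, where \<open>n\<close> is
  the degree of \<open>w\<close>.  Write \<open>g(a)^q = x^m u\<close> with a unit \<open>u\<close> of the integral closure.  If \<open>u\<close> were a unit
  of \<open>K[[x]][a]\<close>, then additivity would give \<open>q L = m n\<close> at once.  In general, \<open>u^k\<close> has for all positive
  and negative \<open>k\<close> a denominator that is bounded independently of \<open>k\<close>.  Hence the codimensions of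
  \<open>g(a)^(q k)\<close> and \<open>x^(m k)\<close> differ by a bounded amount, that is, \<open>k (q L - m n)\<close> is bounded in \<open>k\<close>.
\<close>

theorem codim_eq_nrm:
  assumes g: "ev g \<noteq> 0"
  obtains L where "codim g L" "nrm (ev g) = 2 powr (- (real L / real (degree w)))"
proof -
  from codim_exists[OF g] obtain L where L: "codim g L" by blast
  from val_rel_exists[OF g] obtain t where t: "val_rel (ev g) t" by blast
  then obtain p and q :: nat where q: "q > 0" and tpq: "t = real_of_int p / real q"
    and u': "vunit (ev g ^ q * emb fps_X powi (- p))" unfolding val_rel_def by blast
  have "t \<ge> 0" using integral_iff_val_rel[OF t] integral_ev by blast
  then have "p \<ge> 0" using q by (simp add: tpq zero_le_divide_iff)
  then obtain m where m: "p = int m" by (metis nonneg_int_cases)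
  define u where "u = ev g ^ q * inverse (emb fps_X ^ m)"
  have u: "vunit u" using u' by (simp add: u_def m power_int_minus)
  then have unz: "u \<noteq> 0" by (simp add: vunit_def)
  have gu: "ev g ^ q = emb fps_X ^ m * u" by (simp add: u_def)
  obtain N h where h: "ev g * ev h = emb fps_X ^ N" by (rule ev_dvd_x_power[OF g])
  \<comment> \<open>\<open>u\<close> has the denominator \<open>x^m\<close>; the denominator of \<open>1/u\<close> comes from a multiple of \<open>g(a)\<close> in \<open>K[[x]]\<close>\<close>
  have "\<exists>C. \<forall>k. \<exists>s. ev s = u ^ k * emb fps_X ^ C"
    by (rule bounded_powers[where c = m and h = "g ^ q"]) (use u in \<open>auto simp: vunit_def gu mult.commute\<close>)
  moreover have "\<exists>C. \<forall>k. \<exists>s. ev s = inverse u ^ k * emb fps_X ^ C"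
  proof (rule bounded_powers[where c = "N * q" and h = "x ^ m * h ^ q"])
    have "(ev g * ev h) ^ q = emb fps_X ^ (N * q)" by (simp add: h power_mult)
    then have "emb fps_X ^ (N * q) = u * (emb fps_X ^ m * ev h ^ q)"
      by (simp add: power_mult_distrib gu mult_ac)
    then show "inverse u * emb fps_X ^ (N * q) = ev (x ^ m * h ^ q)" using unz by simp
  qed (use u in \<open>simp add: vunit_def\<close>)
  ultimately obtain A B where A: "\<And>k. \<exists>s. ev s = u ^ k * emb fps_X ^ A"
    and B: "\<And>k. \<exists>s. ev s = inverse u ^ k * emb fps_X ^ B" by blast
  define n where "n = degree w"
  \<comment> \<open>\<open>c\<close> is the codimension of an element with value \<open>x^A u^k\<close>\<close>
  have key: "\<exists>c\<le>(A + B) * n. (q * k) * L + A * n = (m * k) * n + c" for k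
  proof -
    obtain s where s: "ev s = u ^ k * emb fps_X ^ A" using A by blast
    obtain s' where s': "ev s' = inverse u ^ k * emb fps_X ^ B" using B by blast
    have "u ^ k * inverse u ^ k = 1" using unz by (simp flip: power_mult_distrib)
    then have "ev s * ev s' = emb fps_X ^ (A + B)"
      unfolding s s' power_add by (metis (no_types, lifting) mult.assoc mult.left_commute mult_1)
    then have "principal W + principal (x ^ (A + B)) \<subseteq> principal W + principal s"
      by (intro ideal_subset[of _ _ s']) simp
    from has_codim_superspace[OF subspace_principal_plus this codim_x_power]
    obtain c where c: "c \<le> (A + B) * n" "codim s c" unfolding n_def by blast
    have "codim (g ^ (q * k) * x ^ A) ((q * k) * L + A * n)"
      unfolding n_def using g by (intro codim_mult codim_power codim_x_power L) auto
    moreover have "codim (x ^ (m * k) * s) ((m * k) * n + c)"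
      unfolding n_def by (intro codim_mult codim_x_power c(2)) simp
    moreover have "ev (g ^ (q * k) * x ^ A) = ev (x ^ (m * k) * s)"
    proof -
      have "ev (g ^ (q * k) * x ^ A) = (ev g ^ q) ^ k * emb fps_X ^ A" by (simp add: power_mult)
      also have "\<dots> = ev (x ^ (m * k) * s)"
        unfolding gu by (simp add: s power_mult_distrib power_mult mult.assoc)
      finally show ?thesis .
    qed
    ultimately have "(q * k) * L + A * n = (m * k) * n + c"
      using codim_cong has_codim_unique[OF subspace_principal_plus] by metis
    with c show ?thesis by blast
  qed
  have "q * L = m * n"
  proof (rule ccontr)
    assume ne: "q * L \<noteq> m * n"
    define k where "k = (A + B) * n + 1"
    from key[of k] obtain c where c: "c \<le> (A + B) * n" "(q * k) * L + A * n = (m * k) * n + c" by blast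
    have eq: "(q * L) * k + A * n = (m * n) * k + c" using c(2) by (simp add: mult_ac)
    show False
    proof (cases "q * L < m * n")
      case True
      then have "(q * L + 1) * k \<le> (m * n) * k" by (intro mult_right_mono) auto
      then have "(q * L) * k + k \<le> (m * n) * k" by (simp add: distrib_right)
      then have "k \<le> A * n" using eq by linarith
      then show False by (simp add: k_def distrib_right)
    next
      case False
      with ne have "(m * n + 1) * k \<le> (q * L) * k" by (intro mult_right_mono) auto
      then have "(m * n) * k + k \<le> (q * L) * k" by (simp add: distrib_right)
      then have "k \<le> c" using eq by linarith
      then show False using c(1) by (simp add: k_def)
    qed
  qed
  then have "real q * real L = real m * real n" by (metis of_nat_mult)
  then have "t = real L / real n"
    using q degree_pos by (simp add: tpq m n_def field_simps)
  with nrm_eq[OF t] L that show ?thesis by (simp add: n_def)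
qed

text \<open>
  The ideal \<open>(w)\<close> is contained in every \<open>(w, x^N)\<close>, whose codimension \<open>N n\<close> is unbounded.
\<close>

lemma no_finite_codim:
  assumes "W dvd g"
  shows "\<not> codim g b"
proof
  assume b: "codim g b"
  have "principal W + principal g \<subseteq> principal W + principal (x ^ Suc b)"
    using assms by (intro ideal_subset[of _ _ 0]) (simp add: ev_eq_0_iff)
  from has_codim_superspace[OF subspace_principal_plus this b]
  obtain m where m: "m \<le> b" "codim (x ^ Suc b) m" by blast
  from has_codim_unique[OF subspace_principal_plus m(2) codim_x_power] have "m = Suc b * degree w" .
  with m(1) degree_pos show False by (cases "degree w") auto
qed

end

section \<open>The strong triangle inequality for Weierstrass polynomials\<close>

text \<open>
  The Gauss norm of radius \<open>r\<close>.
\<close>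

definition gauss :: "real \<Rightarrow> 'k::field fls alg_closure poly \<Rightarrow> real" where
  "gauss r P = Max ((\<lambda>k. nrm (coeff P k) * r ^ k) ` {..degree P})"

lemma gauss_ge:
  assumes "r \<ge> 0"
  shows "nrm (coeff P k) * r ^ k \<le> gauss r P"
proof (cases "k \<le> degree P")
  case True
  then show ?thesis unfolding gauss_def by (intro Max_ge) auto
next
  case False
  have "0 \<le> nrm (coeff P 0) * r ^ 0" by simp
  also have "\<dots> \<le> gauss r P"
    unfolding gauss_def by (intro Max_ge image_eqI[of _ _ 0]) simp_all
  finally show ?thesis using False by (simp add: coeff_eq_0)
qed

lemma gauss_attained: "\<exists>k\<le>degree P. gauss r P = nrm (coeff P k) * r ^ k"
proof -
  have "gauss r P \<in> (\<lambda>k. nrm (coeff P k) * r ^ k) ` {..degree P}"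
    unfolding gauss_def by (intro Max_in) auto
  then show ?thesis by auto
qed

lemma gauss_le:
  assumes "\<And>k. nrm (coeff P k) * r ^ k \<le> B"
  shows "gauss r P \<le> B"
  using gauss_attained[of P r] assms by metis

text \<open>
  Some coefficient of the product attains the bound: if \<open>\<bar>z\<bar> > r\<close>, the one at any index where \<open>P\<close>
  attains its Gauss norm; if \<open>\<bar>z\<bar> \<le> r\<close>, the one right after the last such index.
\<close>

lemma gauss_linear:
  fixes z :: "'k::field fls alg_closure"
  assumes r: "r > 0"
  shows "gauss r ([:- z, 1:] * P) = max r (nrm z) * gauss r P"
proof (cases "P = 0")
  case True
  then show ?thesis by (simp add: gauss_def)
next
  case False
  define Q where "Q = [:- z, 1:] * P"
  have Q0: "coeff Q 0 = - (z * coeff P 0)" and QS: "coeff Q (Suc k) = coeff P k - z * coeff P (Suc k)" for k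
    by (simp_all add: Q_def)
  have lin: "nrm (z * coeff P k) * r ^ k \<le> nrm z * gauss r P" for k
    using mult_left_mono[OF gauss_ge[of r P k], of "nrm z"] r by (simp add: nrm_mult mult.assoc)
  have shift: "nrm (coeff P k) * r ^ Suc k \<le> r * gauss r P" for k
    using mult_left_mono[OF gauss_ge[of r P k], of r] r by (simp add: mult_ac)
  have G: "gauss r P > 0"
  proof -
    have "0 < nrm (lead_coeff P) * r ^ degree P" using False r by (simp add: mult_pos_pos)
    also have "\<dots> \<le> gauss r P" using r by (intro gauss_ge) simp
    finally show ?thesis .
  qed
  have "gauss r Q \<le> max r (nrm z) * gauss r P"
  proof (rule gauss_le)
    fix k
    show "nrm (coeff Q k) * r ^ k \<le> max r (nrm z) * gauss r P"
    proof (cases k)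
      case 0
      have "nrm (coeff Q 0) * r ^ 0 \<le> nrm z * gauss r P" using lin[of 0] by (simp add: Q0)
      also have "\<dots> \<le> max r (nrm z) * gauss r P" using G by (intro mult_right_mono) auto
      finally show ?thesis by (simp add: 0)
    next
      case (Suc j)
      have "nrm (coeff Q k) * r ^ k \<le> max (nrm (coeff P j)) (nrm (z * coeff P k)) * r ^ k"
        unfolding Suc QS using r by (intro mult_right_mono nrm_diff) simp
      also have "\<dots> = max (nrm (coeff P j) * r ^ Suc j) (nrm (z * coeff P k) * r ^ k)"
        using r by (simp add: Suc max_mult_distrib_right)
      also have "\<dots> \<le> max (r * gauss r P) (nrm z * gauss r P)"
        by (rule max.mono[OF shift lin])
      also have "\<dots> = max r (nrm z) * gauss r P" using G by (simp add: max_mult_distrib_right)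
      finally show ?thesis .
    qed
  qed
  moreover have "max r (nrm z) * gauss r P \<le> gauss r Q"
  proof (cases "r < nrm z")
    case True
    obtain k where k: "gauss r P = nrm (coeff P k) * r ^ k" using gauss_attained by blast
    have "nrm (coeff Q k) * r ^ k = nrm z * gauss r P"
    proof (cases k)
      case 0
      then show ?thesis by (simp add: Q0 nrm_mult k)
    next
      case (Suc j)
      have "nrm (coeff P j) * r ^ k \<le> r * gauss r P" using shift[of j] by (simp add: Suc)
      also have "\<dots> < nrm z * gauss r P" using True G by simp
      also have "\<dots> = nrm (z * coeff P k) * r ^ k" by (simp add: nrm_mult k)
      finally have "nrm (coeff P j) < nrm (- (z * coeff P k))" using r by simp
      from nrm_add_eq[OF this] have "nrm (coeff Q k) = nrm (z * coeff P k)"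
        by (simp add: Suc QS)
      then show ?thesis by (simp add: nrm_mult k)
    qed
    with True gauss_ge[of r Q k] r show ?thesis by simp
  next
    case False
    define K where "K = {k. k \<le> degree P \<and> gauss r P = nrm (coeff P k) * r ^ k}"
    have K: "finite K" "K \<noteq> {}" using gauss_attained[of P r] by (auto simp: K_def)
    define k where "k = Max K"
    have k: "gauss r P = nrm (coeff P k) * r ^ k"
      using Max_in[OF K] by (simp add: K_def k_def)
    have "nrm (coeff P (Suc k)) * r ^ Suc k < gauss r P"
    proof -
      have "Suc k \<notin> K" using Max_ge[OF K(1), of "Suc k"] by (auto simp: k_def)
      then have "nrm (coeff P (Suc k)) * r ^ Suc k \<noteq> gauss r P"
        using G by (cases "Suc k \<le> degree P") (auto simp: K_def coeff_eq_0)
      with gauss_ge[of r P "Suc k"] r show ?thesis by simp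
    qed
    then have "r * (nrm (coeff P (Suc k)) * r ^ Suc k) < r * gauss r P" using r by simp
    then have "nrm z * (nrm (coeff P (Suc k)) * r ^ Suc k) < r * gauss r P"
      using False r by (smt (verit) mult_right_mono nrm_nonneg zero_le_mult_iff zero_le_power)
    also have "r * gauss r P = nrm (coeff P k) * r ^ Suc k" by (simp add: k)
    finally have "nrm (z * coeff P (Suc k)) * r ^ Suc k < nrm (coeff P k) * r ^ Suc k"
      by (simp only: nrm_mult mult.assoc)
    then have "nrm (- (z * coeff P (Suc k))) < nrm (coeff P k)"
      using r by (simp only: nrm_uminus mult_less_cancel_right_pos zero_less_power)
    from nrm_add_eq[OF this] have "nrm (coeff Q (Suc k)) = nrm (coeff P k)"
      by (simp add: QS)
    then have "r * gauss r P = nrm (coeff Q (Suc k)) * r ^ Suc k" by (simp add: k)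
    also have "\<dots> \<le> gauss r Q" using r by (intro gauss_ge) simp
    finally show ?thesis using False by (simp add: max_def)
  qed
  ultimately show ?thesis by (simp add: Q_def)
qed

lemma gauss_prod_linear:
  assumes "r > 0"
  shows "gauss r (\<Prod>x\<in>#A. [:- x, 1:]) = (\<Prod>x\<in>#A. max r (nrm x))"
proof (induction A)
  case empty
  show ?case by (simp add: gauss_def)
next
  case (add x A)
  then show ?case by (simp only: image_mset_add_mset prod_mset.add_mset gauss_linear[OF assms])
qed

definition prox :: "real \<Rightarrow> 'k::field fls alg_closure \<Rightarrow> 'k fls alg_closure multiset \<Rightarrow> real" where
  "prox r z A = (\<Prod>x\<in>#A. max r (nrm (x - z)))"

definition root_mset :: "'k::field fps poly \<Rightarrow> 'k fls alg_closure multiset" where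
  "root_mset w = (SOME A. size A = degree w \<and> map_poly emb w = (\<Prod>x\<in>#A. [:- x, 1:]))"

lemma root_mset:
  assumes "lead_coeff w = 1"
  shows "size (root_mset w) = degree w" "map_poly emb w = (\<Prod>x\<in>#root_mset w. [:- x, 1:])"
proof -
  have l: "lead_coeff (map_poly emb w) = 1" using assms by (simp add: coeff_map_poly)
  then have "map_poly emb w \<noteq> 0" by auto
  from alg_closed_imp_factorization[OF this]
  have "\<exists>A. size A = degree w \<and> map_poly emb w = (\<Prod>x\<in>#A. [:- x, 1:])"
    by (simp only: l) simp
  from someI_ex[OF this]
  show "size (root_mset w) = degree w" "map_poly emb w = (\<Prod>x\<in>#root_mset w. [:- x, 1:])"
    unfolding root_mset_def by blast+
qed

lemma pev_root_mset:
  assumes "lead_coeff w = 1"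
  shows "pev w z = (\<Prod>x\<in>#root_mset w. z - x)"
  unfolding pev_def root_mset(2)[OF assms] by (simp add: poly_prod_mset image_mset.compositionality o_def)

lemma mem_root_mset: "lead_coeff w = 1 \<Longrightarrow> x \<in># root_mset w \<longleftrightarrow> pev w x = 0"
  by (auto simp: pev_root_mset)

lemma nrm_prod_mset: "nrm (prod_mset A) = (\<Prod>x\<in>#A. nrm x)"
  by (induction A) (simp_all add: nrm_mult)

lemma prox_0:
  assumes "lead_coeff w = 1"
  shows "prox 0 z (root_mset w) = nrm (pev w z)"
  by (simp add: prox_def pev_root_mset[OF assms] nrm_prod_mset image_mset.compositionality o_def
      nrm_minus_commute)

lemma pcompose_prod_linear:
  "pcompose (\<Prod>x\<in>#A. [:- x, 1:]) [:z, 1:] = (\<Prod>x\<in>#A. [:- (x - z), 1 :: 'a :: comm_ring_1:])"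
proof (induction A)
  case (add x A)
  have "pcompose [:- x, 1:] [:z, 1:] = [:- (x - z), 1:]" by (simp add: pcompose_pCons)
  with add show ?case by (simp only: image_mset_add_mset prod_mset.add_mset pcompose_mult)
qed (simp add: pcompose_1)

text \<open>
  The Taylor coefficients of \<open>w\<close> at \<open>z\<close> are polynomials in \<open>z\<close> over \<open>K[[x]]\<close>.  This makes their
  absolute values invariant under conjugation.
\<close>

lemma taylor_coeff_poly:
  fixes w :: "'k::field fps poly"
  shows "\<exists>p. \<forall>z. coeff (pcompose (map_poly emb w) [:z, 1:]) k = pev p z"
proof (induction w arbitrary: k)
  case 0
  show ?case by (rule exI[of _ 0]) simp
next
  case (pCons c w)
  from pCons.IH obtain p where p: "\<And>k z. coeff (pcompose (map_poly emb w) [:z, 1:]) k = pev (p k) z"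
    by metis
  have eq: "pcompose (map_poly emb (pCons c w)) [:z, 1:] =
      [:emb c:] + (smult z (pcompose (map_poly emb w) [:z, 1:]) + pCons 0 (pcompose (map_poly emb w) [:z, 1:]))" for z
    by (simp add: map_poly_pCons pcompose_pCons)
  show ?case
  proof (cases k)
    case 0
    show ?thesis
      by (rule exI[of _ "[:c:] + [:0, 1:] * p 0"]) (simp add: eq 0 p del: coeff_pcompose_0)
  next
    case (Suc j)
    show ?thesis
      by (rule exI[of _ "[:0, 1:] * p k + p j"]) (simp add: eq Suc p)
  qed
qed

text \<open>
  For \<open>r > 0\<close> the product is the Gauss norm of \<open>w(z + Y)\<close>, by multiplicativity of the Gauss norm.
  It depends only on the absolute values of the Taylor coefficients of \<open>w\<close> at \<open>z\<close>.
\<close>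

lemma prox_conjugate:
  assumes w: "lead_coeff w = 1" and conj: "\<And>p. pev p a = 0 \<longleftrightarrow> pev p b = 0" and r: "r \<ge> 0"
  shows "prox r a (root_mset w) = prox r b (root_mset w)"
proof (cases "r = 0")
  case True
  with conjugate_nrm[OF conj] show ?thesis by (simp add: prox_0[OF w])
next
  case False
  with r have r: "r > 0" by simp
  have px: "prox r z (root_mset w) = gauss r (pcompose (map_poly emb w) [:z, 1:])" for z
    using gauss_prod_linear[OF r, of "image_mset (\<lambda>x. x - z) (root_mset w)"]
    unfolding root_mset(2)[OF w] pcompose_prod_linear prox_def
    by (simp add: image_mset.compositionality o_def)
  have "nrm (coeff (pcompose (map_poly emb w) [:a, 1:]) k) = nrm (coeff (pcompose (map_poly emb w) [:b, 1:]) k)" for k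
    using taylor_coeff_poly[of w k] conjugate_nrm[OF conj] by metis
  then show ?thesis by (simp add: px gauss_def degree_pcompose)
qed

lemma prox_nonneg: "r \<ge> 0 \<Longrightarrow> prox r z A \<ge> 0"
  unfolding prox_def by (induction A) auto

lemma prox_mono:
  assumes "0 \<le> r" "r \<le> s"
  shows "prox r z A \<le> prox s z A"
proof (induction A)
  case (add x A)
  have "max r (nrm (x - z)) * prox r z A \<le> max s (nrm (x - z)) * prox s z A"
    using add assms by (intro mult_mono prox_nonneg) auto
  then show ?case by (simp add: prox_def)
qed (simp add: prox_def)

lemma prox_cong:
  assumes "\<And>x. x \<in># A \<Longrightarrow> max r (nrm (x - y)) = max s (nrm (x - z))"
  shows "prox r y A = prox s z A"
  unfolding prox_def by (intro arg_cong[of _ _ prod_mset] image_mset_cong assms)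

lemma prox_near:
  fixes y z :: "'k::field fls alg_closure"
  assumes "nrm (y - z) \<le> r"
  shows "prox r y A = prox r z A"
proof (rule prox_cong)
  fix x
  have "nrm (x - y) \<le> max (nrm (x - z)) (nrm (y - z))" for y z :: "'k fls alg_closure"
    using nrm_add[of "x - z" "z - y"] by (simp add: nrm_minus_commute)
  from this[of y z] this[of z y] assms show "max r (nrm (x - y)) = max r (nrm (x - z))"
    by (auto simp: max_def nrm_minus_commute split: if_splits)
qed

text \<open>
  Both sides are the product over all pairs.
\<close>

lemma prox_power_symmetric:
  assumes "\<And>a a'. a \<in># A \<Longrightarrow> a' \<in># A \<Longrightarrow> prox r a B = prox r a' B"
    and "\<And>b b'. b \<in># B \<Longrightarrow> b' \<in># B \<Longrightarrow> prox r b A = prox r b' A"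
    and "a \<in># A" "b \<in># B"
  shows "prox r a B ^ size A = prox r b A ^ size B"
proof -
  have 1: "(\<Prod>x\<in>#A. prox r x B) = prox r a B ^ size A"
  proof -
    have "image_mset (\<lambda>x. prox r x B) A = image_mset (\<lambda>x. prox r a B) A"
      using assms(1,3) by (intro image_mset_cong)
    then show ?thesis by (simp add: image_mset_const_eq)
  qed
  have 2: "(\<Prod>x\<in>#B. prox r x A) = prox r b A ^ size B"
  proof -
    have "image_mset (\<lambda>x. prox r x A) B = image_mset (\<lambda>x. prox r b A) B"
      using assms(2,4) by (intro image_mset_cong)
    then show ?thesis by (simp add: image_mset_const_eq)
  qed
  have "(\<Prod>x\<in>#A. prox r x B) = (\<Prod>y\<in>#B. prox r y A)"
    unfolding prox_def by (subst prod_mset.swap) (simp add: nrm_minus_commute)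
  with 1 2 show ?thesis by simp
qed

lemma prox_symmetric:
  assumes "\<And>a a'. a \<in># A \<Longrightarrow> a' \<in># A \<Longrightarrow> prox r a B = prox r a' B"
    and "\<And>b b'. b \<in># B \<Longrightarrow> b' \<in># B \<Longrightarrow> prox r b A = prox r b' A"
    and ab: "a \<in># A" "b \<in># B" and r: "r \<ge> 0"
  shows "prox r a B powr (1 / size B) = prox r b A powr (1 / size A)"
proof -
  have pos: "size A > 0" "size B > 0" using ab by (auto simp: nonempty_has_size[symmetric])
  have nn: "prox r a B \<ge> 0" "prox r b A \<ge> 0" using r by (simp_all add: prox_nonneg)
  have root: "y powr (1 / real m) = (y ^ n) powr (1 / real (m * n))" if "y \<ge> 0" "m > 0" "n > 0" for y m n
  proof (cases "y = 0")
    case False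
    with that have "y ^ n = y powr real n" by (simp add: powr_realpow)
    with that show ?thesis by (simp add: powr_powr)
  qed (use that in simp)
  have "prox r a B powr (1 / size B) = (prox r a B ^ size A) powr (1 / real (size B * size A))"
    by (rule root[OF nn(1) pos(2,1)])
  also have "prox r a B ^ size A = prox r b A ^ size B"
    by (rule prox_power_symmetric[OF assms(1-4)])
  also have "\<dots> powr (1 / real (size B * size A)) = prox r b A powr (1 / size A)"
    using root[OF nn(2) pos] by (simp add: mult.commute)
  finally show ?thesis .
qed

lemma nearest_pair:
  assumes "A \<noteq> {#}" "B \<noteq> {#}"
  obtains a b where "a \<in># A" "b \<in># B" "\<And>x y. x \<in># A \<Longrightarrow> y \<in># B \<Longrightarrow> nrm (a - b) \<le> nrm (x - y)"
proof -
  let ?S = "(\<lambda>(x, y). nrm (x - y)) ` (set_mset A \<times> set_mset B)"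
  have fin: "finite ?S" "?S \<noteq> {}" using assms by auto
  from Min_in[OF fin] obtain a b where ab: "a \<in># A" "b \<in># B" "Min ?S = nrm (a - b)" by auto
  have "nrm (a - b) \<le> nrm (x - y)" if "x \<in># A" "y \<in># B" for x y
    unfolding ab(3)[symmetric] using that fin by (intro Min_le) auto
  with ab that show ?thesis by blast
qed

text \<open>
  Let \<open>r\<close> be the larger one of the distance between \<open>A\<close> and \<open>B\<close> and the distance between \<open>B\<close> and \<open>C\<close>.
  At radius \<open>r\<close>, the set \<open>A\<close> may be replaced by \<open>B\<close> and then \<open>C\<close> by \<open>B\<close>, because elements at distance at
  most \<open>r\<close> have the same products.  So the left-hand side is at most the mean from \<open>B\<close> to itself at
  radius \<open>r\<close>.  If \<open>r\<close> is the distance between \<open>A\<close> and \<open>B\<close>, this is the mean from \<open>A\<close> to \<open>B\<close> at radius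
  \<open>r\<close>, where the cut-off has no effect; the other case is analogous.
\<close>

theorem prox_strong_triangle:
  assumes const: "\<And>r P Q p p'. r \<ge> 0 \<Longrightarrow> P \<in> {A, B, C} \<Longrightarrow> Q \<in> {A, B, C} \<Longrightarrow>
      p \<in># P \<Longrightarrow> p' \<in># P \<Longrightarrow> prox r p Q = prox r p' Q"
    and a: "a \<in># A" and b: "b \<in># B" and c: "c \<in># C"
  shows "prox 0 a C powr (1 / size C) \<le> max (prox 0 a B powr (1 / size B)) (prox 0 b C powr (1 / size C))"
proof -
  have ne: "A \<noteq> {#}" "B \<noteq> {#}" "C \<noteq> {#}" using a b c by auto
  obtain a1 b1 where 1: "a1 \<in># A" "b1 \<in># B"
    "\<And>x y. x \<in># A \<Longrightarrow> y \<in># B \<Longrightarrow> nrm (a1 - b1) \<le> nrm (x - y)"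
    using nearest_pair[OF ne(1,2)] by blast
  obtain b2 c2 where 2: "b2 \<in># B" "c2 \<in># C"
    "\<And>x y. x \<in># B \<Longrightarrow> y \<in># C \<Longrightarrow> nrm (b2 - c2) \<le> nrm (x - y)"
    using nearest_pair[OF ne(2,3)] by blast
  define r where "r = max (nrm (a1 - b1)) (nrm (b2 - c2))"
  have r0: "r \<ge> 0" by (simp add: r_def le_max_iff_disj)
  have sym: "prox s b' C powr (1 / size C) = prox s c' B powr (1 / size B)"
    if "s \<ge> 0" "b' \<in># B" "c' \<in># C" for s b' c'
    using that by (intro prox_symmetric) (auto intro: const)
  have nearab: "prox r a1 Q = prox r b1 Q" for Q by (rule prox_near) (simp add: r_def)
  have nearbc: "prox r b2 Q = prox r c2 Q" for Q by (rule prox_near) (simp add: r_def)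
  have "prox 0 a C \<le> prox r a C" by (rule prox_mono) (simp_all add: r0)
  also have "prox r a C = prox r a1 C" using a 1 r0 by (intro const) auto
  also have "\<dots> = prox r b1 C" by (rule nearab)
  finally have "prox 0 a C powr (1 / size C) \<le> prox r b1 C powr (1 / size C)"
    by (intro powr_mono2) (auto simp: prox_nonneg)
  also have "\<dots> = prox r c2 B powr (1 / size B)" by (rule sym[OF r0 1(2) 2(2)])
  finally have main: "prox 0 a C powr (1 / size C) \<le> prox r c2 B powr (1 / size B)" .
  show ?thesis
  proof (cases "nrm (b2 - c2) \<le> nrm (a1 - b1)")
    case True
    then have r: "r = nrm (a1 - b1)" by (simp add: r_def)
    have "prox r c2 B = prox r b2 B" by (rule nearbc[symmetric])
    also have "\<dots> = prox r b1 B" using 1 2 r0 by (intro const) auto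
    also have "\<dots> = prox r a1 B" by (rule nearab[symmetric])
    also have "\<dots> = prox r a B" using a 1 r0 by (intro const) auto
    also have "\<dots> = prox 0 a B"
    proof (rule prox_cong)
      fix x assume "x \<in># B"
      with 1(3)[OF a this] show "max r (nrm (x - a)) = max 0 (nrm (x - a))"
        by (simp add: r nrm_minus_commute)
    qed
    finally show ?thesis using main by simp
  next
    case False
    then have r: "r = nrm (b2 - c2)" by (simp add: r_def)
    have "prox r c2 B = prox 0 c2 B"
    proof (rule prox_cong)
      fix x assume "x \<in># B"
      with 2(3)[OF this 2(2)] show "max r (nrm (x - c2)) = max 0 (nrm (x - c2))"
        by (simp add: r nrm_minus_commute)
    qed
    with main sym[of 0 b c2] b 2(2) show ?thesis by simp
  qed
qed

lemma branch_root_conjugate: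
  assumes "branch_root w a" "branch_root w b"
  shows "pev p a = 0 \<longleftrightarrow> pev p b = 0"
  using branch_root.pev_eq_0_iff[OF assms(1)] branch_root.pev_eq_0_iff[OF assms(2)] by simp

lemma branch_root_change:
  assumes "branch_root w a" "pev w b = 0"
  shows "branch_root w b"
  using assms by (simp add: branch_root_def)

text \<open>
  The geometric mean of the distances from \<open>z\<close> to the roots of a monic polynomial \<open>w\<close>.
\<close>

definition sep :: "'k::field fps poly \<Rightarrow> 'k fls alg_closure \<Rightarrow> real" where
  "sep w z = nrm (pev w z) powr (1 / degree w)"

theorem sep_strong_triangle:
  assumes a: "branch_root u a" and b: "branch_root v b" and c: "branch_root w c"
  shows "sep w a \<le> max (sep v a) (sep w b)"
proof -
  have m: "lead_coeff u = 1" "lead_coeff v = 1" "lead_coeff w = 1"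
    using assms branch_root.monic by blast+
  have const: "prox r p Q = prox r p' Q"
    if prems: "r \<ge> 0" "P \<in> {root_mset u, root_mset v, root_mset w}" "Q \<in> {root_mset u, root_mset v, root_mset w}"
      "p \<in># P" "p' \<in># P" for r P Q p p'
  proof -
    obtain f e where f: "f \<in> {u, v, w}" "P = root_mset f" "branch_root f e" using prems(2) a b c by blast
    obtain g where g: "g \<in> {u, v, w}" "Q = root_mset g" using prems(3) by blast
    have "lead_coeff f = 1" "lead_coeff g = 1" using f g m by auto
    then have "branch_root f p" "branch_root f p'"
      using prems(4,5) f by (auto simp: mem_root_mset intro: branch_root_change)
    from prox_conjugate[OF \<open>lead_coeff g = 1\<close> branch_root_conjugate[OF this] prems(1)]
    show ?thesis by (simp add: g)
  qed
  have mem: "a \<in># root_mset u" "b \<in># root_mset v" "c \<in># root_mset w"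
    using assms m by (simp_all add: mem_root_mset branch_root.root)
  from prox_strong_triangle[OF const mem]
  show ?thesis by (simp add: sep_def prox_0 root_mset m)
qed

definition contact_of_sep :: "real \<Rightarrow> ereal" where
  "contact_of_sep s = (if s = 0 then \<infinity> else ereal (- log 2 s))"

lemma contact_of_sep_antimono:
  assumes "0 \<le> s" "s \<le> t"
  shows "contact_of_sep t \<le> contact_of_sep s"
  using assms by (auto simp: contact_of_sep_def)

lemma contact_of_sep_max:
  assumes "0 \<le> s" "s \<le> max t t'" 
  shows "min (contact_of_sep t) (contact_of_sep t') \<le> contact_of_sep s"
proof (cases "t \<le> t'")
  case True
  with assms contact_of_sep_antimono[of s t'] show ?thesis by (simp add: max_def min.coboundedI2)
next
  case False
  with assms contact_of_sep_antimono[of s t] show ?thesis by (simp add: max_def min.coboundedI1)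
qed

text \<open>
  If \<open>a\<close> is a root of \<open>w\<close>, then \<open>u\<close> divides \<open>w\<close>, and both sides are infinite.
\<close>

theorem quotient_dim_eq_contact_of_sep:
  assumes a: "branch_root u a" and m: "lead_coeff w = 1" "degree w > 0"
  shows "ereal_of_enat (quotient_dim (principal (fps_of_poly u) + principal (fps_of_poly w))) /
      ereal (real (degree u) * real (degree w)) = contact_of_sep (sep w a)"
proof -
  interpret branch_root u a by fact
  have pos: "real (degree u) * real (degree w) > 0" using degree_pos m by simp
  show ?thesis
  proof (cases "pev w a = 0")
    case True
    then have "u dvd w" by (simp only: pev_eq_0_iff)
    then have "fps_of_poly u dvd fps_of_poly w" by (auto simp: fps_of_poly_mult)
    then have "quotient_dim (principal (fps_of_poly u) + principal (fps_of_poly w)) = \<infinity>"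
      using no_finite_codim by (intro quotient_dim_infinite) blast
    then show ?thesis using True pos m by (simp add: sep_def contact_of_sep_def)
  next
    case False
    then have "ev (fps_of_poly w) \<noteq> 0" by simp
    from codim_eq_nrm[OF this] obtain L where L: "codim (fps_of_poly w) L"
      "nrm (pev w a) = 2 powr (- (real L / real (degree u)))" by auto
    have "sep w a = 2 powr (- (real L / (real (degree u) * real (degree w))))"
      unfolding sep_def L(2) by (simp add: powr_powr)
    then have "contact_of_sep (sep w a) = ereal (real L / (real (degree u) * real (degree w)))"
      by (simp add: contact_of_sep_def)
    moreover have "quotient_dim (principal (fps_of_poly u) + principal (fps_of_poly w)) = enat L"
      by (rule quotient_dim_eq[OF subspace_principal_plus L(1)])
    ultimately show ?thesis using degree_pos m by simp
  qed
qed

section \<open>General linear coordinates\<close>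

text \<open>
  The expansion of \<open>f(x + c y)\<close> in powers of \<open>y\<close>.  Binomial coefficients take the place of divided
  derivatives, so that the characteristic may be positive.
\<close>

definition taylor :: "'k::comm_ring_1 \<Rightarrow> 'k fps \<Rightarrow> 'k ps2" where
  "taylor c f = Abs_fps (\<lambda>l. Abs_fps (\<lambda>i. of_nat ((i + l) choose l) * c ^ l * f $ (i + l)))"

lemma taylor_nth [simp]: "taylor c f $ l $ i = of_nat ((i + l) choose l) * c ^ l * f $ (i + l)"
  by (simp add: taylor_def)

lemma taylor_add: "taylor c (f + g) = taylor c f + taylor c g"
  by (intro fps_ext) (simp add: distrib_left)

lemma taylor_0 [simp]: "taylor c 0 = 0"
  by (intro fps_ext) simp

lemma taylor_sum: "taylor c (sum f A) = (\<Sum>x\<in>A. taylor c (f x))"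
  by (induction A rule: infinite_finite_induct) (simp_all add: taylor_add)

text \<open>
  Vandermonde's identity.
\<close>

lemma taylor_mult: "taylor c (f * g) = taylor c f * taylor c g"
proof (rule fps_ext, rule fps_ext)
  fix l i
  define h where "h = (\<lambda>a l1. of_nat (a choose l1) * of_nat ((i + l - a) choose (l - l1)) * c ^ l * (f $ a * g $ (i + l - a)))"
  have "taylor c (f * g) $ l $ i = (\<Sum>a\<le>i + l. of_nat ((i + l) choose l) * c ^ l * (f $ a * g $ (i + l - a)))"
    by (simp add: fps_mult_nth sum_distrib_left atLeast0AtMost)
  also have "\<dots> = (\<Sum>a\<le>i + l. \<Sum>l1\<le>l. h a l1)"
  proof (rule sum.cong[OF refl])
    fix a assume "a \<in> {..i + l}"
    then have "(i + l) choose l = (\<Sum>l1\<le>l. (a choose l1) * ((i + l - a) choose (l - l1)))"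
      by (simp add: vandermonde)
    then show "of_nat ((i + l) choose l) * c ^ l * (f $ a * g $ (i + l - a)) = (\<Sum>l1\<le>l. h a l1)"
      by (simp add: h_def sum_distrib_right)
  qed
  also have "\<dots> = (\<Sum>l1\<le>l. \<Sum>a\<le>i + l. h a l1)" by (rule sum.swap)
  also have "\<dots> = (\<Sum>l1\<le>l. \<Sum>i1\<le>i. h (i1 + l1) l1)"
  proof (rule sum.cong[OF refl])
    fix l1 assume l1: "l1 \<in> {..l}"
    have "(\<Sum>a\<le>i + l. h a l1) = (\<Sum>a\<in>{l1..i + l1}. h a l1)"
    proof (rule sum.mono_neutral_right)
      show "\<forall>a\<in>{..i + l} - {l1..i + l1}. h a l1 = 0"
      proof
        fix a assume "a \<in> {..i + l} - {l1..i + l1}"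
        then have "a < l1 \<or> i + l - a < l - l1" using l1 by auto
        then have "a choose l1 = 0 \<or> (i + l - a) choose (l - l1) = 0" by auto
        then show "h a l1 = 0"
          unfolding h_def by (elim disjE) (simp_all only: of_nat_0 mult_zero_left mult_zero_right)
      qed
    qed (use l1 in auto)
    also have "\<dots> = (\<Sum>i1\<le>i. h (i1 + l1) l1)"
      by (rule sum.reindex_bij_witness[of _ "\<lambda>i1. i1 + l1" "\<lambda>a. a - l1"]) auto
    finally show "(\<Sum>a\<le>i + l. h a l1) = (\<Sum>i1\<le>i. h (i1 + l1) l1)" .
  qed
  also have "\<dots> = (\<Sum>l1\<le>l. \<Sum>i1\<le>i. (taylor c f $ l1 $ i1) * (taylor c g $ (l - l1) $ (i - i1)))"
  proof (intro sum.cong refl)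
    fix l1 i1 assume "l1 \<in> {..l}" "i1 \<in> {..i}"
    then have "i + l - (i1 + l1) = (i - i1) + (l - l1)" and "c ^ l = c ^ l1 * c ^ (l - l1)"
      by (auto simp flip: power_add)
    then show "h (i1 + l1) l1 = (taylor c f $ l1 $ i1) * (taylor c g $ (l - l1) $ (i - i1))"
      by (simp add: h_def mult_ac)
  qed
  also have "\<dots> = (taylor c f * taylor c g) $ l $ i"
    by (simp add: fps_mult_nth fps_sum_nth atLeast0AtMost)
  finally show "taylor c (f * g) $ l $ i = (taylor c f * taylor c g) $ l $ i" .
qed

text \<open>
  The substitution \<open>x \<mapsto> x + c y\<close>.
\<close>

definition shear :: "'k::comm_ring_1 \<Rightarrow> 'k ps2 \<Rightarrow> 'k ps2" where
  "shear c f = Abs_fps (\<lambda>j. \<Sum>l\<le>j. taylor c (f $ (j - l)) $ l)"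

lemma shear_nth: "shear c f $ j = (\<Sum>l\<le>j. taylor c (f $ (j - l)) $ l)"
  by (simp add: shear_def)

lemma shear_nth_nth: "shear c f $ j $ i = (\<Sum>l\<le>j. of_nat ((i + l) choose l) * c ^ l * f $ (j - l) $ (i + l))"
  by (simp add: shear_nth fps_sum_nth)

lemma shear_add [simp]: "shear c (f + g) = shear c f + shear c g"
  by (rule fps_ext) (simp add: shear_nth taylor_add sum.distrib)

lemma shear_0 [simp]: "shear c 0 = 0"
  by (rule fps_ext) (simp add: shear_nth)

lemma shear_diff [simp]: "shear c (f - g) = shear c f - shear c g"
  using shear_add[of c "f - g" g] by (simp add: algebra_simps del: shear_add)

lemma shear_sum: "shear c (sum f A) = (\<Sum>x\<in>A. shear c (f x))"
  by (induction A rule: infinite_finite_induct) simp_all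

lemma shear_scale: "shear c (ps2_const d * f) = ps2_const d * shear c f"
  by (intro fps_ext) (simp add: shear_nth_nth ps2_const_def sum_distrib_left mult_ac)

lemma shear_mult [simp]: "shear c (f * g) = shear c f * shear c g"
proof (rule fps_ext)
  fix j :: nat
  let ?L = "SIGMA l:{..j}. {..j - l} \<times> {..l}"
  let ?R = "SIGMA m:{..j}. {..m} \<times> {..j - m}"
  have "shear c (f * g) $ j =
      (\<Sum>l\<le>j. \<Sum>a\<le>j - l. \<Sum>s\<le>l. taylor c (f $ a) $ s * taylor c (g $ (j - l - a)) $ (l - s))"
    by (simp add: shear_nth fps_mult_nth taylor_sum taylor_mult fps_sum_nth atLeast0AtMost)
  also have "\<dots> = (\<Sum>(l, a, s)\<in>?L. taylor c (f $ a) $ s * taylor c (g $ (j - l - a)) $ (l - s))"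
    by (simp add: sum.Sigma sum.cartesian_product split_def)
  also have "\<dots> = (\<Sum>(m, s, t)\<in>?R. taylor c (f $ (m - s)) $ s * taylor c (g $ (j - m - t)) $ t)"
    by (rule sum.reindex_bij_witness[of _ "\<lambda>(m, s, t). (s + t, m - s, s)" "\<lambda>(l, a, s). (a + s, s, l - s)"])
      (auto simp: algebra_simps)
  also have "\<dots> = (\<Sum>m\<le>j. \<Sum>s\<le>m. \<Sum>t\<le>j - m. taylor c (f $ (m - s)) $ s * taylor c (g $ (j - m - t)) $ t)"
    by (simp add: sum.Sigma sum.cartesian_product split_def)
  also have "\<dots> = (shear c f * shear c g) $ j"
    by (simp add: shear_nth fps_mult_nth sum_product atLeast0AtMost)
  finally show "shear c (f * g) $ j = (shear c f * shear c g) $ j" .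
qed

text \<open>
  The coefficients with fixed total shift \<open>N = l + k\<close> combine to a multiple of \<open>(-c + c)^N\<close>.
\<close>

lemma shear_inverse [simp]: "shear (- c) (shear c f) = f"
proof (rule fps_ext, rule fps_ext)
  fix j i
  define h where "h = (\<lambda>N. of_nat ((i + N) choose N) * f $ (j - N) $ (i + N))"
  have shuffle: "s * v * (t * p * q) = y * p * (z * q * v)" if "y * z = s * t" for p q s t v y z :: 'a
  proof -
    have "s * v * (t * p * q) = (s * t) * (p * q * v)" by (simp only: mult_ac)
    also have "\<dots> = (y * z) * (p * q * v)" by (simp only: that)
    also have "\<dots> = y * p * (z * q * v)" by (simp only: mult_ac)
    finally show ?thesis .
  qed
  have "shear (- c) (shear c f) $ j $ i =
      (\<Sum>l\<le>j. \<Sum>k\<le>j - l. of_nat ((i + l) choose l) * (- c) ^ l *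
        (of_nat ((i + l + k) choose k) * c ^ k * f $ (j - l - k) $ (i + l + k)))"
    by (simp add: shear_nth_nth sum_distrib_left)
  also have "\<dots> = (\<Sum>(l, k)\<in>(SIGMA l:{..j}. {..j - l}). of_nat ((i + l) choose l) * (- c) ^ l *
        (of_nat ((i + l + k) choose k) * c ^ k * f $ (j - l - k) $ (i + l + k)))"
    by (simp add: sum.Sigma)
  also have "\<dots> = (\<Sum>(N, l)\<in>(SIGMA N:{..j}. {..N}). h N * (of_nat (N choose l) * (- c) ^ l * c ^ (N - l)))"
  proof (rule sum.reindex_bij_witness[of _ "\<lambda>(N, l). (l, N - l)" "\<lambda>(l, k). (l + k, l)"], goal_cases)
    case (5 z)
    obtain l k where z: "z = (l, k)" by (cases z)
    have "((i + (l + k)) choose (i + l)) * ((i + l) choose i) = ((i + (l + k)) choose i) * ((l + k) choose l)"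
      using choose_mult[of i "i + l" "i + (l + k)"] by simp
    moreover have "(i + (l + k)) choose (i + l) = (i + l + k) choose k"
      using binomial_symmetric[of "i + l" "i + (l + k)"] by (simp add: add.assoc)
    moreover have "(i + l) choose i = (i + l) choose l"
      using binomial_symmetric[of i "i + l"] by simp
    moreover have "(i + (l + k)) choose i = (i + (l + k)) choose (l + k)"
      using binomial_symmetric[of i "i + (l + k)"] by simp
    ultimately have "((i + l) choose l) * ((i + l + k) choose k) = ((i + (l + k)) choose (l + k)) * ((l + k) choose l)"
      by (simp add: mult.commute)
    from arg_cong[OF this, of "of_nat :: nat \<Rightarrow> 'a"]
    have "of_nat ((i + l) choose l) * of_nat ((i + (l + k)) choose k) =
        (of_nat ((i + (l + k)) choose (l + k)) * of_nat ((l + k) choose l) :: 'a)"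
      unfolding of_nat_mult add.assoc .
    then have "h (l + k) * (of_nat ((l + k) choose l) * (- c) ^ l * c ^ k) =
           of_nat ((i + l) choose l) * (- c) ^ l *
           (of_nat ((i + l + k) choose k) * c ^ k * f $ (j - l - k) $ (i + l + k))"
      unfolding h_def diff_diff_left add.assoc by (rule shuffle)
    then show ?case by (simp add: z)
  qed auto
  also have "\<dots> = (\<Sum>N\<le>j. h N * (- c + c) ^ N)"
    by (simp add: sum.Sigma[symmetric] sum_distrib_left[symmetric] binomial_ring[of "- c" c, symmetric])
  also have "\<dots> = (\<Sum>N\<in>{0}. h N * (- c + c) ^ N)"
    by (rule sum.mono_neutral_right) (auto simp: zero_power)
  also have "\<dots> = f $ j $ i" by (simp add: h_def)
  finally show "shear (- c) (shear c f) $ j $ i = f $ j $ i" .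
qed

lemma shear_inverse' [simp]: "shear c (shear (- c) f) = f"
  using shear_inverse[of "- c" f] by simp

lemma inj_shear: "inj (shear c)"
  by (rule inj_on_inverseI[of _ "shear (- c)"]) simp

lemma shear_image_principal_plus:
  "shear c ` (principal f + principal g) = principal (shear c f) + principal (shear c g)"
proof (intro equalityI subsetI)
  fix z assume "z \<in> shear c ` (principal f + principal g)"
  then obtain p q where "z = shear c (f * p + g * q)" by (auto simp: mem_principal_plus)
  then have "z = shear c f * shear c p + shear c g * shear c q" by simp
  then show "z \<in> principal (shear c f) + principal (shear c g)"
    unfolding mem_principal_plus by blast
next
  fix z assume "z \<in> principal (shear c f) + principal (shear c g)"
  then obtain p q where "z = shear c f * p + shear c g * q" by (auto simp: mem_principal_plus)
  then have "z = shear c (f * shear (- c) p + g * shear (- c) q)" by simp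
  then show "z \<in> shear c ` (principal f + principal g)"
    by (intro image_eqI[of _ _ "f * shear (- c) p + g * shear (- c) q"]) (auto simp: mem_principal_plus)
qed

lemma has_codim_shear:
  fixes I :: "'k::field ps2 set"
  assumes "has_codim I n"
  shows "has_codim (shear c ` I) n"
proof -
  from assms obtain B where B: "quotient_basis I B" "card B = n" by (auto simp: has_codim_def)
  have sum: "(\<Sum>b\<in>shear c ` B. ps2_const (d b) * b) = shear c (\<Sum>b\<in>B. ps2_const (d (shear c b)) * b)" for d
    by (subst sum.reindex) (auto simp: inj_on_subset[OF inj_shear] shear_sum shear_scale simp del: shear_mult)
  have "quotient_basis (shear c ` I) (shear c ` B)"
    unfolding quotient_basis_def
  proof (intro conjI allI impI)
    show "finite (shear c ` B)" using B by (simp add: quotient_basis_def)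
  next
    fix d assume "(\<Sum>b\<in>shear c ` B. ps2_const (d b) * b) \<in> shear c ` I"
    then have "(\<Sum>b\<in>B. ps2_const (d (shear c b)) * b) \<in> I"
      unfolding sum by (simp add: inj_image_mem_iff[OF inj_shear])
    with B(1) have "\<forall>b\<in>B. d (shear c b) = 0"
      unfolding quotient_basis_def by (elim conjE) (erule allE[of _ "\<lambda>b. d (shear c b)"], simp)
    then show "\<forall>b\<in>shear c ` B. d b = 0" by blast
  next
    fix f
    from B(1) obtain d where d: "shear (- c) f - (\<Sum>b\<in>B. ps2_const (d b) * b) \<in> I"
      unfolding quotient_basis_def by blast
    have eq: "f - (\<Sum>b\<in>shear c ` B. ps2_const (d (shear (- c) b)) * b) =
        shear c (shear (- c) f - (\<Sum>b\<in>B. ps2_const (d b) * b))"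
      unfolding sum by simp
    from imageI[OF d, of "shear c"]
    show "\<exists>d. f - (\<Sum>b\<in>shear c ` B. ps2_const (d b) * b) \<in> shear c ` I"
      unfolding eq[symmetric] by (rule exI[of _ "\<lambda>b. d (shear (- c) b)"])
  qed
  with B(2) show ?thesis
    unfolding has_codim_def
    by (intro exI[of _ "shear c ` B"]) (simp add: card_image inj_on_subset[OF inj_shear])
qed

lemma quotient_dim_shear:
  fixes f g :: "'k::field ps2"
  shows
  "quotient_dim (principal (shear c f) + principal (shear c g)) = quotient_dim (principal f + principal g)"
    (is "quotient_dim ?J = quotient_dim ?I")
proof (cases "\<exists>n. has_codim ?I n")
  case True
  then obtain n where n: "has_codim ?I n" by blast
  from has_codim_shear[OF this, of c] have "has_codim ?J n" by (simp only: shear_image_principal_plus)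
  with n show ?thesis by (simp add: quotient_dim_eq)
next
  case False
  have "\<not> has_codim ?J n" for n
  proof
    assume "has_codim ?J n"
    from has_codim_shear[OF this, of "- c"] have "has_codim ?I n" by (simp add: shear_image_principal_plus)
    with False show False by blast
  qed
  with False show ?thesis by (simp add: quotient_dim_infinite)
qed

lemma shear_1 [simp]: "shear c 1 = (1 :: 'k :: comm_ring_1 ps2)"
proof -
  have "shear c (1 * shear (- c) 1) = shear c (shear (- c) (1 :: 'k ps2))" by (simp only: mult_1)
  then show ?thesis by (simp only: shear_mult shear_inverse' mult_1_right)
qed

lemma shear_dvd_1: "f dvd 1 \<Longrightarrow> shear c f dvd 1"
  by (metis dvd_def shear_1 shear_mult)

lemma irreducible_shear:
  fixes f :: "'k::field ps2"
  assumes "irreducible f"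
  shows "irreducible (shear c f)"
proof (rule irreducibleI)
  show "shear c f \<noteq> 0"
    using assms by (metis irreducible_def shear_0 shear_inverse)
  show "\<not> shear c f dvd 1"
    using shear_dvd_1[of "shear c f" "- c"] assms by (auto simp: irreducible_def)
  fix a b assume ab: "shear c f = a * b"
  have "f = shear (- c) (a * b)" by (simp flip: ab)
  then have "f = shear (- c) a * shear (- c) b" by simp
  with assms have "shear (- c) a dvd 1 \<or> shear (- c) b dvd 1" by (auto simp: irreducible_def)
  with shear_dvd_1[of _ c] show "a dvd 1 \<or> b dvd 1" by fastforce
qed

lemma infinite_alg_closed_field: "infinite (UNIV :: 'k::alg_closed_field set)"
proof
  assume fin: "finite (UNIV :: 'k set)"
  define p where "p = (\<Prod>a\<in>(UNIV :: 'k set). [:- a, 1:]) + 1"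
  have "degree (\<Prod>a\<in>(UNIV :: 'k set). [:- a, 1:]) = card (UNIV :: 'k set)"
    by (subst degree_prod_eq_sum_degree) auto
  moreover have "card (UNIV :: 'k set) > 0" using fin by (simp add: card_gt_0_iff)
  ultimately have "degree p > 0" unfolding p_def by (subst degree_add_eq_left) auto
  then obtain z where "poly p z = 0" using alg_closed_imp_poly_has_root by blast
  moreover have "poly (\<Prod>a\<in>(UNIV :: 'k set). [:- a, 1:]) z = 0"
    unfolding poly_prod using fin by (intro prod_zero) auto
  ultimately show False by (simp add: p_def)
qed

lemma ps2_ord_nonzero:
  assumes "f \<noteq> 0"
  shows "\<exists>i j. i + j = ps2_ord f \<and> f $ j $ i \<noteq> 0"
proof -
  from assms obtain j i where "f $ j $ i \<noteq> 0" by (metis fps_ext fps_zero_nth)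
  then have "\<exists>n i j. i + j = n \<and> f $ j $ i \<noteq> 0" by blast
  from LeastI_ex[OF this] show ?thesis unfolding ps2_ord_def .
qed

lemma ps2_nth_below_ord:
  assumes "i + j < ps2_ord f"
  shows "f $ j $ i = 0"
  using not_less_Least[OF assms[unfolded ps2_ord_def]] by blast

text \<open>
  With \<open>m\<close> the order of \<open>f\<close>, the coefficient of \<open>y^m\<close> in \<open>f(x + c y, y)\<close> is the value of the leading
  form of \<open>f\<close> at \<open>(c, 1)\<close>, which is a nonzero polynomial in \<open>c\<close>.
\<close>

lemma generic_shear_regular:
  fixes S :: "'k::alg_closed_field ps2 set"
  assumes S: "finite S" "0 \<notin> S"
  shows "\<exists>c. \<forall>f\<in>S. ps2_regular (ps2_ord f) (shear c f)"
proof -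
  define P where "P = (\<lambda>f :: 'k ps2. \<Sum>l\<le>ps2_ord f. monom (f $ (ps2_ord f - l) $ l) l)"
  have cP: "coeff (P f) l = (if l \<le> ps2_ord f then f $ (ps2_ord f - l) $ l else 0)" for f l
    by (simp add: P_def coeff_sum)
  have P: "P f \<noteq> 0" if "f \<in> S" for f
  proof -
    have "f \<noteq> 0" using that S(2) by auto
    from ps2_ord_nonzero[OF this] obtain i j where ij: "i + j = ps2_ord f" "f $ j $ i \<noteq> 0" by blast
    then have "ps2_ord f - i = j" "i \<le> ps2_ord f" by auto
    with ij have "coeff (P f) i \<noteq> 0" by (simp add: cP)
    then show ?thesis by auto
  qed
  then have "prod P S \<noteq> 0" using S(1) by auto
  then have "finite {c. poly (prod P S) c = 0}" by (rule poly_roots_finite)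
  then obtain c where c: "poly (prod P S) c \<noteq> 0"
    using infinite_alg_closed_field ex_new_if_finite by blast
  have "ps2_regular (ps2_ord f) (shear c f)" if "f \<in> S" for f
    unfolding ps2_regular_def
  proof (intro conjI allI impI)
    fix j assume "j < ps2_ord f"
    then show "shear c f $ j $ 0 = 0"
      unfolding shear_nth_nth by (intro sum.neutral) (auto intro!: ps2_nth_below_ord)
  next
    have "poly (P f) c \<noteq> 0" using c that S(1) by (auto simp: poly_prod)
    moreover have "shear c f $ ps2_ord f $ 0 = poly (P f) c"
      by (simp add: shear_nth_nth P_def poly_sum poly_monom mult.commute)
    ultimately show "shear c f $ ps2_ord f $ 0 \<noteq> 0" by simp
  qed
  then show ?thesis by blast
qed

lemma principal_mult_unit:
  fixes f :: "'k::field ps2"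
  assumes "u $ 0 $ 0 \<noteq> 0"
  shows "principal (f * u) = principal f"
proof -
  obtain v where "u * v = 1" using ps2_unit_cancel[OF assms] by blast
  then have "f = f * u * v" by (simp add: mult.assoc)
  then have "f * u dvd f" by (metis dvd_triv_left)
  then show ?thesis by (simp add: principal_eq_iff)
qed

lemma irreducible_times_unit:
  fixes f u :: "'a::idom"
  assumes f: "irreducible f" and u: "u dvd 1"
  shows "irreducible (f * u)"
proof (rule irreducibleI)
  obtain v where uv: "1 = u * v" using u by (rule dvdE)
  show "f * u \<noteq> 0" using f uv by (auto simp: irreducible_def)
  show "\<not> f * u dvd 1" using f dvd_mult_left by (auto simp: irreducible_def)
  fix a b assume "f * u = a * b"
  then have "f * (u * v) = a * (b * v)" by (simp flip: mult.assoc)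
  then have "f = a * (b * v)" by (simp flip: uv)
  with f have "a dvd 1 \<or> b * v dvd 1" by (auto simp: irreducible_def)
  then show "a dvd 1 \<or> b dvd 1" using dvd_mult_left by blast
qed

lemma branch_root_exists:
  fixes f :: "'k::alg_closed_field ps2"
  assumes f: "irreducible f" and reg: "ps2_regular n (shear c f)"
  obtains w a where "branch_root w a" "degree w = n" "principal (shear c f) = principal (fps_of_poly w)"
proof -
  obtain u w where u: "u $ 0 $ 0 \<noteq> 0" "shear c f * u = fps_of_poly w" and w: "weierstrass_poly w" "degree w = n"
    using weierstrass_preparation[OF reg] by blast
  have "u dvd 1" using u(1) by (simp add: ps2_is_unit_iff)
  then have irr: "irreducible (fps_of_poly w)"
    using irreducible_shear[OF f, of c] unfolding u(2)[symmetric]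
    by (intro irreducible_times_unit)
  have "degree w \<noteq> 0"
  proof
    assume "degree w = 0"
    then obtain b where "w = [:b:]" by (rule degree_eq_zeroE)
    with w(1) have "fps_of_poly w = 1" by (simp add: weierstrass_poly_def)
    with irr show False by simp
  qed
  then obtain a where "pev w a = 0"
    using alg_closed_imp_poly_has_root[of "map_poly emb w"] by (auto simp: pev_def)
  with w irr have "branch_root w a" by (simp add: branch_root_def)
  moreover have "principal (shear c f) = principal (fps_of_poly w)"
    using principal_mult_unit[OF u(1), of "shear c f"] u(2) by simp
  ultimately show ?thesis using w(2) that by blast
qed

section \<open>Contact of branches and of reduced curves\<close>

lemma branch_contact_commute: "branch_contact C D = branch_contact D C"
  by (simp add: branch_contact_def intersection_mult_def add.commute mult.commute)

text \<open>
  One general value of \<open>c\<close> serves the three branches at once.  It makes the degrees of the Weierstrass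
  polynomials equal to the multiplicities.
\<close>

theorem branch_contact_strong_triangle:
  fixes C D E :: "'k::alg_closed_field ps2 set"
  assumes "branch C" "branch D" "branch E"
  shows "min (branch_contact C D) (branch_contact D E) \<le> branch_contact C E"
proof -
  from assms obtain f g h where f: "is_curve f C" "irreducible f" and g: "is_curve g D" "irreducible g"
    and h: "is_curve h E" "irreducible h" by (auto simp: branch_def)
  have "0 \<notin> {f, g, h}" using f g h by (auto simp: is_curve_def)
  from generic_shear_regular[OF _ this] obtain c
    where c: "\<forall>f\<in>{f, g, h}. ps2_regular (ps2_ord f) (shear c f)" by auto
  obtain u a where u: "branch_root u a" "degree u = ps2_ord f" "principal (shear c f) = principal (fps_of_poly u)"
    using branch_root_exists[OF f(2)] c by blast
  obtain v b where v: "branch_root v b" "degree v = ps2_ord g" "principal (shear c g) = principal (fps_of_poly v)"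
    using branch_root_exists[OF g(2)] c by blast
  obtain w e where w: "branch_root w e" "degree w = ps2_ord h" "principal (shear c h) = principal (fps_of_poly w)"
    using branch_root_exists[OF h(2)] c by blast
  have bc: "branch_contact A Z = contact_of_sep (sep q z)"
    if "is_curve k A" "is_curve l Z" "branch_root p z" "branch_root q z'" "degree p = ps2_ord k" "degree q = ps2_ord l"
      "principal (shear c k) = principal (fps_of_poly p)" "principal (shear c l) = principal (fps_of_poly q)"
    for A Z :: "'k ps2 set" and k l p q z z'
  proof -
    have "A = principal k" "Z = principal l" using that by (simp_all add: is_curve_def)
    then have "intersection_mult A Z = quotient_dim (principal (fps_of_poly p) + principal (fps_of_poly q))"
      unfolding intersection_mult_def that(7,8)[symmetric] by (simp add: quotient_dim_shear)
    moreover have "curve_mult A = degree p" "curve_mult Z = degree q"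
      using that by (simp_all add: curve_mult_eq)
    ultimately show ?thesis
      using quotient_dim_eq_contact_of_sep[OF that(3), of q] branch_root.monic[OF that(4)]
        branch_root.degree_pos[OF that(4)] by (simp add: branch_contact_def)
  qed
  have "min (contact_of_sep (sep v a)) (contact_of_sep (sep w b)) \<le> contact_of_sep (sep w a)"
    by (rule contact_of_sep_max[OF _ sep_strong_triangle[OF u(1) v(1) w(1)]]) (simp add: sep_def)
  then show ?thesis
    using bc[OF f(1) g(1) u(1) v(1) u(2) v(2) u(3) v(3)] bc[OF g(1) h(1) v(1) w(1) v(2) w(2) v(3) w(3)]
      bc[OF f(1) h(1) u(1) w(1) u(2) w(2) u(3) w(3)] by simp
qed

theorem proposition5p4:
  fixes C :: "'k::alg_closed_field ps2 set"
    and B :: "nat \<Rightarrow> 'k ps2 set"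
    and k r :: nat
  assumes "k \<ge> 1"
    and "reduced_curve C"
    and "r > 1"
    and "bij_betw B {1..r} (branches C)"
  shows "contact_k k C =
    inf (INF i\<in>{1..r}. contact_k k (B i))
        (INF (i, j)\<in>{1..r} \<times> {1..r}. contact (B i) (B j))"
proof -
  have im: "branches C = B ` {1..r}" using assms(4) by (simp add: bij_betw_def)
  have branch_B: "branch (B i)" if "i \<in> {1..r}" for i
    using that im by (auto simp: branches_def branch_def)
  have branch_W: "branch W" if "W \<in> branch_family k" for W :: "'k ps2 set"
    using that by (simp add: branch_family_def)
  have contact_CW: "contact C W = (INF i\<in>{1..r}. branch_contact (B i) W)" if "branch W" for W
    using that by (simp add: contact_def im branches_branch image_image)
  have one: "1 \<in> {1..r}" using assms(3) by simp
  define m where "m = inf (INF i\<in>{1..r}. contact_k k (B i))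
        (INF (i, j)\<in>{1..r} \<times> {1..r}. contact (B i) (B j))"
  have m_le: "m \<le> branch_contact (B i) (B j)" if "i \<in> {1..r}" "j \<in> {1..r}" for i j
  proof -
    have "m \<le> (INF (i, j)\<in>{1..r} \<times> {1..r}. contact (B i) (B j))" by (simp add: m_def)
    also have "\<dots> \<le> contact (B i) (B j)"
      using that by (intro INF_lower2[of "(i, j)"]) auto
    finally show ?thesis using that branch_B by (simp add: contact_eq_branch_contact)
  qed
  have "contact_k k C \<le> m"
    unfolding contact_k_def
  proof (rule SUP_least)
    fix W :: "'k ps2 set" assume W: "W \<in> branch_family k"
    have le: "contact C W \<le> branch_contact (B i) W" if "i \<in> {1..r}" for i
      unfolding contact_CW[OF branch_W[OF W]] using that by (rule INF_lower)
    have "contact C W \<le> contact_k k (B i)" if "i \<in> {1..r}" for i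
    proof -
      have "contact C W \<le> contact (B i) W"
        using le[OF that] branch_B[OF that] branch_W[OF W] by (simp add: contact_eq_branch_contact)
      also have "\<dots> \<le> contact_k k (B i)" unfolding contact_k_def using W by (rule SUP_upper)
      finally show ?thesis .
    qed
    moreover have "contact C W \<le> contact (B i) (B j)" if "i \<in> {1..r}" "j \<in> {1..r}" for i j
    proof -
      have "contact C W \<le> min (branch_contact (B i) W) (branch_contact W (B j))"
        using le that by (simp add: branch_contact_commute[of W])
      also have "\<dots> \<le> branch_contact (B i) (B j)"
        using that by (intro branch_contact_strong_triangle branch_B branch_W[OF W])
      finally show ?thesis using that branch_B by (simp add: contact_eq_branch_contact)
    qed
    ultimately show "contact C W \<le> m"
      unfolding m_def by (intro le_infI INF_greatest) auto
  qed
  moreover have "m \<le> contact_k k C"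
  proof (rule ccontr)
    assume "\<not> m \<le> contact_k k C"
    then have less: "contact_k k C < m" by simp
    also have "m \<le> (INF i\<in>{1..r}. contact_k k (B i))" by (simp add: m_def)
    also have "\<dots> \<le> contact_k k (B 1)" using one by (rule INF_lower)
    \<comment> \<open>a branch that is close to the first branch, and hence to all of them\<close>
    finally obtain W where W: "W \<in> branch_family k" "contact_k k C < contact (B 1) W"
      unfolding contact_k_def[of k "B 1"] less_SUP_iff by blast
    have "contact_k k C < branch_contact (B i) W" if "i \<in> {1..r}" for i
    proof -
      have "contact_k k C < min (branch_contact (B i) (B 1)) (branch_contact (B 1) W)"
        using less m_le[OF that one] W branch_B[OF one] branch_W[OF W(1)]
        by (simp add: contact_eq_branch_contact less_le_trans)
      also have "\<dots> \<le> branch_contact (B i) W"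
        using that one by (intro branch_contact_strong_triangle branch_B branch_W[OF W(1)])
      finally show ?thesis .
    qed
    \<comment> \<open>the infimum over finitely many branches is attained\<close>
    moreover have "contact C W \<in> (\<lambda>i. branch_contact (B i) W) ` {1..r}"
    proof -
      have "finite ((\<lambda>i. branch_contact (B i) W) ` {1..r})" "(\<lambda>i. branch_contact (B i) W) ` {1..r} \<noteq> {}"
        using one by auto
      from Min_in[OF this] Min_Inf[OF this] show ?thesis
        unfolding contact_CW[OF branch_W[OF W(1)]] by simp
    qed
    ultimately have "contact_k k C < contact C W" by auto
    moreover have "contact C W \<le> contact_k k C"
      unfolding contact_k_def using W(1) by (rule SUP_upper)
    ultimately show False by simp
  qed
  ultimately show ?thesis unfolding m_def by (rule antisym)
qed

end
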